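(* Let $A \subseteq \{0,1\}^*$ be a random oracle, i.e. each binary string is included in $A$ independently with probability $1/2$. Then with probability $1$ it holds that $\mathrm{UP}^A \not\subseteq \mathrm{QSZK}^A$.
   Context: An oracle is a set $A \subseteq \{0,1\}^*$ of binary strings to which membership queries are available at unit cost. $\mathrm{UP}^A$ is the class of languages $L$ for which there is a polynomial-time nondeterministic oracle Turing machine $M$ with oracle $A$ such that $M$ has exactly one accepting computation path on every input $x \in L$ and no accepting computation path on every input $x \notin L$. $\mathrm{QSZK}^A$ is the class of languages having honest-verifier quantum statistical zero-knowledge interactive proof systems relative to $A$: a polynomial-time uniform family of quantum verifier circuits (which may contain query gates to $A$, where a query gate for $n$-bit strings acts as $|x\rangle|a\rangle \mapsto |x\rangle|a \oplus [x\in A]\rangle$) interacting with a prover (which may also query $A$), such that on inputs in $L$ some prover makes the verifier accept with high probability, on inputs not in $L$ every prover makes it accept with only small probability, and on inputs in $L$ the view of the (unitarily purified) verifier has negligible trace distance to a state produced by a polynomial-time uniform family of relativized quantum circuits that do not interact with a prover. (Equivalently, $L \in \mathrm{QSZK}^A$ iff there is a polynomial-time uniform family of pairs of relativized quantum circuits $(Q_0^x, Q_1^x)$, taking no input and producing states $\rho_0^x(A),\rho_1^x(A)$ on the same number of qubits when queries are answered according to $A$, with $\frac12\|\rho_0^x(A)-\rho_1^x(A)\|_1 \ge 2/3$ for $x\in L$ and $\le 1/3$ for $x \notin L$.) *)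

theory Defs
  imports
    "HOL-Probability.Probability"
    "HOL-Computational_Algebra.Fundamental_Theorem_Algebra"
    "Jordan_Normal_Form.Schur_Decomposition"
begin

unbundle no vec_syntax

type_synonym language = "bool list set"

section \<open>Nondeterministic oracle Turing machines\<close>

text \<open>
  Multi-tape machines with two-way infinite tapes. Tape 0 holds the input; tape 1 is the query tape
  of an oracle machine and the output tape of a transducer; the others are work tapes. A tape is
  given by its contents and its head position. The transition table is a finite list, so only
  finitely many states and symbols are ever in use.
\<close>

datatype symbol = Blank | Bit bool | Aux nat

datatype move = MoveLeft | Stay | MoveRight

record otm =
  work_tapes :: nat
  start_state :: nat
  accept_state :: nat
  query_state :: nat
  yes_state :: nat
  no_state :: nat
  transitions :: "((nat \<times> symbol list) \<times> (nat \<times> (symbol \<times> move) list)) list"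

type_synonym tape = "(int \<Rightarrow> symbol) \<times> int"

type_synonym config = "nat \<times> tape list"

fun offset :: "move \<Rightarrow> int" where
  "offset MoveLeft = -1"
| "offset Stay = 0"
| "offset MoveRight = 1"

definition read_tape :: "tape \<Rightarrow> symbol" where
  "read_tape t = fst t (snd t)"

definition act_tape :: "symbol \<times> move \<Rightarrow> tape \<Rightarrow> tape" where
  "act_tape a t = ((fst t)(snd t := fst a), snd t + offset (snd a))"

definition blank_tape :: tape where
  "blank_tape = (\<lambda>_. Blank, 0)"

definition input_tape :: "bool list \<Rightarrow> tape" where
  "input_tape x = (\<lambda>i. if 0 \<le> i \<and> i < int (length x) then Bit (x ! nat i) else Blank, 0)"

text \<open>The binary word written in the cells 0, 1, 2, ... up to the first cell not holding a bit.\<close>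

definition tape_word :: "tape \<Rightarrow> bool list" where
  "tape_word t =
     map (\<lambda>i. fst t (int i) = Bit True) [0..<(LEAST i. fst t (int i) \<notin> range Bit)]"

definition initial_config :: "otm \<Rightarrow> bool list \<Rightarrow> config" where
  "initial_config M x = (start_state M, input_tape x # replicate (Suc (work_tapes M)) blank_tape)"

text \<open>
  The accepting state is halting. A configuration without successor in any other state halts
  without accepting. Distinct applicable transitions lead to distinct configurations, so that
  computation paths may be identified with sequences of configurations.
\<close>

definition step :: "language \<Rightarrow> otm \<Rightarrow> config \<Rightarrow> config \<Rightarrow> bool" where
  "step A M c c' \<longleftrightarrow>
     fst c \<noteq> accept_state M \<and>
     (if fst c = query_state M
      then c' = (if tape_word (snd c ! 1) \<in> A then yes_state M else no_state M, snd c)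
      else \<exists>q acts. ((fst c, map read_tape (snd c)), (q, acts)) \<in> set (transitions M) \<and>
             length acts = length (snd c) \<and> c' = (q, map2 act_tape acts (snd c)))"

definition computation_path :: "language \<Rightarrow> otm \<Rightarrow> bool list \<Rightarrow> config list \<Rightarrow> bool" where
  "computation_path A M x cs \<longleftrightarrow>
     cs \<noteq> [] \<and> hd cs = initial_config M x \<and> successively (step A M) cs"

definition accepting_path :: "language \<Rightarrow> otm \<Rightarrow> bool list \<Rightarrow> config list \<Rightarrow> bool" where
  "accepting_path A M x cs \<longleftrightarrow> computation_path A M x cs \<and> fst (last cs) = accept_state M"

definition polynomial_time :: "language \<Rightarrow> otm \<Rightarrow> bool" where
  "polynomial_time A M \<longleftrightarrow>
     (\<exists>p :: nat poly. \<forall>x cs. computation_path A M x cs \<longrightarrow> length cs \<le> poly p (length x))"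

definition UP :: "language \<Rightarrow> language set" where
  "UP A = {L. \<exists>M. polynomial_time A M \<and>
                (\<forall>x\<in>L. \<exists>!cs. accepting_path A M x cs) \<and>
                (\<forall>x. x \<notin> L \<longrightarrow> (\<nexists>cs. accepting_path A M x cs))}"

text \<open>
  Polynomial-time computable functions. The empty oracle gives ordinary, unrelativized
  deterministic machines.
\<close>

definition polytime_computable :: "(bool list \<Rightarrow> bool list) \<Rightarrow> bool" where
  "polytime_computable f \<longleftrightarrow>
     (\<exists>M. single_valued (set (transitions M)) \<and> polynomial_time {} M \<and>
          (\<forall>x. \<exists>cs. accepting_path {} M x cs \<and> tape_word (snd (last cs) ! 1) = f x))"

section \<open>Relativized quantum circuits\<close>

text \<open>
  The computational basis of \<open>n\<close> qubits is indexed by the numbers below \<open>2 ^ n\<close>, qubit \<open>j\<close>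
  having the value \<open>bit k j\<close> in the basis state \<open>k\<close>. \<open>Phase\<close> is the gate diag(1, i); together with
  Hadamard and Toffoli gates it is universal. \<open>Query qs t\<close> queries the string held by the qubits
  \<open>qs\<close> and adds the answer to qubit \<open>t\<close>.
\<close>

datatype gate =
    Hadamard nat
  | Phase nat
  | Toffoli nat nat nat
  | Query "nat list" nat

type_synonym circuit = "gate list"

fun gate_qubits :: "gate \<Rightarrow> nat list" where
  "gate_qubits (Hadamard q) = [q]"
| "gate_qubits (Phase q) = [q]"
| "gate_qubits (Toffoli a b t) = [a, b, t]"
| "gate_qubits (Query qs t) = qs @ [t]"

definition circuit_on :: "nat \<Rightarrow> circuit \<Rightarrow> bool" where
  "circuit_on n C \<longleftrightarrow>
     (\<forall>g\<in>set C. distinct (gate_qubits g) \<and> (\<forall>q\<in>set (gate_qubits g). q < n))"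

fun gate_entry :: "language \<Rightarrow> gate \<Rightarrow> nat \<Rightarrow> nat \<Rightarrow> complex" where
  "gate_entry A (Hadamard q) r c =
     (if r = c \<or> r = flip_bit q c
      then (if bit r q \<and> bit c q then -1 else 1) / complex_of_real (sqrt 2) else 0)"
| "gate_entry A (Phase q) r c = (if r = c then (if bit c q then \<i> else 1) else 0)"
| "gate_entry A (Toffoli a b t) r c =
     (if r = (if bit c a \<and> bit c b then flip_bit t c else c) then 1 else 0)"
| "gate_entry A (Query qs t) r c =
     (if r = (if map (bit c) qs \<in> A then flip_bit t c else c) then 1 else 0)"

definition gate_mat :: "language \<Rightarrow> nat \<Rightarrow> gate \<Rightarrow> complex mat" where
  "gate_mat A n g = Matrix.mat (2 ^ n) (2 ^ n) (\<lambda>(r, c). gate_entry A g r c)"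

definition circuit_mat :: "language \<Rightarrow> nat \<Rightarrow> circuit \<Rightarrow> complex mat" where
  "circuit_mat A n C = fold (\<lambda>g U. gate_mat A n g * U) C (1\<^sub>m (2 ^ n))"

definition zero_state :: "nat \<Rightarrow> complex Matrix.vec" where
  "zero_state n = unit_vec (2 ^ n) 0"

text \<open>The density matrix of the first \<open>k\<close> of \<open>n\<close> qubits in the pure state \<open>\<psi>\<close>.\<close>

definition reduced_state :: "nat \<Rightarrow> nat \<Rightarrow> complex Matrix.vec \<Rightarrow> complex mat" where
  "reduced_state n k \<psi> =
     Matrix.mat (2 ^ k) (2 ^ k)
       (\<lambda>(r, c). \<Sum>e<2 ^ (n - k). \<psi> $ (r + 2 ^ k * e) * cnj (\<psi> $ (c + 2 ^ k * e)))"

text \<open>The sum of the singular values, i.e. the trace of the square root of \<open>X\<^sup>\<dagger> X\<close>.\<close>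

definition trace_norm :: "complex mat \<Rightarrow> real" where
  "trace_norm X = (\<Sum>e\<in>#proots (char_poly (mat_adjoint X * X)). sqrt (Re e))"

definition trace_distance :: "complex mat \<Rightarrow> complex mat \<Rightarrow> real" where
  "trace_distance \<rho> \<sigma> = trace_norm (\<rho> - \<sigma>) / 2"

definition unitary_mat :: "nat \<Rightarrow> complex mat \<Rightarrow> bool" where
  "unitary_mat d U \<longleftrightarrow> U \<in> carrier_mat d d \<and> mat_adjoint U * U = 1\<^sub>m d"

section \<open>Honest-verifier quantum statistical zero-knowledge proof systems\<close>

text \<open>
  The circuits \<open>V\<^sub>0, \<dots>, V\<^sub>r\<close> of a verifier alternate with \<open>r\<close> moves of the prover, starting and
  ending with the verifier, so that \<open>2 * r\<close> messages are exchanged. The verifier's private qubits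
  come first, followed by the message qubits and then the prover's private qubits.
\<close>

record verifier =
  private_qubits :: nat
  message_qubits :: nat
  circuits :: "circuit list"

definition verifier_qubits :: "verifier \<Rightarrow> nat" where
  "verifier_qubits V = private_qubits V + message_qubits V"

definition rounds :: "verifier \<Rightarrow> nat" where
  "rounds V = length (circuits V) - 1"

definition valid_verifier :: "verifier \<Rightarrow> bool" where
  "valid_verifier V \<longleftrightarrow>
     private_qubits V \<ge> 1 \<and> circuits V \<noteq> [] \<and>
     (\<forall>C\<in>set (circuits V). circuit_on (verifier_qubits V) C)"

text \<open>
  A prover consists of the number of its private qubits and one unitary operator on the message
  qubits and its private qubits for each of its moves. These operators are arbitrary, hence may
  depend on the input and the oracle in any way.
\<close>

type_synonym prover = "nat \<times> (nat \<Rightarrow> complex mat)"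

definition valid_prover :: "verifier \<Rightarrow> prover \<Rightarrow> bool" where
  "valid_prover V P \<longleftrightarrow> (\<forall>i. unitary_mat (2 ^ (message_qubits V + fst P)) (snd P i))"

definition total_qubits :: "verifier \<Rightarrow> prover \<Rightarrow> nat" where
  "total_qubits V P = verifier_qubits V + fst P"

text \<open>The operator acting as \<open>U\<close> on all of the \<open>n\<close> qubits but the first \<open>v\<close>.\<close>

definition extend_mat :: "nat \<Rightarrow> nat \<Rightarrow> complex mat \<Rightarrow> complex mat" where
  "extend_mat v n U =
     Matrix.mat (2 ^ n) (2 ^ n)
       (\<lambda>(r, c). if r mod 2 ^ v = c mod 2 ^ v then U $$ (r div 2 ^ v, c div 2 ^ v) else 0)"

text \<open>
  The joint state after \<open>j\<close> moves of either party, which for \<open>j \<le> 2 * rounds V\<close> is the state after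
  \<open>j\<close> messages.
\<close>

primrec joint_state :: "language \<Rightarrow> verifier \<Rightarrow> prover \<Rightarrow> nat \<Rightarrow> complex Matrix.vec" where
  "joint_state A V P 0 = zero_state (total_qubits V P)"
| "joint_state A V P (Suc j) =
     (if even j then circuit_mat A (total_qubits V P) (circuits V ! (j div 2))
      else extend_mat (private_qubits V) (total_qubits V P) (snd P (j div 2)))
     *\<^sub>v joint_state A V P j"

definition view :: "language \<Rightarrow> verifier \<Rightarrow> prover \<Rightarrow> nat \<Rightarrow> complex mat" where
  "view A V P j = reduced_state (total_qubits V P) (verifier_qubits V) (joint_state A V P j)"

text \<open>The verifier accepts iff measuring its qubit 0 after its last move gives 1.\<close>

definition accept_prob :: "language \<Rightarrow> verifier \<Rightarrow> prover \<Rightarrow> real" where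
  "accept_prob A V P =
     (\<Sum>k\<in>{k. k < 2 ^ total_qubits V P \<and> bit k 0}.
        (cmod (joint_state A V P (2 * rounds V + 1) $ k))\<^sup>2)"

text \<open>
  A simulator for \<open>V\<close> is a list of circuits with their numbers of qubits, one for each number of
  messages exchanged. The first \<open>verifier_qubits V\<close> qubits are the output and the others are
  traced out.
\<close>

type_synonym simulator = "(nat \<times> circuit) list"

definition valid_simulator :: "verifier \<Rightarrow> simulator \<Rightarrow> bool" where
  "valid_simulator V S \<longleftrightarrow>
     length S = 2 * rounds V + 1 \<and>
     (\<forall>(n, C)\<in>set S. verifier_qubits V \<le> n \<and> circuit_on n C)"

definition simulated_view :: "language \<Rightarrow> verifier \<Rightarrow> simulator \<Rightarrow> nat \<Rightarrow> complex mat" where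
  "simulated_view A V S j =
     (let (n, C) = S ! j
      in reduced_state n (verifier_qubits V) (circuit_mat A n C *\<^sub>v zero_state n))"

subsection \<open>Uniformity\<close>

text \<open>
  Circuits are described by sequences of numbers, each of them written in unary. Since a
  polynomial-time machine must write down every gate, this entails that sizes are polynomial.
\<close>

definition encode :: "nat list \<Rightarrow> bool list" where
  "encode ns = concat (map (\<lambda>n. replicate n True @ [False]) ns)"

fun gate_code :: "gate \<Rightarrow> nat list" where
  "gate_code (Hadamard q) = [0, q]"
| "gate_code (Phase q) = [1, q]"
| "gate_code (Toffoli a b t) = [2, a, b, t]"
| "gate_code (Query qs t) = [3, length qs] @ qs @ [t]"

definition circuit_code :: "circuit \<Rightarrow> nat list" where
  "circuit_code C = length C # concat (map gate_code C)"

definition verifier_code :: "verifier \<Rightarrow> nat list" where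
  "verifier_code V =
     [private_qubits V, message_qubits V, length (circuits V)] @
     concat (map circuit_code (circuits V))"

definition simulator_code :: "simulator \<Rightarrow> nat list" where
  "simulator_code S = length S # concat (map (\<lambda>(n, C). n # circuit_code C) S)"

definition polytime_uniform :: "('a \<Rightarrow> nat list) \<Rightarrow> (bool list \<Rightarrow> 'a) \<Rightarrow> bool" where
  "polytime_uniform code F \<longleftrightarrow> polytime_computable (\<lambda>x. encode (code (F x)))"

subsection \<open>The class QSZK\<close>

definition negligible :: "(nat \<Rightarrow> real) \<Rightarrow> bool" where
  "negligible \<delta> \<longleftrightarrow> (\<forall>k::nat. \<forall>\<^sub>F n in sequentially. \<bar>\<delta> n\<bar> < 1 / real n ^ k)"

definition QSZK :: "language \<Rightarrow> language set" where
  "QSZK A = {L. \<exists>(V :: bool list \<Rightarrow> verifier) (S :: bool list \<Rightarrow> simulator) \<delta>.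
     (\<forall>x. valid_verifier (V x) \<and> valid_simulator (V x) (S x)) \<and>
     polytime_uniform verifier_code V \<and> polytime_uniform simulator_code S \<and> negligible \<delta> \<and>
     (\<forall>x\<in>L. \<exists>P. valid_prover (V x) P \<and> accept_prob A (V x) P \<ge> 2 / 3 \<and>
        (\<forall>j \<le> 2 * rounds (V x).
           trace_distance (simulated_view A (V x) (S x) j) (view A (V x) P j) \<le> \<delta> (length x))) \<and>
     (\<forall>x. x \<notin> L \<longrightarrow> (\<forall>P. valid_prover (V x) P \<longrightarrow> accept_prob A (V x) P \<le> 1 / 3))}"

section \<open>Random oracles\<close>

definition random_oracle :: "(bool list \<Rightarrow> bool) measure" where
  "random_oracle = (\<Pi>\<^sub>M w\<in>UNIV. measure_pmf (bernoulli_pmf (1 / 2)))"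

end

theory Submission
  imports Defs "HOL-Real_Asymp.Real_Asymp"
begin

text \<open>Why there are many inputs per length: with a single input, a number of witnesses of
  constant mean would leave a constant probability of two witnesses at every length, and uniqueness
  would fail infinitely often. With all \<open>x\<close> of length n there are 2^(2n) pairs (x, w).
  Blocks of q = 2n + k + 2 strings give a mean of 2^-(k+2) witnesses in total, whereas two witnesses
  of one common \<open>x\<close> have expected number at most 2^(3n - 2q) = 2^-(n+2k+4), which is
  summable over n. This balance fixes q.

  Interleaving lets the machine write the query string in a single scan of the input.

  The obstacle is that an honest prover knows \<open>w\<close> and may tell the verifier, so nothing
  bounds the verifier's queries directly. The simulator has no such help: its run under
  \<open>A\<close> is fixed before \<open>w\<close> is planted, and disjoint blocks share its query
  weight. Running the prover made for \<open>B\<close> under \<open>A\<close> is legitimate because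
  provers are arbitrary unitaries.

  There are uncountably many negligible functions; each is eventually below 1/n^K, where K is read
  off the size of the circuits. Only countably many families and thresholds then remain.\<close>

text \<open>
  For \<open>k \<ge> 0\<close> let \<open>L\<^sub>k\<close> be the set of words \<open>x\<close> such that, for some \<open>w\<close> with \<open>|w| = |x| = n\<close>, the oracle
  contains all strings \<open>y 1\<^sup>j\<close> with \<open>j < 2 n + k + 2\<close>, where \<open>y\<close> interleaves \<open>x\<close> and \<open>w\<close>. The
  expected number of pairs of witnesses of a common word is at most \<open>2 \<sqdot> 4\<^sup>-\<^sup>k\<close>, so almost surely some \<open>k\<close>
  has unique witnesses throughout and \<open>L\<^sub>k\<close> is in UP. Yet for each \<open>n\<close> some word of length \<open>n\<close> has a
  witness with probability bounded away from 0.

  Suppose that a proof system is sound on \<open>x\<close> under an oracle \<open>A\<close> without witnesses for \<open>x\<close>, and let \<open>B\<close>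
  be \<open>A\<close> with a witness \<open>w\<close> planted. The planted strings are queried with small weight by the simulator
  under \<open>A\<close> for all but few \<open>w\<close>, hence also under \<open>B\<close> by the hybrid argument; by zero knowledge the
  same is true of the verifier when it talks to the honest prover under \<open>B\<close>. By the hybrid argument
  again, the honest prover for \<open>B\<close> would convince the verifier under \<open>A\<close>, so the system fails under
  \<open>B\<close> for at least half of all \<open>w\<close>. Planting is compatible with the distribution of the oracle up to a
  constant factor, so each of the countably many systems errs at length \<open>n\<close> with probability bounded
  away from 0, conditionally on all strings of length less than \<open>2 n\<close>.
\<close>

section \<open>The trace norm of a Hermitian matrix\<close>

lemma mat_adjoint_carrier: "A \<in> carrier_mat n m \<Longrightarrow> mat_adjoint A \<in> carrier_mat m n"
  by (intro carrier_matI) (simp_all add: mat_adjoint_def)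

lemma dim_mat_adjoint [simp]:
  "dim_row (mat_adjoint A) = dim_col A" "dim_col (mat_adjoint A) = dim_row A"
  by (simp_all add: mat_adjoint_def)

lemma mat_adjoint_index:
  fixes A :: "complex mat"
  shows "i < dim_col A \<Longrightarrow> j < dim_row A \<Longrightarrow> mat_adjoint A $$ (i, j) = cnj (A $$ (j, i))"
  by (simp add: mat_adjoint_def mat_of_rows_index)

lemma mat_adjoint_mult:
  fixes A B :: "complex mat"
  assumes "A \<in> carrier_mat n m" "B \<in> carrier_mat m l"
  shows "mat_adjoint (A * B) = mat_adjoint B * mat_adjoint A"
proof (rule eq_matI)
  note c = mat_adjoint_carrier[OF assms(1)] mat_adjoint_carrier[OF assms(2)]
  show "dim_row (mat_adjoint (A * B)) = dim_row (mat_adjoint B * mat_adjoint A)"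
    "dim_col (mat_adjoint (A * B)) = dim_col (mat_adjoint B * mat_adjoint A)"
    using assms by (auto simp: mat_adjoint_def)
  fix i j assume "i < dim_row (mat_adjoint B * mat_adjoint A)" "j < dim_col (mat_adjoint B * mat_adjoint A)"
  then have ij: "i < l" "j < n" using c by auto
  then show "mat_adjoint (A * B) $$ (i, j) = (mat_adjoint B * mat_adjoint A) $$ (i, j)"
    using assms c by (auto simp: mat_adjoint_index scalar_prod_def intro!: sum.cong)
qed

lemma mat_adjoint_adjoint:
  fixes A :: "complex mat"
  shows "mat_adjoint (mat_adjoint A) = A"
  by (rule eq_matI) (auto simp: mat_adjoint_index)

lemma unitary_mat_mult:
  assumes "unitary_mat d U" "unitary_mat d W"
  shows "unitary_mat d (U * W)"
proof -
  have c: "U \<in> carrier_mat d d" "W \<in> carrier_mat d d"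
    and e: "mat_adjoint U * U = 1\<^sub>m d" "mat_adjoint W * W = 1\<^sub>m d"
    using assms by (auto simp: unitary_mat_def)
  note a = mat_adjoint_carrier[OF c(1)] mat_adjoint_carrier[OF c(2)]
  have "mat_adjoint (U * W) * (U * W) = mat_adjoint W * mat_adjoint U * (U * W)"
    using c by (simp add: mat_adjoint_mult)
  also have "\<dots> = mat_adjoint W * (mat_adjoint U * U) * W"
    using c a by (simp add: assoc_mult_mat[of _ d d _ d _ d] mult_carrier_mat[of _ d d _ d])
  finally show ?thesis using c e a by (simp add: unitary_mat_def)
qed

lemma unitary_mat_right:
  assumes "unitary_mat d U"
  shows "U * mat_adjoint U = 1\<^sub>m d"
  using assms mat_mult_left_right_inverse[OF mat_adjoint_carrier, of U d U] by (auto simp: unitary_mat_def)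

text \<open>Complete \<open>v\<close> to a basis and orthogonalise: Gram-Schmidt keeps the first
  vector. Its output is only orthogonal, so the columns are rescaled, and \<open>c\<close> is the
  factor on \<open>v\<close>.\<close>

lemma unitary_with_first_col:
  fixes v :: "complex Matrix.vec"
  assumes v: "v \<in> carrier_vec n" and v0: "v \<noteq> 0\<^sub>v n"
  shows "\<exists>W c. unitary_mat n W \<and> c \<noteq> 0 \<and> 0 < n \<and> col W 0 = c \<cdot>\<^sub>v v"
proof -
  interpret cof_vec_space n "TYPE(complex)" .
  define b where "b = basis_completion v"
  define ws where "ws = gram_schmidt n b"
  from basis_completion[OF v v0, folded b_def]
  have span_b: "span (set b) = carrier_vec n" and dist_b: "distinct b" 
    and indep: "\<not> lin_dep (set b)" and b: "set b \<subseteq> carrier_vec n" and hdb: "hd b = v" 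
    and len_b: "length b = n" by auto
  have n: "0 < n" using v v0 by (cases n) auto
  from hdb len_b n obtain vs where bv: "b = v # vs" by (cases b, auto)
  from gram_schmidt_result[OF b dist_b indep refl, folded ws_def]
  have ws: "set ws \<subseteq> carrier_vec n" "corthogonal ws" "length ws = n" 
    by (auto simp: len_b)
  from gram_schmidt_hd[OF v, of vs, folded bv] have hdws: "hd ws = v" unfolding ws_def .
  have ws0: "ws ! 0 = v" using hdws ws(3) n by (cases ws) auto
  define g where "g i = (\<Sum>j<n. (cmod (ws ! i $ j))\<^sup>2)" for i
  have wsc: "ws ! i \<in> carrier_vec n" if "i < n" for i using ws that by auto
  have sp: "ws ! i \<bullet>c ws ! i = complex_of_real (g i)" if "i < n" for i
    using wsc[OF that] unfolding g_def scalar_prod_def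
    by (auto simp: complex_norm_square[symmetric] atLeast0LessThan)
  have gpos: "g i > 0" if "i < n" for i
  proof -
    have "g i \<noteq> 0" using corthogonalD[OF ws(2), of i i] ws(3) that sp[OF that] by auto
    moreover have "g i \<ge> 0" unfolding g_def by (intro sum_nonneg) auto
    ultimately show ?thesis by auto
  qed
  define W where "W = Matrix.mat n n (\<lambda>(r, i). ws ! i $ r / complex_of_real (sqrt (g i)))"
  have Wc: "W \<in> carrier_mat n n" by (simp add: W_def)
  have "mat_adjoint W * W = 1\<^sub>m n"
  proof (rule eq_matI)
    fix i j assume "i < dim_row (1\<^sub>m n :: complex mat)" "j < dim_col (1\<^sub>m n :: complex mat)"
    then have ij: "i < n" "j < n" by auto
    have "(mat_adjoint W * W) $$ (i, j) = (\<Sum>r<n. cnj (W $$ (r, i)) * W $$ (r, j))"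
      using ij Wc mat_adjoint_carrier[OF Wc]
      by (auto simp: scalar_prod_def mat_adjoint_index atLeast0LessThan intro!: sum.cong)
    also have "\<dots> = (\<Sum>r<n. ws ! j $ r * cnj (ws ! i $ r)) / (complex_of_real (sqrt (g i)) * complex_of_real (sqrt (g j)))"
      using ij by (simp add: W_def sum_divide_distrib mult.commute)
    also have "(\<Sum>r<n. ws ! j $ r * cnj (ws ! i $ r)) = ws ! j \<bullet>c ws ! i"
      using wsc[OF ij(1)] wsc[OF ij(2)] by (auto simp: scalar_prod_def atLeast0LessThan intro!: sum.cong)
    also have "(ws ! j \<bullet>c ws ! i) / (complex_of_real (sqrt (g i)) * complex_of_real (sqrt (g j))) = (if i = j then 1 else 0)"
    proof (cases "i = j")
      case True
      have "complex_of_real (sqrt (g j)) * complex_of_real (sqrt (g j)) = complex_of_real (g j)"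
        using gpos[OF ij(2)] by (simp flip: of_real_mult)
      then show ?thesis using True sp[OF ij(2)] gpos[OF ij(2)] by simp
    next
      case False
      then show ?thesis using corthogonalD[OF ws(2), of j i] ws(3) ij by auto
    qed
    finally show "(mat_adjoint W * W) $$ (i, j) = 1\<^sub>m n $$ (i, j)" using ij by simp
  qed (use Wc mat_adjoint_carrier[OF Wc] in auto)
  then have "unitary_mat n W" using Wc by (simp add: unitary_mat_def)
  moreover have "col W 0 = (1 / complex_of_real (sqrt (g 0))) \<cdot>\<^sub>v v"
    using n v ws0 by (intro eq_vecI) (auto simp: W_def)
  moreover have "1 / complex_of_real (sqrt (g 0)) \<noteq> 0" using gpos[OF n] by simp
  ultimately show ?thesis using n by blast
qed

text \<open>Deflation: conjugating by a unitary whose first column is an eigenvector clears the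
  first column outside the corner, Hermitian symmetry clears the first row, and the remaining block
  is Hermitian of size \<open>n\<close>.\<close>

lemma hermitian_diagonalization:
  fixes X :: "complex mat"
  assumes "X \<in> carrier_mat n n" "mat_adjoint X = X"
  shows "\<exists>W d. unitary_mat n W \<and>
           mat_adjoint W * X * W = Matrix.mat n n (\<lambda>(i, j). if i = j then complex_of_real (d i) else 0)"
  using assms
proof (induction n arbitrary: X)
  case 0
  then show ?case 
    by (intro exI[of _ "1\<^sub>m 0"]) (auto simp: unitary_mat_def intro!: eq_matI simp: mat_adjoint_def)
next
  case (Suc n)
  note X = Suc.prems
  have "degree (char_poly X) = Suc n" using degree_monic_char_poly[OF X(1)] by simp
  then obtain e where "poly (char_poly X) e = 0"
    using fundamental_theorem_of_algebra[of "char_poly X"] by (auto simp: constant_degree)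
  then have "eigenvalue X e" using eigenvalue_root_char_poly[OF X(1)] by simp
  then obtain v where v: "v \<in> carrier_vec (Suc n)" "v \<noteq> 0\<^sub>v (Suc n)" "X *\<^sub>v v = e \<cdot>\<^sub>v v"
    using X(1) by (auto simp: eigenvalue_def eigenvector_def)
  obtain W c where W: "unitary_mat (Suc n) W" and c: "c \<noteq> 0" "col W 0 = c \<cdot>\<^sub>v v"
    using unitary_with_first_col[OF v(1,2)] by blast
  have Wc: "W \<in> carrier_mat (Suc n) (Suc n)" and WW: "mat_adjoint W * W = 1\<^sub>m (Suc n)"
    using W by (auto simp: unitary_mat_def)
  note Wa = mat_adjoint_carrier[OF Wc]
  define Y where "Y = mat_adjoint W * X * W"
  have Yc: "Y \<in> carrier_mat (Suc n) (Suc n)" using Wc Wa X(1) by (auto simp: Y_def)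
  have Yh: "mat_adjoint Y = Y"
  proof -
    have "mat_adjoint Y = mat_adjoint W * mat_adjoint (mat_adjoint W * X)"
      unfolding Y_def using Wc Wa X(1) by (intro mat_adjoint_mult) auto
    also have "mat_adjoint (mat_adjoint W * X) = X * W"
      using mat_adjoint_mult[OF Wa X(1)] X(2) mat_adjoint_adjoint by simp
    finally show ?thesis unfolding Y_def using assoc_mult_mat[OF Wa X(1) Wc] by simp
  qed
  have Xw: "X *\<^sub>v col W 0 = e \<cdot>\<^sub>v col W 0"
    using v X(1) c by (simp add: mult_mat_vec smult_smult_assoc mult.commute)
  have col0: "Y $$ (i, 0) = (if i = 0 then e else 0)" if i: "i < Suc n" for i
  proof -
    have "Y $$ (i, 0) = col Y 0 $ i" using i Yc by simp
    also have "col Y 0 = (mat_adjoint W * X) *\<^sub>v col W 0"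
      unfolding Y_def using Wc Wa X(1) by (subst col_mult2) auto
    also have "\<dots> = mat_adjoint W *\<^sub>v (e \<cdot>\<^sub>v col W 0)"
      using Wc Wa X(1) Xw col_dim[of W 0] by (subst assoc_mult_mat_vec) auto
    also have "\<dots> = e \<cdot>\<^sub>v (mat_adjoint W *\<^sub>v col W 0)" using Wc Wa col_dim[of W 0] by (subst mult_mat_vec) auto
    also have "mat_adjoint W *\<^sub>v col W 0 = col (mat_adjoint W * W) 0"
      using Wc Wa by (subst col_mult2) auto
    finally show ?thesis using i by (simp add: WW)
  qed
  have Yij: "Y $$ (i, j) = cnj (Y $$ (j, i))" if "i < Suc n" "j < Suc n" for i j
    using mat_adjoint_index[of i Y j] that Yc unfolding Yh by auto
  have row0: "Y $$ (0, j) = (if j = 0 then cnj e else 0)" if "j < Suc n" for j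
    using Yij[of 0 j] col0[of j] that by auto
  \<comment> \<open>The corner entry is its own conjugate, so the eigenvalue is real.\<close>
  have er: "e = complex_of_real (Re e)" using col0[of 0] row0[of 0] by (simp add: complex_eq_iff)
  define Z where "Z = Matrix.mat n n (\<lambda>(i, j). Y $$ (Suc i, Suc j))"
  have Zc: "Z \<in> carrier_mat n n" by (simp add: Z_def)
  have "mat_adjoint Z = Z"
  proof (rule eq_matI)
    fix i j assume "i < dim_row Z" "j < dim_col Z"
    then have "i < n" "j < n" using Zc by auto
    then show "mat_adjoint Z $$ (i, j) = Z $$ (i, j)"
      using Yij[of "Suc j" "Suc i"] by (simp add: mat_adjoint_index Z_def)
  qed (use Zc in auto)
  from Suc.IH[OF Zc this] obtain U d where U: "unitary_mat n U" and
    Ud: "mat_adjoint U * Z * U = Matrix.mat n n (\<lambda>(i, j). if i = j then complex_of_real (d i) else 0)"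
    by blast
  have Uc: "U \<in> carrier_mat n n" and UU: "mat_adjoint U * U = 1\<^sub>m n" using U by (auto simp: unitary_mat_def)
  note Ua = mat_adjoint_carrier[OF Uc]
  let ?I = "1\<^sub>m 1 :: complex mat" and ?z = "0\<^sub>m 1 n :: complex mat" and ?z' = "0\<^sub>m n 1 :: complex mat"
  let ?E = "Matrix.mat 1 1 (\<lambda>_. e)"
  \<comment> \<open>diag(1, U) keeps the eigenvector found and diagonalises the smaller
    block.\<close>
  define B where "B = four_block_mat ?I ?z ?z' U"
  have Bc: "B \<in> carrier_mat (Suc n) (Suc n)" using Uc by (auto simp: B_def)
  have Ba: "mat_adjoint B = four_block_mat ?I ?z ?z' (mat_adjoint U)"
  proof (rule eq_matI)
    fix i j assume "i < dim_row (four_block_mat ?I ?z ?z' (mat_adjoint U))"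
      "j < dim_col (four_block_mat ?I ?z ?z' (mat_adjoint U))"
    then have ij: "i < Suc n" "j < Suc n" using Uc by auto
    then have "mat_adjoint B $$ (i, j) = cnj (B $$ (j, i))" using Bc by (intro mat_adjoint_index) auto
    also have "\<dots> = four_block_mat ?I ?z ?z' (mat_adjoint U) $$ (i, j)"
      using ij Uc by (auto simp: B_def mat_adjoint_index)
    finally show "mat_adjoint B $$ (i, j) = four_block_mat ?I ?z ?z' (mat_adjoint U) $$ (i, j)" .
  qed (use Bc Uc in auto)
  have Yb: "Y = four_block_mat ?E ?z ?z' Z"
  proof (rule eq_matI)
    fix i j assume "i < dim_row (four_block_mat ?E ?z ?z' Z)" "j < dim_col (four_block_mat ?E ?z ?z' Z)"
    then have ij: "i < Suc n" "j < Suc n" using Zc by auto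
    then show "Y $$ (i, j) = four_block_mat ?E ?z ?z' Z $$ (i, j)"
      using col0[of i] row0[of j] by (cases i; cases j) (auto simp: Z_def)
  qed (use Yc Zc in auto)
  have id: "four_block_mat ?I ?z ?z' (1\<^sub>m n) = 1\<^sub>m (Suc n)"
    by (intro eq_matI) auto
  have "mat_adjoint B * B = 1\<^sub>m (Suc n)"
    unfolding Ba unfolding B_def
    by (subst mult_four_block_mat[of _ 1 1 _ n _ n _ _ 1 _ n])
       (use Uc Ua UU id in \<open>auto\<close>)
  then have Bu: "unitary_mat (Suc n) B" using Bc by (simp add: unitary_mat_def)
  have WB: "unitary_mat (Suc n) (W * B)" by (rule unitary_mat_mult[OF W Bu])
  have Bac: "mat_adjoint B \<in> carrier_mat (Suc n) (Suc n)" by (rule mat_adjoint_carrier[OF Bc])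
  have "mat_adjoint (W * B) * X * (W * B) = mat_adjoint B * mat_adjoint W * X * (W * B)"
    using mat_adjoint_mult[OF Wc Bc] by simp
  also have "\<dots> = mat_adjoint B * Y * B"
    unfolding Y_def using Wc Bc X(1) Wa Bac
    by (simp add: assoc_mult_mat[of _ "Suc n" "Suc n" _ "Suc n" _ "Suc n"] mult_carrier_mat[of _ "Suc n" "Suc n" _ "Suc n"])
  also have "mat_adjoint B * Y = four_block_mat ?E ?z ?z' (mat_adjoint U * Z)"
    unfolding Ba unfolding Yb
    by (subst mult_four_block_mat[of _ 1 1 _ n _ n _ _ 1 _ n])
       (use Uc Ua Zc in \<open>auto\<close>)
  also have "\<dots> * B = four_block_mat ?E ?z ?z' (mat_adjoint U * Z * U)"
    unfolding B_def
    by (subst mult_four_block_mat[of _ 1 1 _ n _ n _ _ 1 _ n])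
       (use Uc Ua Zc in \<open>auto\<close>)
  also have "\<dots> = Matrix.mat (Suc n) (Suc n) (\<lambda>(i, j). if i = j then complex_of_real (case_nat (Re e) d i) else 0)"
    unfolding Ud by (intro eq_matI) (auto split: nat.splits simp: er[symmetric])
  finally show ?case using WB by blast
qed

lemma index_mult_mat_sum:
  assumes "A \<in> carrier_mat n m" "B \<in> carrier_mat m l" "i < n" "j < l"
  shows "(A * B) $$ (i, j) = (\<Sum>k<m. A $$ (i, k) * B $$ (k, j))"
  using assms by (auto simp: scalar_prod_def atLeast0LessThan)

text \<open>Since \<open>X\<close> is Hermitian, the matrix in the definition of
  \<open>trace_norm\<close> is \<open>X * X\<close>, with eigenvalues \<open>(d i)\<^sup>2\<close>;
  the square roots of the roots of its characteristic polynomial are therefore the absolute values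
  of the \<open>d i\<close>.\<close>

lemma trace_norm_hermitian:
  assumes X: "X \<in> carrier_mat n n" "mat_adjoint X = X"
  obtains W d where "unitary_mat n W"
    "\<And>i j. i < n \<Longrightarrow> j < n \<Longrightarrow>
       X $$ (i, j) = (\<Sum>m<n. complex_of_real (d m) * W $$ (i, m) * cnj (W $$ (j, m)))"
    "trace_norm X = (\<Sum>m<n. \<bar>d m\<bar>)"
proof -
  obtain W d where W: "unitary_mat n W" and
    e: "mat_adjoint W * X * W = Matrix.mat n n (\<lambda>(i, j). if i = j then complex_of_real (d i) else 0)"
    using hermitian_diagonalization[OF X] by blast
  define D where "D = Matrix.mat n n (\<lambda>(i, j). if i = j then complex_of_real (d i) else 0)"
  define D2 where "D2 = Matrix.mat n n (\<lambda>(i, j). if i = j then complex_of_real ((d i)\<^sup>2) else 0)"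
  have Wc: "W \<in> carrier_mat n n" and WW: "mat_adjoint W * W = 1\<^sub>m n" using W by (auto simp: unitary_mat_def)
  note Wa = mat_adjoint_carrier[OF Wc] and WW' = unitary_mat_right[OF W]
  have Dc: "D \<in> carrier_mat n n" "D2 \<in> carrier_mat n n" by (auto simp: D_def D2_def)
  note c = Wc Wa Dc X(1)
  note as = assoc_mult_mat[of _ n n _ n _ n] mult_carrier_mat[of _ n n _ n]
  have "W * D * mat_adjoint W = (W * mat_adjoint W) * X * (W * mat_adjoint W)"
    unfolding D_def e[symmetric] using c by (simp add: as)
  then have Xe: "X = W * D * mat_adjoint W" using c by (simp add: WW')
  have DD: "D * D = D2"
  proof (rule eq_matI)
    fix i j assume "i < dim_row D2" "j < dim_col D2"
    then have ij: "i < n" "j < n" using Dc by auto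
    have "(D * D) $$ (i, j) = (\<Sum>m<n. D $$ (i, m) * D $$ (m, j))"
      using ij Dc by (auto simp: scalar_prod_def atLeast0LessThan)
    also have "\<dots> = (\<Sum>m<n. if m = i then D $$ (i, m) * D $$ (m, j) else 0)"
      using ij by (intro sum.cong) (auto simp: D_def)
    also have "\<dots> = D2 $$ (i, j)" using ij by (auto simp: D_def D2_def power2_eq_square)
    finally show "(D * D) $$ (i, j) = D2 $$ (i, j)" .
  qed (use Dc in auto)
  have "X * X = W * D * (mat_adjoint W * W) * D * mat_adjoint W"
    unfolding Xe using c by (simp add: as)
  also have "\<dots> = W * D2 * mat_adjoint W" using c by (simp add: WW as DD[symmetric])
  finally have XX: "X * X = W * D2 * mat_adjoint W" .
  have "similar_mat (X * X) D2"
    by (rule similar_matI[of _ _ W "mat_adjoint W" n]) (use c WW WW' XX in auto)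
  then have "char_poly (X * X) = char_poly D2" by (rule char_poly_similar)
  also have "\<dots> = (\<Prod>a \<leftarrow> diag_mat D2. [:- a, 1:])"
    by (rule char_poly_upper_triangular[OF Dc(2)]) (auto simp: D2_def)
  also have "diag_mat D2 = map (\<lambda>i. complex_of_real ((d i)\<^sup>2)) [0..<n]"
    by (auto simp: diag_mat_def D2_def)
  finally have cp: "char_poly (X * X) = (\<Prod>a \<leftarrow> map (\<lambda>i. complex_of_real ((d i)\<^sup>2)) [0..<n]. [:- a, 1:])" .
  have pr: "proots (\<Prod>a \<leftarrow> as. [:- a, 1:]) = mset as" for as :: "complex list"
  proof (induction as)
    case (Cons a as)
    have "(\<Prod>a \<leftarrow> as. [:- a, 1:]) \<noteq> 0" by (auto simp: prod_list_zero_iff)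
    then show ?case using Cons by (simp add: proots_mult del: mult_pCons_left)
  qed simp
  have "trace_norm X = (\<Sum>i\<in>#mset [0..<n]. \<bar>d i\<bar>)"
    unfolding trace_norm_def X(2) cp pr by (simp add: image_mset.compositionality o_def)
  also have "\<dots> = (\<Sum>m<n. \<bar>d m\<bar>)"
    by (simp add: sum_unfold_sum_mset atLeast0LessThan)
  finally have tn: "trace_norm X = (\<Sum>m<n. \<bar>d m\<bar>)" .
  have "X $$ (i, j) = (\<Sum>m<n. complex_of_real (d m) * W $$ (i, m) * cnj (W $$ (j, m)))"
    if ij: "i < n" "j < n" for i j
  proof -
    have wd: "(W * D) $$ (i, m) = complex_of_real (d m) * W $$ (i, m)" if "m < n" for m
    proof -
      have "(W * D) $$ (i, m) = (\<Sum>l<n. W $$ (i, l) * D $$ (l, m))"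
        using ij that c by (auto simp: scalar_prod_def atLeast0LessThan)
      also have "\<dots> = (\<Sum>l<n. if l = m then W $$ (i, l) * D $$ (l, m) else 0)"
        using that by (intro sum.cong) (auto simp: D_def)
      also have "\<dots> = complex_of_real (d m) * W $$ (i, m)" using that by (simp add: D_def)
      finally show ?thesis .
    qed
    have "X $$ (i, j) = (\<Sum>m<n. (W * D) $$ (i, m) * mat_adjoint W $$ (m, j))"
      by (subst Xe, rule index_mult_mat_sum[of _ n n _ n]) (use ij c in auto)
    also have "\<dots> = (\<Sum>m<n. complex_of_real (d m) * W $$ (i, m) * cnj (W $$ (j, m)))"
      using ij Wc by (intro sum.cong) (auto simp: wd mat_adjoint_index)
    finally show ?thesis .
  qed
  with W tn show thesis by (intro that)
qed

lemma unitary_mat_norm: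
  assumes "unitary_mat n U"
  shows "(\<Sum>r<n. (cmod (\<Sum>c<n. U $$ (r, c) * v c))\<^sup>2) = (\<Sum>c<n. (cmod (v c))\<^sup>2)"
proof -
  have Uc: "U \<in> carrier_mat n n" and UU: "mat_adjoint U * U = 1\<^sub>m n" using assms by (auto simp: unitary_mat_def)
  have orth: "(\<Sum>r<n. U $$ (r, c) * cnj (U $$ (r, c'))) = (if c = c' then 1 else 0)"
    if "c < n" "c' < n" for c c'
  proof -
    have "(mat_adjoint U * U) $$ (c', c) = (\<Sum>r<n. cnj (U $$ (r, c')) * U $$ (r, c))"
      using that Uc by (auto simp: scalar_prod_def mat_adjoint_index atLeast0LessThan intro!: sum.cong)
    then show ?thesis using that by (cases "c = c'") (simp_all add: UU mult.commute)
  qed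
  have "complex_of_real (\<Sum>r<n. (cmod (\<Sum>c<n. U $$ (r, c) * v c))\<^sup>2) =
      (\<Sum>r<n. \<Sum>c<n. \<Sum>c'<n. v c * cnj (v c') * (U $$ (r, c) * cnj (U $$ (r, c'))))"
    by (auto simp: complex_norm_square sum_product algebra_simps simp del: of_real_power intro!: sum.cong)
  also have "\<dots> = (\<Sum>c<n. \<Sum>r<n. \<Sum>c'<n. v c * cnj (v c') * (U $$ (r, c) * cnj (U $$ (r, c'))))"
    by (rule sum.swap)
  also have "\<dots> = (\<Sum>c<n. \<Sum>c'<n. \<Sum>r<n. v c * cnj (v c') * (U $$ (r, c) * cnj (U $$ (r, c'))))"
    by (intro sum.cong refl sum.swap)
  also have "\<dots> = (\<Sum>c<n. \<Sum>c'<n. if c' = c then v c * cnj (v c') else 0)"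
    by (intro sum.cong) (auto simp: sum_distrib_left[symmetric] orth)
  also have "\<dots> = complex_of_real (\<Sum>c<n. (cmod (v c))\<^sup>2)"
    by (simp add: complex_norm_square del: of_real_power)
  finally show ?thesis by (simp only: of_real_eq_iff)
qed

text \<open>The sum is the trace of \<open>K\<^sup>\<dagger> K X\<close>, where \<open>K\<close> is a contraction.\<close>

lemma trace_norm_bound:
  assumes X: "X \<in> carrier_mat n n" "mat_adjoint X = X" and R: "finite R"
    and K: "\<And>v. (\<Sum>r\<in>R. (cmod (\<Sum>c<n. K r c * v c))\<^sup>2) \<le> (\<Sum>c<n. (cmod (v c))\<^sup>2)"
  shows "cmod (\<Sum>r\<in>R. \<Sum>c<n. \<Sum>c'<n. K r c * cnj (K r c') * X $$ (c, c')) \<le> trace_norm X"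
proof -
  obtain W d where W: "unitary_mat n W" and
    Xe: "\<And>i j. i < n \<Longrightarrow> j < n \<Longrightarrow>
       X $$ (i, j) = (\<Sum>m<n. complex_of_real (d m) * W $$ (i, m) * cnj (W $$ (j, m)))"
    and tn: "trace_norm X = (\<Sum>m<n. \<bar>d m\<bar>)"
    using trace_norm_hermitian[OF X] by blast
  have one: "(\<Sum>c<n. (cmod (W $$ (c, m)))\<^sup>2) = 1" if "m < n" for m
  proof -
    have "(\<Sum>c<n. (cmod (\<Sum>c'<n. W $$ (c, c') * (if c' = m then 1 else 0)))\<^sup>2) = (\<Sum>c<n. (cmod (if c = m then 1 else 0))\<^sup>2)"
      by (rule unitary_mat_norm[OF W])
    then show ?thesis using that by (simp add: if_distrib[of "\<lambda>x. _ * x"] if_distrib[of cmod] if_distrib[of "\<lambda>x. x\<^sup>2"] cong: if_cong)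
  qed
  \<comment> \<open>The squared length of the image under \<open>K\<close> of the m-th unit
    eigenvector, hence at most 1. Expanding \<open>X\<close> in its eigenvectors turns the triple
    sum into the sum of the products \<open>d m * s m\<close>.\<close>
  define s where "s m = (\<Sum>r\<in>R. (cmod (\<Sum>c<n. K r c * W $$ (c, m)))\<^sup>2)" for m
  have s: "0 \<le> s m" "m < n \<Longrightarrow> s m \<le> 1" for m
    using K[of "\<lambda>c. W $$ (c, m)"] one[of m] by (auto simp: s_def intro!: sum_nonneg)
  have sq: "complex_of_real ((cmod (\<Sum>c<n. a c))\<^sup>2) = (\<Sum>c<n. \<Sum>c'<n. a c * cnj (a c'))" for a
    by (simp only: complex_norm_square cnj_sum sum_product)
  have "(\<Sum>r\<in>R. \<Sum>c<n. \<Sum>c'<n. K r c * cnj (K r c') * X $$ (c, c')) =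
    (\<Sum>r\<in>R. \<Sum>c<n. \<Sum>c'<n. \<Sum>m<n. complex_of_real (d m) * ((K r c * W $$ (c, m)) * cnj (K r c' * W $$ (c', m))))"
    by (intro sum.cong refl) (simp add: Xe sum_distrib_left algebra_simps)
  also have "\<dots> = (\<Sum>r\<in>R. \<Sum>c<n. \<Sum>m<n. \<Sum>c'<n. complex_of_real (d m) * ((K r c * W $$ (c, m)) * cnj (K r c' * W $$ (c', m))))"
    by (intro sum.cong refl sum.swap)
  also have "\<dots> = (\<Sum>r\<in>R. \<Sum>m<n. \<Sum>c<n. \<Sum>c'<n. complex_of_real (d m) * ((K r c * W $$ (c, m)) * cnj (K r c' * W $$ (c', m))))"
    by (intro sum.cong refl sum.swap)
  also have "\<dots> = (\<Sum>m<n. \<Sum>r\<in>R. \<Sum>c<n. \<Sum>c'<n. complex_of_real (d m) * ((K r c * W $$ (c, m)) * cnj (K r c' * W $$ (c', m))))"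
    by (rule sum.swap)
  also have "\<dots> = (\<Sum>m<n. complex_of_real (d m) * complex_of_real (s m))"
    by (simp only: s_def of_real_sum sq sum_distrib_left)
  finally have "cmod (\<Sum>r\<in>R. \<Sum>c<n. \<Sum>c'<n. K r c * cnj (K r c') * X $$ (c, c')) \<le> (\<Sum>m<n. cmod (complex_of_real (d m) * complex_of_real (s m)))"
    by (simp only: norm_sum)
  also have "\<dots> \<le> (\<Sum>m<n. \<bar>d m\<bar>)"
    using s by (intro sum_mono) (auto simp: norm_mult intro!: mult_left_le)
  finally show ?thesis by (simp add: tn)
qed

section \<open>Circuits acting on amplitudes\<close>

text \<open>\<open>r + 2 ^ v * e\<close> is the basis state with \<open>r\<close> on the first
  \<open>v\<close> qubits and \<open>e\<close> on the others; the addition has no carries.\<close>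

lemma bit_add_high:
  fixes r e :: nat
  assumes "r < 2 ^ v"
  shows "bit (r + 2 ^ v * e) m \<longleftrightarrow> (if m < v then bit r m else bit e (m - v))"
proof -
  have "take_bit v (r + 2 ^ v * e) = r" using assms by (simp add: take_bit_eq_mod)
  then have low: "bit (r + 2 ^ v * e) m \<longleftrightarrow> bit r m" if "m < v"
    using that bit_take_bit_iff[of v "r + 2 ^ v * e" m] by simp
  have "drop_bit v (r + 2 ^ v * e) = e" using assms by (simp add: drop_bit_eq_div)
  then have high: "bit (r + 2 ^ v * e) m \<longleftrightarrow> bit e (m - v)" if "\<not> m < v"
    using that bit_drop_bit_eq[of v "r + 2 ^ v * e"] by (simp add: fun_eq_iff)
  show ?thesis using low high by simp
qed

lemma flip_bit_less: "r < 2 ^ v \<Longrightarrow> q < v \<Longrightarrow> flip_bit q (r :: nat) < 2 ^ v"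
  by (metis take_bit_flip_bit_eq take_bit_nat_eq_self_iff linorder_not_less)

lemma flip_bit_flip_bit: "flip_bit q (flip_bit q r) = (r :: nat)"
  by (rule bit_eqI) (auto simp: bit_flip_bit_iff)

lemma flip_bit_add_high:
  fixes r e :: nat
  assumes "r < 2 ^ v" "q < v"
  shows "flip_bit q (r + 2 ^ v * e) = flip_bit q r + 2 ^ v * e"
  using assms flip_bit_less[OF assms]
  by (intro bit_eqI) (auto simp: bit_flip_bit_iff bit_add_high)

lemma sum_split_qubits:
  fixes f :: "nat \<Rightarrow> 'a :: comm_monoid_add"
  assumes "v \<le> n"
  shows "(\<Sum>c<2 ^ n. f c) = (\<Sum>e<2 ^ (n - v). \<Sum>r<2 ^ v. f (r + 2 ^ v * e))"
proof -
  have n: "(2::nat) ^ n = 2 ^ v * 2 ^ (n - v)" using assms by (simp flip: power_add)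
  have "(\<Sum>e<2 ^ (n - v). \<Sum>r<2 ^ v. f (r + 2 ^ v * e)) =
        (\<Sum>(e, r)\<in>{..<2 ^ (n - v)} \<times> {..<2 ^ v}. f (r + 2 ^ v * e))"
    by (rule sum.cartesian_product)
  also have "\<dots> = (\<Sum>c<2 ^ n. f c)"
  proof (rule sum.reindex_bij_witness[of _ "\<lambda>c. (c div 2 ^ v, c mod 2 ^ v)" "\<lambda>(e, r). r + 2 ^ v * e"])
    fix a :: "nat \<times> nat" assume a: "a \<in> {..<2 ^ (n - v)} \<times> {..<2 ^ v}"
    obtain e r where [simp]: "a = (e, r)" by fastforce
    have "r < 2 ^ v" "e < 2 ^ (n - v)" using a by auto
    then have "r + 2 ^ v * e < 2 ^ v * Suc e" by simp
    also have "\<dots> \<le> 2 ^ v * 2 ^ (n - v)" using \<open>e < 2 ^ (n - v)\<close> by (intro mult_le_mono) auto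
    finally show "(case a of (e, r) \<Rightarrow> r + 2 ^ v * e) \<in> {..<2 ^ n}" by (simp add: n)
    show "((case a of (e, r) \<Rightarrow> r + 2 ^ v * e) div 2 ^ v, (case a of (e, r) \<Rightarrow> r + 2 ^ v * e) mod 2 ^ v) = a"
      using a by auto
  next
    fix b :: nat assume "b \<in> {..<2 ^ n}"
    then have "b div 2 ^ v < 2 ^ (n - v)" by (simp add: n div_less_iff_less_mult mult.commute)
    then show "(b div 2 ^ v, b mod 2 ^ v) \<in> {..<2 ^ (n - v)} \<times> {..<2 ^ v}" by simp
  qed auto
  finally show ?thesis ..
qed

definition gate_on :: "nat \<Rightarrow> gate \<Rightarrow> bool" where
  "gate_on n g \<longleftrightarrow> distinct (gate_qubits g) \<and> (\<forall>q\<in>set (gate_qubits g). q < n)"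

text \<open>
  States are represented by total functions on basis indices: the action of a gate then does not
  depend on the number of qubits, and values beyond the dimension are junk.
\<close>

fun gate_fun :: "language \<Rightarrow> gate \<Rightarrow> (nat \<Rightarrow> complex) \<Rightarrow> nat \<Rightarrow> complex" where
  "gate_fun A (Hadamard q) f r =
     (if bit r q then f (flip_bit q r) - f r else f r + f (flip_bit q r)) / complex_of_real (sqrt 2)"
| "gate_fun A (Phase q) f r = (if bit r q then \<i> else 1) * f r"
| "gate_fun A (Toffoli a b t) f r = f (if bit r a \<and> bit r b then flip_bit t r else r)"
| "gate_fun A (Query qs t) f r = f (if map (bit r) qs \<in> A then flip_bit t r else r)"

lemma map_bit_flip: "t \<notin> set qs \<Longrightarrow> map (bit (flip_bit t (r :: nat))) qs = map (bit r) qs"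
  by (auto simp: bit_flip_bit_iff)

text \<open>For the permutation gates: \<open>h\<close> is the action on basis states and
  \<open>h'\<close> its inverse, so each row of the matrix has a single nonzero entry.\<close>

lemma sum_delta_fun:
  fixes f :: "nat \<Rightarrow> complex"
  assumes "\<And>c. c < N \<Longrightarrow> r = h c \<longleftrightarrow> c = h' r" "h' r < N"
  shows "(\<Sum>c<N. (if r = h c then 1 else 0) * f c) = f (h' r)"
proof -
  have "(\<Sum>c<N. (if r = h c then 1 else 0) * f c) = (\<Sum>c<N. if c = h' r then f c else 0)"
    using assms(1) by (intro sum.cong) auto
  then show ?thesis using assms(2) by simp
qed

text \<open>Every gate matrix is symmetric (Toffoli and query gates are involutions, as the target
  is not among the qubits they read), which is why \<open>gate_fun\<close> can read the input
  amplitude at the flipped index.\<close>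

lemma gate_entry_sum:
  assumes g: "gate_on n g" and r: "r < 2 ^ n"
  shows "(\<Sum>c<2 ^ n. gate_entry A g r c * f c) = gate_fun A g f r"
proof (cases g)
  case (Hadamard q)
  have q: "q < n" using g Hadamard by (simp add: gate_on_def)
  have fl: "flip_bit q r < 2 ^ n" using flip_bit_less[OF r q] .
  have ne: "flip_bit q r \<noteq> r" using bit_flip_bit_iff[of q r q] by auto
  have iff: "r = flip_bit q c \<longleftrightarrow> c = flip_bit q r" for c by (metis flip_bit_flip_bit)
  have "(\<Sum>c<2 ^ n. gate_entry A g r c * f c) =
    (\<Sum>c\<in>{r, flip_bit q r}. gate_entry A g r c * f c)"
    using r fl iff by (intro sum.mono_neutral_right) (auto simp: Hadamard)
  also have "\<dots> = gate_fun A g f r"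
    using ne by (cases "bit r q") (simp_all add: Hadamard bit_flip_bit_iff flip_bit_flip_bit diff_divide_distrib add_divide_distrib)
  finally show ?thesis .
next
  case (Phase q)
  have "(\<Sum>c<2 ^ n. gate_entry A g r c * f c) =
    (\<Sum>c<2 ^ n. if c = r then gate_fun A g f r else 0)"
    by (intro sum.cong) (auto simp: Phase)
  then show ?thesis using r by simp
next
  case (Toffoli a b t)
  have t: "t < n" "t \<noteq> a" "t \<noteq> b" using g Toffoli by (auto simp: gate_on_def)
  have "(r = (if bit c a \<and> bit c b then flip_bit t c else c)) \<longleftrightarrow>
     c = (if bit r a \<and> bit r b then flip_bit t r else r)" for c
    using t by (auto simp: bit_flip_bit_iff flip_bit_flip_bit)
  then show ?thesis unfolding Toffoli gate_entry.simps gate_fun.simps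
    using flip_bit_less[OF r t(1)] r
    by (intro sum_delta_fun[where h = "\<lambda>c. if bit c a \<and> bit c b then flip_bit t c else c"
          and h' = "\<lambda>r. if bit r a \<and> bit r b then flip_bit t r else r"]) auto
next
  case (Query qs t)
  have t: "t < n" "t \<notin> set qs" using g Query by (auto simp: gate_on_def)
  have "(r = (if map (bit c) qs \<in> A then flip_bit t c else c)) \<longleftrightarrow>
     c = (if map (bit r) qs \<in> A then flip_bit t r else r)" for c
    using map_bit_flip[OF t(2)] flip_bit_flip_bit by (metis (full_types))
  then show ?thesis unfolding Query gate_entry.simps gate_fun.simps
    using flip_bit_less[OF r t(1)] r
    by (intro sum_delta_fun[where h = "\<lambda>c. if map (bit c) qs \<in> A then flip_bit t c else c"
          and h' = "\<lambda>r. if map (bit r) qs \<in> A then flip_bit t r else r"]) auto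
qed

lemma gate_fun_cong:
  assumes "gate_on n g" "r < 2 ^ n" "\<And>c. c < 2 ^ n \<Longrightarrow> f c = h c"
  shows "gate_fun A g f r = gate_fun A g h r"
proof -
  have "gate_fun A g f r = (\<Sum>c<2 ^ n. gate_entry A g r c * f c)" using gate_entry_sum[OF assms(1,2), of A f] by simp
  also have "\<dots> = (\<Sum>c<2 ^ n. gate_entry A g r c * h c)" using assms by (intro sum.cong) auto
  also have "\<dots> = gate_fun A g h r" using gate_entry_sum[OF assms(1,2), of A h] by simp
  finally show ?thesis .
qed

lemma gate_fun_diff: "gate_fun A g (\<lambda>c. f c - h c) r = gate_fun A g f r - gate_fun A g h r"
  by (cases g) (auto simp: diff_divide_distrib add_divide_distrib right_diff_distrib)

lemma gate_fun_add_high: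
  assumes g: "gate_on v g" and r: "r < 2 ^ v"
  shows "gate_fun A g f (r + 2 ^ v * e) = gate_fun A g (\<lambda>c. f (c + 2 ^ v * e)) r"
proof (cases g)
  case (Query qs t)
  have "map (bit (r + 2 ^ v * e)) qs = map (bit r) qs"
    using g r by (auto simp: Query gate_on_def bit_add_high)
  then show ?thesis unfolding Query gate_fun.simps using g r by (simp only:) (simp add: Query gate_on_def flip_bit_add_high)
qed (use g r in \<open>auto simp: gate_on_def bit_add_high flip_bit_add_high\<close>)

lemma sum_involution:
  assumes "\<And>r. r \<in> S \<Longrightarrow> h r \<in> S" "\<And>r. r \<in> S \<Longrightarrow> h (h r) = r"
  shows "(\<Sum>r\<in>S. f (h r)) = (\<Sum>r\<in>S. f r)"
  by (rule sum.reindex_bij_witness[of _ h h]) (use assms in auto)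

lemma gate_fun_norm:
  assumes g: "gate_on n g"
  shows "(\<Sum>r<2 ^ n. (cmod (gate_fun A g f r))\<^sup>2) = (\<Sum>r<2 ^ n. (cmod (f r))\<^sup>2)"
proof (cases g)
  case (Hadamard q)
  have q: "q < n" using g Hadamard by (simp add: gate_on_def)
  have fl: "(\<Sum>r<2 ^ n. h (flip_bit q r)) = (\<Sum>r<2 ^ n. h r)" for h :: "nat \<Rightarrow> real"
    using flip_bit_less q by (intro sum_involution) (auto simp: flip_bit_flip_bit)
  \<comment> \<open>Parallelogram identity for the pair of indices \<open>r\<close>,
    \<open>flip_bit q r\<close>. Summing over all \<open>r\<close> meets each pair twice, hence the
    factor 2 below.\<close>
  have par: "(cmod ((a + b) / complex_of_real (sqrt 2)))\<^sup>2 + (cmod ((a - b) / complex_of_real (sqrt 2)))\<^sup>2 =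
    (cmod a)\<^sup>2 + (cmod b)\<^sup>2" for a b
    by (simp add: norm_divide power_divide cmod_power2) (simp add: power2_eq_square field_simps)
  have pair: "(cmod (gate_fun A g f r))\<^sup>2 + (cmod (gate_fun A g f (flip_bit q r)))\<^sup>2 =
     (cmod (f r))\<^sup>2 + (cmod (f (flip_bit q r)))\<^sup>2" for r
  proof (cases "bit r q")
    case True
    then have "gate_fun A g f r = (f (flip_bit q r) - f r) / complex_of_real (sqrt 2)"
      "gate_fun A g f (flip_bit q r) = (f (flip_bit q r) + f r) / complex_of_real (sqrt 2)"
      by (simp_all add: Hadamard bit_flip_bit_iff flip_bit_flip_bit)
    then show ?thesis using par[of "f (flip_bit q r)" "f r"] by (simp only:)
  next
    case False
    then have "gate_fun A g f r = (f r + f (flip_bit q r)) / complex_of_real (sqrt 2)"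
      "gate_fun A g f (flip_bit q r) = (f r - f (flip_bit q r)) / complex_of_real (sqrt 2)"
      by (simp_all add: Hadamard bit_flip_bit_iff flip_bit_flip_bit)
    then show ?thesis using par[of "f r" "f (flip_bit q r)"] by (simp only:)
  qed
  have "2 * (\<Sum>r<2 ^ n. (cmod (gate_fun A g f r))\<^sup>2) =
    (\<Sum>r<2 ^ n. (cmod (gate_fun A g f r))\<^sup>2) + (\<Sum>r<2 ^ n. (cmod (gate_fun A g f (flip_bit q r)))\<^sup>2)"
    by (simp add: fl[of "\<lambda>r. (cmod (gate_fun A g f r))\<^sup>2"])
  also have "\<dots> = (\<Sum>r<2 ^ n. (cmod (f r))\<^sup>2) + (\<Sum>r<2 ^ n. (cmod (f (flip_bit q r)))\<^sup>2)"
    by (simp only: sum.distrib[symmetric] pair)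
  finally show ?thesis by (simp add: fl[of "\<lambda>r. (cmod (f r))\<^sup>2"])
next
  case (Phase q)
  then show ?thesis by (auto simp: norm_mult intro!: sum.cong)
next
  case (Toffoli a b t)
  have t: "t < n" "t \<noteq> a" "t \<noteq> b" using g Toffoli by (auto simp: gate_on_def)
  show ?thesis unfolding Toffoli gate_fun.simps
    using t flip_bit_less by (intro sum_involution[of _ _ "\<lambda>r. (cmod (f r))\<^sup>2"]) (auto simp: bit_flip_bit_iff flip_bit_flip_bit)
next
  case (Query qs t)
  have t: "t < n" "t \<notin> set qs" using g Query by (auto simp: gate_on_def)
  show ?thesis unfolding Query gate_fun.simps
    using t flip_bit_less
    by (intro sum_involution[of _ _ "\<lambda>r. (cmod (f r))\<^sup>2"]) (auto simp: flip_bit_flip_bit map_bit_flip)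
qed

definition run :: "language \<Rightarrow> circuit \<Rightarrow> (nat \<Rightarrow> complex) \<Rightarrow> nat \<Rightarrow> complex" where
  "run A C = fold (gate_fun A) C"

lemma run_simps [simp]: "run A [] f = f" "run A (g # C) f = run A C (gate_fun A g f)"
  "run A (C @ C') f = run A C' (run A C f)"
  by (simp_all add: run_def)

lemma circuit_on_simps [simp]:
  "circuit_on n []" "circuit_on n (g # C) \<longleftrightarrow> gate_on n g \<and> circuit_on n C"
  "circuit_on n (C @ C') \<longleftrightarrow> circuit_on n C \<and> circuit_on n C'"
  by (auto simp: circuit_on_def gate_on_def)

lemma circuit_on_take: "circuit_on n C \<Longrightarrow> circuit_on n (take t C)"
  by (auto simp: circuit_on_def dest: in_set_takeD)

lemma circuit_on_nth: "circuit_on n C \<Longrightarrow> t < length C \<Longrightarrow> gate_on n (C ! t)"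
  by (auto simp: circuit_on_def gate_on_def)

lemma circuit_on_mono: "circuit_on v C \<Longrightarrow> v \<le> n \<Longrightarrow> circuit_on n C"
  by (fastforce simp: circuit_on_def)

lemma run_cong:
  assumes "circuit_on n C" "r < 2 ^ n" "\<And>c. c < 2 ^ n \<Longrightarrow> f c = h c"
  shows "run A C f r = run A C h r"
  using assms
proof (induction C arbitrary: f h)
  case (Cons g C)
  have "run A C (gate_fun A g f) r = run A C (gate_fun A g h) r"
  proof (rule Cons.IH)
    show "gate_fun A g f c = gate_fun A g h c" if "c < 2 ^ n" for c
      by (rule gate_fun_cong[of n]) (use Cons.prems that in auto)
  qed (use Cons.prems in auto)
  then show ?case by simp
qed simp

text \<open>Lets the verifier's circuit be analysed separately on each slice of the joint state
  given by a basis state \<open>e\<close> of the prover's qubits.\<close>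

lemma run_add_high:
  assumes "circuit_on v C" "r < 2 ^ v"
  shows "run A C f (r + 2 ^ v * e) = run A C (\<lambda>c. f (c + 2 ^ v * e)) r"
  using assms
proof (induction C arbitrary: f)
  case (Cons g C)
  then have "run A (g # C) f (r + 2 ^ v * e) = run A C (\<lambda>c. gate_fun A g f (c + 2 ^ v * e)) r" by simp
  also have "\<dots> = run A C (gate_fun A g (\<lambda>c. f (c + 2 ^ v * e))) r"
    using Cons.prems gate_fun_add_high[of v g] by (intro run_cong[of v]) auto
  finally show ?case by simp
qed simp

lemma run_norm:
  assumes "circuit_on n C"
  shows "(\<Sum>r<2 ^ n. (cmod (run A C f r))\<^sup>2) = (\<Sum>r<2 ^ n. (cmod (f r))\<^sup>2)"
  using assms by (induction C arbitrary: f) (auto simp: gate_fun_norm)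

lemma circuit_mat_snoc: "circuit_mat A n (C @ [g]) = gate_mat A n g * circuit_mat A n C"
  by (simp add: circuit_mat_def)

lemma gate_mat_carrier: "gate_mat A n g \<in> carrier_mat (2 ^ n) (2 ^ n)"
  by (simp add: gate_mat_def)

lemma circuit_mat_carrier: "circuit_mat A n C \<in> carrier_mat (2 ^ n) (2 ^ n)"
proof (induction C rule: rev_induct)
  case Nil
  then show ?case by (simp add: circuit_mat_def)
next
  case (snoc g C)
  then show ?case unfolding circuit_mat_snoc by (intro mult_carrier_mat[OF gate_mat_carrier])
qed

lemma gate_mat_mult_vec:
  assumes "gate_on n g" "r < 2 ^ n" "\<psi> \<in> carrier_vec (2 ^ n)"
  shows "(gate_mat A n g *\<^sub>v \<psi>) $ r = gate_fun A g (\<lambda>c. \<psi> $ c) r"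
proof -
  have "(gate_mat A n g *\<^sub>v \<psi>) $ r = (\<Sum>c<2 ^ n. gate_entry A g r c * \<psi> $ c)"
    using assms by (auto simp: gate_mat_def scalar_prod_def atLeast0LessThan intro!: sum.cong)
  then show ?thesis using gate_entry_sum[OF assms(1,2)] by simp
qed

lemma circuit_mat_mult_vec:
  assumes "circuit_on n C" "r < 2 ^ n" "\<psi> \<in> carrier_vec (2 ^ n)"
  shows "(circuit_mat A n C *\<^sub>v \<psi>) $ r = run A C (\<lambda>c. \<psi> $ c) r"
  using assms
proof (induction C arbitrary: r rule: rev_induct)
  case Nil
  then show ?case by (simp add: circuit_mat_def)
next
  case (snoc g C)
  have "(circuit_mat A n (C @ [g]) *\<^sub>v \<psi>) = gate_mat A n g *\<^sub>v (circuit_mat A n C *\<^sub>v \<psi>)"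
    unfolding circuit_mat_snoc 
    by (rule assoc_mult_mat_vec[OF gate_mat_carrier circuit_mat_carrier]) (use snoc.prems in simp)
  moreover have "circuit_mat A n C *\<^sub>v \<psi> \<in> carrier_vec (2 ^ n)"
    using circuit_mat_carrier snoc.prems by (intro mult_mat_vec_carrier)
  ultimately have "(circuit_mat A n (C @ [g]) *\<^sub>v \<psi>) $ r = gate_fun A g (\<lambda>c. (circuit_mat A n C *\<^sub>v \<psi>) $ c) r"
    using gate_mat_mult_vec snoc.prems by simp
  also have "\<dots> = gate_fun A g (run A C (\<lambda>c. \<psi> $ c)) r"
    using snoc by (intro gate_fun_cong[of n]) auto
  finally show ?case by simp
qed

lemma run_circuit_mat:
  assumes "circuit_on n C" "r < 2 ^ n"
  shows "run A C f r = (\<Sum>c<2 ^ n. circuit_mat A n C $$ (r, c) * f c)"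
proof -
  have "run A C f r = run A C (\<lambda>c. Matrix.vec (2 ^ n) f $ c) r" using assms by (intro run_cong) auto
  also have "\<dots> = (circuit_mat A n C *\<^sub>v Matrix.vec (2 ^ n) f) $ r"
    using assms by (intro circuit_mat_mult_vec[symmetric]) auto
  also have "\<dots> = (\<Sum>c<2 ^ n. circuit_mat A n C $$ (r, c) * f c)"
    using assms circuit_mat_carrier[of A n C]
    by (auto simp: scalar_prod_def atLeast0LessThan intro!: sum.cong)
  finally show ?thesis .
qed

section \<open>Query weights and the hybrid argument\<close>

text \<open>Restricting the index set amounts to projecting the state; query weights and acceptance
  amplitudes are both of this kind.\<close>

definition nrm :: "nat set \<Rightarrow> (nat \<Rightarrow> complex) \<Rightarrow> real" where
  "nrm S f = L2_set (\<lambda>c. cmod (f c)) S"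

lemma nrm_nonneg [simp]: "0 \<le> nrm S f"
  by (simp add: nrm_def)

lemma nrm_square: "(nrm S f)\<^sup>2 = (\<Sum>c\<in>S. (cmod (f c))\<^sup>2)"
  by (simp add: nrm_def L2_set_def sum_nonneg)

lemma nrm_triangle: "nrm S (\<lambda>c. f c + h c) \<le> nrm S f + nrm S h"
proof -
  have "nrm S (\<lambda>c. f c + h c) \<le> L2_set (\<lambda>c. cmod (f c) + cmod (h c)) S"
    unfolding nrm_def by (intro L2_set_mono norm_triangle_ineq) auto
  also have "\<dots> \<le> nrm S f + nrm S h" unfolding nrm_def by (rule L2_set_triangle_ineq)
  finally show ?thesis .
qed

lemma nrm_diff_triangle: "nrm S (\<lambda>c. f c - h c) \<le> nrm S (\<lambda>c. f c - k c) + nrm S (\<lambda>c. k c - h c)"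
  using nrm_triangle[of S "\<lambda>c. f c - k c" "\<lambda>c. k c - h c"] by simp

lemma nrm_le_diff: "nrm S f \<le> nrm S h + nrm S (\<lambda>c. f c - h c)"
  using nrm_triangle[of S h "\<lambda>c. f c - h c"] by simp

lemma nrm_cong: "(\<And>c. c \<in> S \<Longrightarrow> f c = h c) \<Longrightarrow> nrm S f = nrm S h"
  unfolding nrm_def by (intro L2_set_cong) auto

lemma nrm_subset:
  assumes "finite T" "S \<subseteq> T"
  shows "nrm S f \<le> nrm T f"
  unfolding nrm_def L2_set_def using assms by (intro real_sqrt_le_mono sum_mono2) auto

lemma nrm_eqI: "(\<Sum>c\<in>S. (cmod (f c))\<^sup>2) = (\<Sum>c\<in>T. (cmod (h c))\<^sup>2) \<Longrightarrow> nrm S f = nrm T h"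
  by (simp add: nrm_def L2_set_def)

lemma nrm_commute: "nrm S (\<lambda>c. f c - h c) = nrm S (\<lambda>c. h c - f c)"
  unfolding nrm_def by (intro L2_set_cong) (auto simp: norm_minus_commute)

fun query_support :: "language \<Rightarrow> gate \<Rightarrow> nat set" where
  "query_support F (Query qs t) = {c. map (bit c) qs \<in> F}"
| "query_support F _ = {}"

text \<open>The square root of the probability that measuring the query qubits yields a string of
  \<open>F\<close>. The root is taken because the hybrid argument adds norms.\<close>

definition query_weight :: "language \<Rightarrow> nat \<Rightarrow> gate \<Rightarrow> (nat \<Rightarrow> complex) \<Rightarrow> real" where
  "query_weight F n g f = nrm ({..<2 ^ n} \<inter> query_support F g) f"

lemma query_weight_nonneg [simp]: "0 \<le> query_weight F n g f"
  by (simp add: query_weight_def)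

text \<open>The outputs differ only where the queried string lies in \<open>F\<close>, and there by
  at most two amplitudes of \<open>f\<close>, at \<open>r\<close> and at the flipped index. Flipping
  the target preserves the queried string, so both parts have the same norm; this is the factor
  2.\<close>

lemma gate_fun_oracle_diff:
  assumes g: "gate_on n g" and AB: "\<And>u. u \<notin> F \<Longrightarrow> u \<in> A \<longleftrightarrow> u \<in> B"
  shows "nrm {..<2 ^ n} (\<lambda>r. gate_fun A g f r - gate_fun B g f r) \<le> 2 * query_weight F n g f"
proof (cases g)
  case (Query qs t)
  have t: "t < n" "t \<notin> set qs" using g Query by (auto simp: gate_on_def)
  let ?S = "{..<2 ^ n} \<inter> query_support F g"
  have "nrm {..<2 ^ n} (\<lambda>r. gate_fun A g f r - gate_fun B g f r) =
      nrm ?S (\<lambda>r. gate_fun A g f r - gate_fun B g f r)"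
  proof (rule nrm_eqI, rule sum.mono_neutral_right)
    show "\<forall>i\<in>{..<2 ^ n} - {..<2 ^ n} \<inter> query_support F g. (cmod (gate_fun A g f i - gate_fun B g f i))\<^sup>2 = 0"
      using AB by (auto simp: Query)
  qed auto
  also have "\<dots> \<le> L2_set (\<lambda>r. cmod (f r) + cmod (f (flip_bit t r))) ?S"
    unfolding nrm_def
  proof (intro L2_set_mono)
    show "cmod (gate_fun A g f r - gate_fun B g f r) \<le> cmod (f r) + cmod (f (flip_bit t r))" for r
      using norm_triangle_ineq4[of "f r" "f (flip_bit t r)"] norm_triangle_ineq4[of "f (flip_bit t r)" "f r"]
      by (auto simp: Query)
  qed auto
  also have "\<dots> \<le> L2_set (\<lambda>r. cmod (f r)) ?S + L2_set (\<lambda>r. cmod (f (flip_bit t r))) ?S"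
    by (rule L2_set_triangle_ineq)
  also have "L2_set (\<lambda>r. cmod (f (flip_bit t r))) ?S = L2_set (\<lambda>r. cmod (f r)) ?S"
    unfolding L2_set_def
    by (intro arg_cong[where f = sqrt] sum_involution[where f = "\<lambda>r. (cmod (f r))\<^sup>2"])
       (use t flip_bit_less in \<open>auto simp: Query flip_bit_flip_bit map_bit_flip\<close>)
  finally show ?thesis by (simp add: query_weight_def nrm_def)
qed (auto simp: nrm_def L2_set_def)

lemma gate_fun_nrm_diff:
  assumes "gate_on n g"
  shows "nrm {..<2 ^ n} (\<lambda>r. gate_fun A g f r - gate_fun A g h r) = nrm {..<2 ^ n} (\<lambda>r. f r - h r)"
  using gate_fun_norm[OF assms, of A "\<lambda>r. f r - h r"] unfolding gate_fun_diff by (rule nrm_eqI)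

text \<open>Exchange the oracle at the first gate and carry the difference through the rest
  isometrically. All weights are taken along the run under \<open>B\<close>, so the lemma can be
  applied from whichever oracle has known weights.\<close>

lemma run_hybrid:
  assumes AB: "\<And>u. u \<notin> F \<Longrightarrow> u \<in> A \<longleftrightarrow> u \<in> B" and C: "circuit_on n C"
  shows "nrm {..<2 ^ n} (\<lambda>r. run A C f r - run B C h r) \<le> nrm {..<2 ^ n} (\<lambda>r. f r - h r) +
     (\<Sum>t<length C. 2 * query_weight F n (C ! t) (run B (take t C) h))"
  using C
proof (induction C arbitrary: f h)
  case (Cons g C)
  let ?d = "\<lambda>f h. nrm {..<2 ^ n} (\<lambda>r. f r - h r)"
  have g: "gate_on n g" using Cons.prems by simp
  have "?d (run A (g # C) f) (run B (g # C) h) \<le> ?d (gate_fun A g f) (gate_fun B g h) +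
      (\<Sum>t<length C. 2 * query_weight F n (C ! t) (run B (take t C) (gate_fun B g h)))"
    using Cons by simp
  moreover have "?d (gate_fun A g h) (gate_fun B g h) \<le> 2 * query_weight F n g h"
    by (rule gate_fun_oracle_diff[OF g]) (use AB in auto)
  then have "?d (gate_fun A g f) (gate_fun B g h) \<le> ?d f h + 2 * query_weight F n g h"
    using nrm_diff_triangle[of "{..<2 ^ n}" "gate_fun A g f" "gate_fun B g h" "gate_fun A g h"]
      gate_fun_nrm_diff[OF g, of A f h] by linarith
  moreover have "(\<Sum>t<length (g # C). 2 * query_weight F n ((g # C) ! t) (run B (take t (g # C)) h)) =
      2 * query_weight F n g h + (\<Sum>t<length C. 2 * query_weight F n (C ! t) (run B (take t C) (gate_fun B g h)))"
    by (simp add: sum.lessThan_Suc_shift del: sum.lessThan_Suc)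
  ultimately show ?case by linarith
qed simp

text \<open>Disjoint sets of strings are queried on disjoint sets of basis states, so one query
  cannot put much weight on many \<open>F w\<close>.\<close>

lemma sum_query_weight_le:
  assumes W: "finite W" "disjoint_family_on F W"
  shows "(\<Sum>w\<in>W. (query_weight (F w) n g f)\<^sup>2) \<le> (nrm {..<2 ^ n} f)\<^sup>2"
proof -
  let ?S = "\<lambda>w. {..<2 ^ n} \<inter> query_support (F w) g"
  have "(\<Sum>w\<in>W. (query_weight (F w) n g f)\<^sup>2) = (\<Sum>w\<in>W. \<Sum>c\<in>?S w. (cmod (f c))\<^sup>2)"
    by (simp add: query_weight_def nrm_square)
  also have "\<dots> = (\<Sum>c\<in>(\<Union>w\<in>W. ?S w). (cmod (f c))\<^sup>2)"
  proof (rule sum.UNION_disjoint[symmetric])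
    show "\<forall>i\<in>W. \<forall>j\<in>W. i \<noteq> j \<longrightarrow> ?S i \<inter> ?S j = {}"
      using W(2) by (cases g) (auto simp: disjoint_family_on_def)
  qed (use W in auto)
  also have "\<dots> \<le> (\<Sum>c<2 ^ n. (cmod (f c))\<^sup>2)" by (intro sum_mono2) auto
  finally show ?thesis by (simp add: nrm_square)
qed

lemma reduced_state_carrier: "reduced_state n v \<psi> \<in> carrier_mat (2 ^ v) (2 ^ v)"
  by (simp add: reduced_state_def)

text \<open>
  The weight of a query made by a circuit on the first \<open>v\<close> qubits is a function of the reduced state
  of these qubits.
\<close>

lemma query_weight_reduced_state:
  assumes v: "v \<le> n" and C: "circuit_on v C" and g: "gate_on v g"
  shows "complex_of_real ((query_weight F n g (run B C (\<lambda>c. \<psi> $ c)))\<^sup>2) =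
    (\<Sum>r\<in>{..<2 ^ v} \<inter> query_support F g. \<Sum>c<2 ^ v. \<Sum>c'<2 ^ v.
       circuit_mat B v C $$ (r, c) * cnj (circuit_mat B v C $$ (r, c')) * reduced_state n v \<psi> $$ (c, c'))"
proof -
  let ?U = "\<lambda>r c. circuit_mat B v C $$ (r, c)" and ?S = "query_support F g"
  have supp: "r + 2 ^ v * e \<in> ?S \<longleftrightarrow> r \<in> ?S" if "r < 2 ^ v" for r e
  proof (cases g)
    case (Query qs t)
    have "map (bit (r + 2 ^ v * e)) qs = map (bit r) qs"
      using g that by (auto simp: Query gate_on_def bit_add_high)
    then show ?thesis by (simp only: Query query_support.simps mem_Collect_eq)
  qed auto
  have "(query_weight F n g (run B C (\<lambda>c. \<psi> $ c)))\<^sup>2 =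
    (\<Sum>c<2 ^ n. if c \<in> ?S then (cmod (run B C (\<lambda>c. \<psi> $ c) c))\<^sup>2 else 0)"
    by (simp add: query_weight_def nrm_square sum.inter_restrict)
  also have "\<dots> = (\<Sum>e<2 ^ (n - v). \<Sum>r<2 ^ v. if r + 2 ^ v * e \<in> ?S
      then (cmod (run B C (\<lambda>c. \<psi> $ c) (r + 2 ^ v * e)))\<^sup>2 else 0)"
    by (rule sum_split_qubits[OF v])
  also have "\<dots> = (\<Sum>e<2 ^ (n - v). \<Sum>r\<in>{..<2 ^ v} \<inter> ?S.
      (cmod (\<Sum>c<2 ^ v. ?U r c * \<psi> $ (c + 2 ^ v * e)))\<^sup>2)"
    unfolding sum.inter_restrict[OF finite_lessThan]
    by (intro sum.cong refl) (auto simp: supp run_add_high[OF C] run_circuit_mat[OF C])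
  also have "\<dots> = (\<Sum>r\<in>{..<2 ^ v} \<inter> ?S. \<Sum>e<2 ^ (n - v).
      (cmod (\<Sum>c<2 ^ v. ?U r c * \<psi> $ (c + 2 ^ v * e)))\<^sup>2)"
    by (rule sum.swap)
  finally have eq: "complex_of_real ((query_weight F n g (run B C (\<lambda>c. \<psi> $ c)))\<^sup>2) =
     (\<Sum>r\<in>{..<2 ^ v} \<inter> ?S. \<Sum>e<2 ^ (n - v).
       complex_of_real ((cmod (\<Sum>c<2 ^ v. ?U r c * \<psi> $ (c + 2 ^ v * e)))\<^sup>2))"
    by (simp only: of_real_sum)
  have "(\<Sum>e<2 ^ (n - v). complex_of_real ((cmod (\<Sum>c<2 ^ v. ?U r c * \<psi> $ (c + 2 ^ v * e)))\<^sup>2)) =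
     (\<Sum>c<2 ^ v. \<Sum>c'<2 ^ v. ?U r c * cnj (?U r c') * reduced_state n v \<psi> $$ (c, c'))" for r
  proof -
    have "(\<Sum>e<2 ^ (n - v). complex_of_real ((cmod (\<Sum>c<2 ^ v. ?U r c * \<psi> $ (c + 2 ^ v * e)))\<^sup>2)) =
      (\<Sum>e<2 ^ (n - v). \<Sum>c<2 ^ v. \<Sum>c'<2 ^ v. ?U r c * \<psi> $ (c + 2 ^ v * e) * cnj (?U r c' * \<psi> $ (c' + 2 ^ v * e)))"
      by (simp only: complex_norm_square cnj_sum sum_product)
    also have "\<dots> = (\<Sum>c<2 ^ v. \<Sum>e<2 ^ (n - v). \<Sum>c'<2 ^ v. ?U r c * \<psi> $ (c + 2 ^ v * e) * cnj (?U r c' * \<psi> $ (c' + 2 ^ v * e)))"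
      by (rule sum.swap)
    also have "\<dots> = (\<Sum>c<2 ^ v. \<Sum>c'<2 ^ v. \<Sum>e<2 ^ (n - v). ?U r c * \<psi> $ (c + 2 ^ v * e) * cnj (?U r c' * \<psi> $ (c' + 2 ^ v * e)))"
      by (intro sum.cong refl sum.swap)
    also have "\<dots> = (\<Sum>c<2 ^ v. \<Sum>c'<2 ^ v. ?U r c * cnj (?U r c') * reduced_state n v \<psi> $$ (c, c'))"
      by (intro sum.cong refl) (simp add: reduced_state_def sum_distrib_left mult_ac)
    finally show ?thesis .
  qed
  then show ?thesis unfolding eq by (simp only:)
qed

text \<open>Squared weights are linear in the reduced state: their difference is the trace of the
  difference of the states against \<open>K\<^sup>\<dagger> K\<close>, where \<open>K\<close> is the
  circuit followed by a projection. Such a \<open>K\<close> is a contraction, so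
  \<open>trace_norm_bound\<close> applies.\<close>

lemma query_weight_trace_norm:
  assumes v: "v \<le> n" "v \<le> n'" and C: "circuit_on v C" and g: "gate_on v g"
  shows "(query_weight F n g (run B C (\<lambda>c. \<psi> $ c)))\<^sup>2 \<le>
    (query_weight F n' g (run B C (\<lambda>c. \<psi>' $ c)))\<^sup>2 + trace_norm (reduced_state n' v \<psi>' - reduced_state n v \<psi>)"
    (is "?a \<le> ?b + trace_norm ?X")
proof -
  let ?U = "\<lambda>r c. circuit_mat B v C $$ (r, c)" and ?S = "{..<2 ^ v} \<inter> query_support F g"
  have Xc: "?X \<in> carrier_mat (2 ^ v) (2 ^ v)"
    using reduced_state_carrier by (intro minus_carrier_mat)
  have Xe: "?X $$ (c, c') = reduced_state n' v \<psi>' $$ (c, c') - reduced_state n v \<psi> $$ (c, c')"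
    if "c < 2 ^ v" "c' < 2 ^ v" for c c'
    using that reduced_state_carrier[of n v \<psi>] by simp
  have Xh: "mat_adjoint ?X = ?X"
  proof (rule eq_matI)
    fix i j assume "i < dim_row ?X" "j < dim_col ?X"
    then have ij: "i < 2 ^ v" "j < 2 ^ v" using Xc by auto
    have h: "cnj (reduced_state m v \<phi> $$ (j, i)) = reduced_state m v \<phi> $$ (i, j)" for m \<phi>
      using ij by (simp add: reduced_state_def mult.commute)
    have "mat_adjoint ?X $$ (i, j) = cnj (?X $$ (j, i))" using ij Xc by (intro mat_adjoint_index) auto
    then show "mat_adjoint ?X $$ (i, j) = ?X $$ (i, j)" using ij Xe h by simp
  qed (use carrier_matD[OF Xc] in \<open>simp_all only: dim_mat_adjoint\<close>)
  have K: "(\<Sum>r\<in>?S. (cmod (\<Sum>c<2 ^ v. ?U r c * f c))\<^sup>2) \<le> (\<Sum>c<2 ^ v. (cmod (f c))\<^sup>2)" for f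
  proof -
    have "(\<Sum>r\<in>?S. (cmod (\<Sum>c<2 ^ v. ?U r c * f c))\<^sup>2) \<le> (\<Sum>r<2 ^ v. (cmod (\<Sum>c<2 ^ v. ?U r c * f c))\<^sup>2)"
      by (intro sum_mono2) auto
    also have "\<dots> = (\<Sum>r<2 ^ v. (cmod (run B C f r))\<^sup>2)"
      by (intro sum.cong) (auto simp: run_circuit_mat[OF C])
    finally show ?thesis by (simp add: run_norm[OF C])
  qed
  have "complex_of_real ?b - complex_of_real ?a =
    (\<Sum>r\<in>?S. \<Sum>c<2 ^ v. \<Sum>c'<2 ^ v. ?U r c * cnj (?U r c') * ?X $$ (c, c'))"
    unfolding query_weight_reduced_state[OF v(1) C g] query_weight_reduced_state[OF v(2) C g]
      sum_subtractf[symmetric]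
    by (intro sum.cong refl) (auto simp: Xe right_diff_distrib)
  then have "cmod (complex_of_real ?b - complex_of_real ?a) \<le> trace_norm ?X"
    by (simp only:) (rule trace_norm_bound[OF Xc Xh _ K], simp)
  then have "\<bar>?b - ?a\<bar> \<le> trace_norm ?X" by (metis norm_of_real of_real_diff)
  then show ?thesis by linarith
qed

section \<open>Moves of the prover as isometries of the joint state\<close>

lemma extend_mat_mult_vec:
  assumes p: "p \<le> n" and U: "U \<in> carrier_mat (2 ^ (n - p)) (2 ^ (n - p))"
    and l: "l < 2 ^ p" and h: "h < 2 ^ (n - p)" and \<psi>: "\<psi> \<in> carrier_vec (2 ^ n)"
  shows "(extend_mat p n U *\<^sub>v \<psi>) $ (l + 2 ^ p * h) = (\<Sum>k<2 ^ (n - p). U $$ (h, k) * \<psi> $ (l + 2 ^ p * k))"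
proof -
  have n: "(2::nat) ^ n = 2 ^ p * 2 ^ (n - p)" using p by (simp flip: power_add)
  have "l + 2 ^ p * h < 2 ^ p * Suc h" using l by simp
  also have "\<dots> \<le> 2 ^ p * 2 ^ (n - p)" using h by (intro mult_le_mono) auto
  finally have r: "l + 2 ^ p * h < 2 ^ n" by (simp add: n)
  have "(extend_mat p n U *\<^sub>v \<psi>) $ (l + 2 ^ p * h) =
     (\<Sum>c<2 ^ n. (if l = c mod 2 ^ p then U $$ (h, c div 2 ^ p) else 0) * \<psi> $ c)"
    using r \<psi> l by (auto simp: extend_mat_def scalar_prod_def atLeast0LessThan intro!: sum.cong)
  also have "\<dots> = (\<Sum>k<2 ^ (n - p). \<Sum>m<2 ^ p. if m = l then U $$ (h, k) * \<psi> $ (m + 2 ^ p * k) else 0)"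
    unfolding sum_split_qubits[OF p] by (intro sum.cong refl) auto
  also have "\<dots> = (\<Sum>k<2 ^ (n - p). U $$ (h, k) * \<psi> $ (l + 2 ^ p * k))"
    using l by simp
  finally show ?thesis .
qed

lemma extend_mat_carrier: "extend_mat p n U \<in> carrier_mat (2 ^ n) (2 ^ n)"
  by (simp add: extend_mat_def)

lemma extend_mat_norm:
  assumes p: "p \<le> n" and U: "unitary_mat (2 ^ (n - p)) U" and \<psi>: "\<psi> \<in> carrier_vec (2 ^ n)"
  shows "(\<Sum>r<2 ^ n. (cmod ((extend_mat p n U *\<^sub>v \<psi>) $ r))\<^sup>2) = (\<Sum>r<2 ^ n. (cmod (\<psi> $ r))\<^sup>2)"
proof -
  have Uc: "U \<in> carrier_mat (2 ^ (n - p)) (2 ^ (n - p))" using U by (simp add: unitary_mat_def)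
  have "(\<Sum>r<2 ^ n. (cmod ((extend_mat p n U *\<^sub>v \<psi>) $ r))\<^sup>2) =
    (\<Sum>h<2 ^ (n - p). \<Sum>l<2 ^ p. (cmod (\<Sum>k<2 ^ (n - p). U $$ (h, k) * \<psi> $ (l + 2 ^ p * k)))\<^sup>2)"
    unfolding sum_split_qubits[OF p] using extend_mat_mult_vec[OF p Uc _ _ \<psi>] by (intro sum.cong refl) auto
  also have "\<dots> = (\<Sum>l<2 ^ p. \<Sum>h<2 ^ (n - p). (cmod (\<Sum>k<2 ^ (n - p). U $$ (h, k) * \<psi> $ (l + 2 ^ p * k)))\<^sup>2)"
    by (rule sum.swap)
  also have "\<dots> = (\<Sum>l<2 ^ p. \<Sum>k<2 ^ (n - p). (cmod (\<psi> $ (l + 2 ^ p * k)))\<^sup>2)"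
    by (intro sum.cong refl unitary_mat_norm[OF U])
  also have "\<dots> = (\<Sum>k<2 ^ (n - p). \<Sum>l<2 ^ p. (cmod (\<psi> $ (l + 2 ^ p * k)))\<^sup>2)"
    by (rule sum.swap)
  also have "\<dots> = (\<Sum>r<2 ^ n. (cmod (\<psi> $ r))\<^sup>2)" by (rule sum_split_qubits[OF p, symmetric])
  finally show ?thesis .
qed

lemma extend_mat_nrm_diff:
  assumes p: "p \<le> n" and U: "unitary_mat (2 ^ (n - p)) U"
    and \<psi>: "\<psi> \<in> carrier_vec (2 ^ n)" "\<phi> \<in> carrier_vec (2 ^ n)"
  shows "nrm {..<2 ^ n} (\<lambda>r. (extend_mat p n U *\<^sub>v \<psi>) $ r - (extend_mat p n U *\<^sub>v \<phi>) $ r) =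
    nrm {..<2 ^ n} (\<lambda>r. \<psi> $ r - \<phi> $ r)"
proof (rule nrm_eqI)
  have E: "extend_mat p n U \<in> carrier_mat (2 ^ n) (2 ^ n)" by (rule extend_mat_carrier)
  have "extend_mat p n U *\<^sub>v (\<psi> - \<phi>) = extend_mat p n U *\<^sub>v \<psi> - extend_mat p n U *\<^sub>v \<phi>"
    using \<psi> by (intro mult_minus_distrib_mat_vec[OF E])
  then have "(\<Sum>r<2 ^ n. (cmod ((extend_mat p n U *\<^sub>v \<psi>) $ r - (extend_mat p n U *\<^sub>v \<phi>) $ r))\<^sup>2) =
     (\<Sum>r<2 ^ n. (cmod ((extend_mat p n U *\<^sub>v (\<psi> - \<phi>)) $ r))\<^sup>2)"
    using \<psi> E by (intro sum.cong) auto
  also have "\<dots> = (\<Sum>r<2 ^ n. (cmod ((\<psi> - \<phi>) $ r))\<^sup>2)"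
    using \<psi> by (intro extend_mat_norm[OF p U]) auto
  also have "\<dots> = (\<Sum>r<2 ^ n. (cmod (\<psi> $ r - \<phi> $ r))\<^sup>2)"
    using \<psi> by (intro sum.cong) auto
  finally show "(\<Sum>r<2 ^ n. (cmod ((extend_mat p n U *\<^sub>v \<psi>) $ r - (extend_mat p n U *\<^sub>v \<phi>) $ r))\<^sup>2) =
    (\<Sum>r<2 ^ n. (cmod (\<psi> $ r - \<phi> $ r))\<^sup>2)" .
qed

section \<open>Stability of the verifier under planted witnesses\<close>

lemma joint_state_carrier: "joint_state A V P j \<in> carrier_vec (2 ^ total_qubits V P)"
proof (induction j)
  case 0
  then show ?case by (simp add: zero_state_def)
next
  case (Suc j)
  then show ?case
    using mult_mat_vec_carrier[OF circuit_mat_carrier Suc] mult_mat_vec_carrier[OF extend_mat_carrier Suc]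
    by simp
qed

lemma zero_state_norm: "nrm {..<2 ^ n} (\<lambda>c. zero_state n $ c) = 1"
proof -
  have "(\<Sum>c<2 ^ n. (cmod (zero_state n $ c))\<^sup>2) = (\<Sum>c<(2::nat) ^ n. if c = 0 then 1 else 0)"
    by (intro sum.cong) (auto simp: zero_state_def)
  then have "(nrm {..<2 ^ n} (\<lambda>c. zero_state n $ c))\<^sup>2 = 1" by (simp add: nrm_square)
  then show ?thesis by (simp add: power2_eq_1_iff) (metis nrm_nonneg not_one_le_zero neg_0_le_iff_le)
qed

lemma run_nrm: "circuit_on n C \<Longrightarrow> nrm {..<2 ^ n} (run A C f) = nrm {..<2 ^ n} f"
  by (intro nrm_eqI run_norm)

lemma circuit_nth_rounds:
  assumes "valid_verifier V" "i \<le> rounds V"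
  shows "circuit_on (verifier_qubits V) (circuits V ! i)"
proof -
  have "i < length (circuits V)" using assms by (cases "circuits V") (auto simp: valid_verifier_def rounds_def)
  then show ?thesis using assms by (simp add: valid_verifier_def)
qed

lemma verifier_qubits_le_total: "verifier_qubits V \<le> total_qubits V P"
  by (simp add: total_qubits_def)

lemma private_qubits_le_total: "private_qubits V \<le> total_qubits V P"
  by (simp add: total_qubits_def verifier_qubits_def)

lemma valid_prover_unitary:
  "valid_prover V P \<Longrightarrow> unitary_mat (2 ^ (total_qubits V P - private_qubits V)) (snd P i)"
  by (simp add: valid_prover_def total_qubits_def verifier_qubits_def)

lemma joint_state_even:
  assumes "valid_verifier V" "even j" "j \<le> 2 * rounds V" "r < 2 ^ total_qubits V P"
  shows "joint_state A V P (Suc j) $ r = run A (circuits V ! (j div 2)) (\<lambda>c. joint_state A V P j $ c) r"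
proof -
  have "circuit_on (total_qubits V P) (circuits V ! (j div 2))"
    using assms by (intro circuit_on_mono[OF circuit_nth_rounds verifier_qubits_le_total]) auto
  then show ?thesis using assms circuit_mat_mult_vec[OF _ _ joint_state_carrier] by simp
qed

lemma joint_state_norm:
  assumes V: "valid_verifier V" and P: "valid_prover V P"
  shows "j \<le> 2 * rounds V + 1 \<Longrightarrow> nrm {..<2 ^ total_qubits V P} (\<lambda>c. joint_state A V P j $ c) = 1"
proof (induction j)
  case 0
  then show ?case by (simp add: zero_state_norm)
next
  case (Suc j)
  let ?N = "total_qubits V P"
  show ?case
  proof (cases "even j")
    case True
    have C: "circuit_on ?N (circuits V ! (j div 2))"
      using Suc.prems by (intro circuit_on_mono[OF circuit_nth_rounds[OF V] verifier_qubits_le_total]) auto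
    have "nrm {..<2 ^ ?N} (\<lambda>c. joint_state A V P (Suc j) $ c) =
        nrm {..<2 ^ ?N} (run A (circuits V ! (j div 2)) (\<lambda>c. joint_state A V P j $ c))"
      using True Suc.prems V by (intro nrm_cong) (auto simp: joint_state_even simp del: joint_state.simps)
    then show ?thesis using Suc run_nrm[OF C] by simp
  next
    case False
    then have "nrm {..<2 ^ ?N} (\<lambda>c. joint_state A V P (Suc j) $ c) = nrm {..<2 ^ ?N} (\<lambda>c. joint_state A V P j $ c)"
      by (intro nrm_eqI)
         (simp add: extend_mat_norm[OF private_qubits_le_total valid_prover_unitary[OF P] joint_state_carrier])
    then show ?thesis using Suc by simp
  qed
qed

text \<open>The prover applies the same unitaries in both runs, which preserves distances; only the
  verifier's moves contribute, and \<open>Suc j div 2\<close> of them have been made by time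
  \<open>j\<close>.\<close>

lemma joint_state_hybrid:
  assumes V: "valid_verifier V" and P: "valid_prover V P"
    and AB: "\<And>u. u \<notin> F \<Longrightarrow> u \<in> A \<longleftrightarrow> u \<in> B"
  shows "j \<le> 2 * rounds V + 1 \<Longrightarrow>
    nrm {..<2 ^ total_qubits V P} (\<lambda>c. joint_state A V P j $ c - joint_state B V P j $ c) \<le>
    (\<Sum>i<Suc j div 2. \<Sum>t<length (circuits V ! i). 2 * query_weight F (total_qubits V P) (circuits V ! i ! t)
       (run B (take t (circuits V ! i)) (\<lambda>c. joint_state B V P (2 * i) $ c)))"
proof (induction j)
  case 0
  then show ?case by (simp add: nrm_def L2_set_def)
next
  case (Suc j)
  let ?N = "total_qubits V P"
  let ?d = "\<lambda>j. nrm {..<2 ^ ?N} (\<lambda>c. joint_state A V P j $ c - joint_state B V P j $ c)"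
  show ?case
  proof (cases "even j")
    case True
    then obtain i where j: "j = 2 * i" by blast
    have C: "circuit_on ?N (circuits V ! i)"
      using Suc.prems j by (intro circuit_on_mono[OF circuit_nth_rounds[OF V] verifier_qubits_le_total]) auto
    have "?d (Suc j) = nrm {..<2 ^ ?N} (\<lambda>c. run A (circuits V ! i) (\<lambda>c. joint_state A V P j $ c) c -
         run B (circuits V ! i) (\<lambda>c. joint_state B V P j $ c) c)"
      using True Suc.prems V j by (intro nrm_cong) (auto simp: joint_state_even simp del: joint_state.simps)
    also have "\<dots> \<le> ?d j + (\<Sum>t<length (circuits V ! i). 2 * query_weight F ?N (circuits V ! i ! t)
       (run B (take t (circuits V ! i)) (\<lambda>c. joint_state B V P j $ c)))"
      by (rule run_hybrid[OF AB C])
    finally show ?thesis using Suc j by simp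
  next
    case False
    then have "?d (Suc j) = ?d j"
      using extend_mat_nrm_diff[OF private_qubits_le_total valid_prover_unitary[OF P] joint_state_carrier joint_state_carrier]
      by simp
    moreover obtain i where "j = Suc (2 * i)" using False by (auto elim: oddE)
    ultimately show ?thesis using Suc by simp
  qed
qed

lemma accept_prob_nrm:
  "accept_prob A V P =
    (nrm {k. k < 2 ^ total_qubits V P \<and> bit k 0} (\<lambda>k. joint_state A V P (2 * rounds V + 1) $ k))\<^sup>2"
  by (simp add: accept_prob_def nrm_square)

lemma query_weight_le_nrm_diff:
  "query_weight F n g f \<le> query_weight F n g h + nrm {..<2 ^ n} (\<lambda>c. f c - h c)"
proof -
  have "query_weight F n g f \<le> query_weight F n g h + nrm ({..<2 ^ n} \<inter> query_support F g) (\<lambda>c. f c - h c)"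
    unfolding query_weight_def by (rule nrm_le_diff)
  also have "nrm ({..<2 ^ n} \<inter> query_support F g) (\<lambda>c. f c - h c) \<le> nrm {..<2 ^ n} (\<lambda>c. f c - h c)"
    by (intro nrm_subset) auto
  finally show ?thesis by simp
qed

lemma query_weight_cong:
  "(\<And>c. c < 2 ^ n \<Longrightarrow> f c = h c) \<Longrightarrow> query_weight F n g f = query_weight F n g h"
  unfolding query_weight_def by (intro nrm_cong) auto

definition circuit_size :: "verifier \<Rightarrow> simulator \<Rightarrow> nat" where
  "circuit_size V S = sum_list (map length (circuits V)) + sum_list (map (length \<circ> snd) S)"

text \<open>The simulator for the verifier's \<open>i\<close>-th move, continued by that move.\<close>

definition simulated_circuit :: "verifier \<Rightarrow> simulator \<Rightarrow> nat \<Rightarrow> circuit" where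
  "simulated_circuit V S i = snd (S ! (2 * i)) @ circuits V ! i"

text \<open>The total squared weight on \<open>F\<close> over all simulated moves. No prover occurs
  in it, so under a fixed \<open>A\<close> it can be summed over all candidate witnesses.\<close>

definition simulated_weight :: "language \<Rightarrow> verifier \<Rightarrow> simulator \<Rightarrow> language \<Rightarrow> real" where
  "simulated_weight A V S F = (\<Sum>i\<le>rounds V. \<Sum>t<length (simulated_circuit V S i).
     (query_weight F (fst (S ! (2 * i))) (simulated_circuit V S i ! t)
       (run A (take t (simulated_circuit V S i)) (\<lambda>c. zero_state (fst (S ! (2 * i))) $ c)))\<^sup>2)"

lemma sum_length_circuits:
  assumes "valid_verifier V"
  shows "(\<Sum>i\<le>rounds V. length (circuits V ! i)) = sum_list (map length (circuits V))"
proof -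
  have "length (circuits V) = Suc (rounds V)"
    using assms by (cases "circuits V") (auto simp: valid_verifier_def rounds_def)
  then show ?thesis by (simp add: sum_list_sum_nth atLeast0LessThan lessThan_Suc_atMost del: sum.lessThan_Suc)
qed

lemma sum_length_simulated_circuit:
  assumes V: "valid_verifier V" and S: "valid_simulator V S"
  shows "(\<Sum>i\<le>rounds V. length (simulated_circuit V S i)) \<le> circuit_size V S"
proof -
  have len: "length S = Suc (2 * rounds V)" using S by (simp add: valid_simulator_def)
  have "(\<Sum>i\<le>rounds V. length (snd (S ! (2 * i)))) = (\<Sum>j\<in>(\<lambda>i. 2 * i) ` {..rounds V}. length (snd (S ! j)))"
    by (subst sum.reindex) (auto intro: inj_onI)
  also have "\<dots> \<le> (\<Sum>j<length S. length (snd (S ! j)))" using len by (intro sum_mono2) auto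
  also have "\<dots> = sum_list (map (length \<circ> snd) S)" by (simp add: sum_list_sum_nth atLeast0LessThan)
  finally show ?thesis
    using sum_length_circuits[OF V] by (simp add: simulated_circuit_def circuit_size_def sum.distrib)
qed

lemma simulated_circuit_on:
  assumes V: "valid_verifier V" and S: "valid_simulator V S" and i: "i \<le> rounds V"
  shows "circuit_on (fst (S ! (2 * i))) (simulated_circuit V S i)"
    "verifier_qubits V \<le> fst (S ! (2 * i))" "circuit_on (fst (S ! (2 * i))) (snd (S ! (2 * i)))"
proof -
  have "S ! (2 * i) \<in> set S" using S i by (intro nth_mem) (simp add: valid_simulator_def)
  then have *: "verifier_qubits V \<le> fst (S ! (2 * i)) \<and> circuit_on (fst (S ! (2 * i))) (snd (S ! (2 * i)))"
    using S by (auto simp: valid_simulator_def split_beta)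
  then show "verifier_qubits V \<le> fst (S ! (2 * i))" "circuit_on (fst (S ! (2 * i))) (snd (S ! (2 * i)))"
    by auto
  then show "circuit_on (fst (S ! (2 * i))) (simulated_circuit V S i)"
    using circuit_on_mono[OF circuit_nth_rounds[OF V i]] by (simp add: simulated_circuit_def)
qed

text \<open>For each gate the squared weights on the disjoint \<open>F w\<close> add up to at most
  1, the squared norm of the state, so the bound is the number of gates.\<close>

lemma sum_simulated_weight_le:
  assumes V: "valid_verifier V" and S: "valid_simulator V S"
    and W: "finite W" "disjoint_family_on F W"
  shows "(\<Sum>w\<in>W. simulated_weight A V S (F w)) \<le> real (circuit_size V S)"
proof -
  let ?n = "\<lambda>i. fst (S ! (2 * i))" and ?R = "simulated_circuit V S"
  let ?f = "\<lambda>i t. run A (take t (?R i)) (\<lambda>c. zero_state (?n i) $ c)"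
  have "(\<Sum>w\<in>W. simulated_weight A V S (F w)) =
    (\<Sum>i\<le>rounds V. \<Sum>w\<in>W. \<Sum>t<length (?R i). (query_weight (F w) (?n i) (?R i ! t) (?f i t))\<^sup>2)"
    unfolding simulated_weight_def by (rule sum.swap)
  also have "\<dots> = (\<Sum>i\<le>rounds V. \<Sum>t<length (?R i). \<Sum>w\<in>W. (query_weight (F w) (?n i) (?R i ! t) (?f i t))\<^sup>2)"
    by (intro sum.cong refl sum.swap)
  also have "\<dots> \<le> (\<Sum>i\<le>rounds V. \<Sum>t<length (?R i). 1)"
  proof (intro sum_mono)
    fix i t assume i: "i \<in> {..rounds V}"
    have "(\<Sum>w\<in>W. (query_weight (F w) (?n i) (?R i ! t) (?f i t))\<^sup>2) \<le> (nrm {..<2 ^ ?n i} (?f i t))\<^sup>2"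
      by (rule sum_query_weight_le[OF W])
    also have "nrm {..<2 ^ ?n i} (?f i t) = 1"
      using simulated_circuit_on(1)[OF V S] i by (subst run_nrm) (auto intro: circuit_on_take simp: zero_state_norm)
    finally show "(\<Sum>w\<in>W. (query_weight (F w) (?n i) (?R i ! t) (?f i t))\<^sup>2) \<le> 1" by simp
  qed
  also have "\<dots> = real (\<Sum>i\<le>rounds V. length (?R i))" by simp
  also have "\<dots> \<le> real (circuit_size V S)" using sum_length_simulated_circuit[OF V S] by (simp only: of_nat_le_iff)
  finally show ?thesis .
qed

text \<open>
  In the interaction with the honest prover under the oracle \<open>B\<close>, the verifier queries \<open>F\<close> with about
  the same weight as on the simulated views, and these hardly change when \<open>B\<close> is replaced by \<open>A\<close>.
\<close>

lemma verifier_query_weight: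
  assumes V: "valid_verifier V" and S: "valid_simulator V S" and P: "valid_prover V P"
    and AB: "\<And>u. u \<notin> F \<Longrightarrow> u \<in> A \<longleftrightarrow> u \<in> B"
    and zk: "\<And>j. j \<le> 2 * rounds V \<Longrightarrow> trace_distance (simulated_view B V S j) (view B V P j) \<le> \<epsilon>"
    and T: "circuit_size V S \<le> T" and w: "simulated_weight A V S F \<le> \<eta>\<^sup>2" "0 \<le> \<eta>"
    and i: "i \<le> rounds V" and t: "t < length (circuits V ! i)"
  shows "(query_weight F (total_qubits V P) (circuits V ! i ! t)
       (run B (take t (circuits V ! i)) (\<lambda>c. joint_state B V P (2 * i) $ c)))\<^sup>2 \<le> 9 * real T ^ 2 * \<eta>\<^sup>2 + 2 * \<epsilon>"
proof -
  let ?n = "fst (S ! (2 * i))" and ?R = "simulated_circuit V S i" and ?C = "circuits V ! i"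
  let ?SC = "snd (S ! (2 * i))"
  let ?z = "\<lambda>c. zero_state ?n $ c" and ?v = "verifier_qubits V"
  let ?q = "\<lambda>s. query_weight F ?n (?R ! s) (run A (take s ?R) ?z)"
  have Ron: "circuit_on ?n ?R" and vn: "?v \<le> ?n" and SCon: "circuit_on ?n ?SC"
    using simulated_circuit_on[OF V S i] by auto
  have Con: "circuit_on ?v ?C" by (rule circuit_nth_rounds[OF V i])
  have "length ?R \<le> (\<Sum>i\<le>rounds V. length (simulated_circuit V S i))"
    using i by (intro member_le_sum[where f = "\<lambda>i. length (simulated_circuit V S i)"]) auto
  then have RT: "length ?R \<le> T" using sum_length_simulated_circuit[OF V S] T by linarith
  have q: "?q s \<le> \<eta>" if s: "s < length ?R" for s
  proof -
    have "(?q s)\<^sup>2 \<le> (\<Sum>s<length ?R. (?q s)\<^sup>2)"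
      using s by (intro member_le_sum[where f = "\<lambda>s. (?q s)\<^sup>2"]) auto
    also have "\<dots> \<le> simulated_weight A V S F"
      unfolding simulated_weight_def
      by (rule member_le_sum[where f = "\<lambda>i. \<Sum>t<length (simulated_circuit V S i).
     (query_weight F (fst (S ! (2 * i))) (simulated_circuit V S i ! t)
       (run A (take t (simulated_circuit V S i)) (\<lambda>c. zero_state (fst (S ! (2 * i))) $ c)))\<^sup>2"])
         (use i in \<open>auto intro: sum_nonneg\<close>)
    also have "\<dots> \<le> \<eta>\<^sup>2" by (rule w(1))
    finally show ?thesis using w(2) by (rule power2_le_imp_le)
  qed
  define s where "s = length ?SC + t"
  have s: "s < length ?R" "?R ! s = ?C ! t" "take s ?R = ?SC @ take t ?C"
    using t by (auto simp: s_def simulated_circuit_def nth_append)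
  \<comment> \<open>The hybrid argument with the oracles exchanged: the weights known to be at most
    \<open>\<eta>\<close> are those of the simulation under \<open>A\<close>.\<close>
  have "nrm {..<2 ^ ?n} (\<lambda>c. run B (take s ?R) ?z c - run A (take s ?R) ?z c) \<le>
      nrm {..<2 ^ ?n} (\<lambda>c. ?z c - ?z c) +
      (\<Sum>s'<length (take s ?R). 2 * query_weight F ?n (take s ?R ! s') (run A (take s' (take s ?R)) ?z))"
    by (rule run_hybrid) (use AB circuit_on_take[OF Ron] in auto)
  also have "nrm {..<2 ^ ?n} (\<lambda>c. ?z c - ?z c) = 0" by (simp add: nrm_def L2_set_def)
  also have "(\<Sum>s'<length (take s ?R). 2 * query_weight F ?n (take s ?R ! s') (run A (take s' (take s ?R)) ?z)) \<le>
      (\<Sum>s'<length (take s ?R). 2 * \<eta>)"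
    using q s(1) by (intro sum_mono) (auto simp: min_def)
  also have "\<dots> \<le> real T * (2 * \<eta>)"
    using s(1) RT w(2) by (simp add: mult_right_mono)
  finally have d: "nrm {..<2 ^ ?n} (\<lambda>c. run B (take s ?R) ?z c - run A (take s ?R) ?z c) \<le> real T * (2 * \<eta>)"
    by simp
  \<comment> \<open>Absorbs \<open>\<eta>\<close> into \<open>T * \<eta>\<close>, so that \<eta> + 2
    T \<eta> is at most 3 T \<eta>; squaring yields the 9.\<close>
  have "1 \<le> real T" using RT s(1) by linarith
  then have "\<eta> \<le> real T * \<eta>" using w(2) mult_right_mono[of 1 "real T" \<eta>] by simp
  moreover have "query_weight F ?n (?C ! t) (run B (take s ?R) ?z) \<le> \<eta> + real T * (2 * \<eta>)"
    using query_weight_le_nrm_diff[of F ?n "?C ! t" "run B (take s ?R) ?z" "run A (take s ?R) ?z"] d q[OF s(1)] s(2)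
    by simp
  ultimately have "query_weight F ?n (?C ! t) (run B (take s ?R) ?z) \<le> 3 * real T * \<eta>" by linarith
  then have "(query_weight F ?n (?C ! t) (run B (take s ?R) ?z))\<^sup>2 \<le> (3 * real T * \<eta>)\<^sup>2"
    by (intro power_mono) auto
  then have sim: "(query_weight F ?n (?C ! t) (run B (take s ?R) ?z))\<^sup>2 \<le> 9 * real T ^ 2 * \<eta>\<^sup>2"
    by (simp add: power_mult_distrib)
  let ?\<psi> = "circuit_mat B ?n ?SC *\<^sub>v zero_state ?n"
  have z: "zero_state ?n \<in> carrier_vec (2 ^ ?n)" by (simp add: zero_state_def)
  have "run B (take s ?R) ?z c = run B (take t ?C) (\<lambda>c. ?\<psi> $ c) c" if "c < 2 ^ ?n" for c
    unfolding s(3) run_simps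
    by (rule run_cong[of ?n])
       (use that circuit_on_mono[OF circuit_on_take[OF Con] vn] circuit_mat_mult_vec[OF SCon _ z] in auto)
  then have e: "query_weight F ?n (?C ! t) (run B (take t ?C) (\<lambda>c. ?\<psi> $ c)) = query_weight F ?n (?C ! t) (run B (take s ?R) ?z)"
    by (intro query_weight_cong) auto
  have "(query_weight F (total_qubits V P) (?C ! t) (run B (take t ?C) (\<lambda>c. joint_state B V P (2 * i) $ c)))\<^sup>2 \<le>
     (query_weight F ?n (?C ! t) (run B (take t ?C) (\<lambda>c. ?\<psi> $ c)))\<^sup>2 +
     trace_norm (reduced_state ?n ?v ?\<psi> - reduced_state (total_qubits V P) ?v (joint_state B V P (2 * i)))"
    by (rule query_weight_trace_norm[OF verifier_qubits_le_total vn circuit_on_take[OF Con] circuit_on_nth[OF Con t]])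
  \<comment> \<open>The factor 2 undoes the halving in \<open>trace_distance\<close>. The
    \<open>i\<close>-th verifier move starts from the view after \<open>2 * i\<close>
    messages.\<close>
  moreover have "trace_norm (reduced_state ?n ?v ?\<psi> - reduced_state (total_qubits V P) ?v (joint_state B V P (2 * i))) \<le> 2 * \<epsilon>"
    using zk[of "2 * i"] i by (simp add: trace_distance_def simulated_view_def view_def split_beta Let_def)
  ultimately show ?thesis using sim unfolding e by linarith
qed

text \<open>The same prover plays under both oracles. With every query weight at most the square
  root shown, the final states are within 2 T times it; passing from norms, which are at most 1, to
  their squares costs another factor 2.\<close>

lemma accept_prob_stable:
  assumes V: "valid_verifier V" and S: "valid_simulator V S" and P: "valid_prover V P"
    and AB: "\<And>u. u \<notin> F \<Longrightarrow> u \<in> A \<longleftrightarrow> u \<in> B"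
    and zk: "\<And>j. j \<le> 2 * rounds V \<Longrightarrow> trace_distance (simulated_view B V S j) (view B V P j) \<le> \<epsilon>"
    and T: "circuit_size V S \<le> T" and w: "simulated_weight A V S F \<le> \<eta>\<^sup>2" "0 \<le> \<eta>" and \<epsilon>: "0 \<le> \<epsilon>"
  shows "accept_prob B V P \<le> accept_prob A V P + 4 * real T * sqrt (9 * real T ^ 2 * \<eta>\<^sup>2 + 2 * \<epsilon>)"
proof -
  let ?N = "total_qubits V P" and ?\<kappa> = "sqrt (9 * real T ^ 2 * \<eta>\<^sup>2 + 2 * \<epsilon>)"
  let ?j = "2 * rounds V + 1"
  let ?a = "\<lambda>k. joint_state A V P ?j $ k" and ?b = "\<lambda>k. joint_state B V P ?j $ k"
  let ?S = "{k. k < 2 ^ ?N \<and> bit k 0}"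
  have \<kappa>: "0 \<le> ?\<kappa>" using \<epsilon> by simp
  have "nrm {..<2 ^ ?N} (\<lambda>k. ?a k - ?b k) \<le>
    (\<Sum>i<Suc ?j div 2. \<Sum>t<length (circuits V ! i). 2 * query_weight F ?N (circuits V ! i ! t)
       (run B (take t (circuits V ! i)) (\<lambda>c. joint_state B V P (2 * i) $ c)))"
    by (rule joint_state_hybrid[OF V P AB]) auto
  also have "\<dots> \<le> (\<Sum>i<Suc ?j div 2. \<Sum>t<length (circuits V ! i). 2 * ?\<kappa>)"
  proof (intro sum_mono)
    fix i t assume "i \<in> {..<Suc ?j div 2}" "t \<in> {..<length (circuits V ! i)}"
    then have it: "i \<le> rounds V" "t < length (circuits V ! i)" by auto
    show "2 * query_weight F ?N (circuits V ! i ! t)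
       (run B (take t (circuits V ! i)) (\<lambda>c. joint_state B V P (2 * i) $ c)) \<le> 2 * ?\<kappa>"
      using verifier_query_weight[OF V S P AB zk T w it] by (simp add: real_le_rsqrt)
  qed
  also have "\<dots> = real (\<Sum>i\<le>rounds V. length (circuits V ! i)) * (2 * ?\<kappa>)"
    by (simp add: sum_distrib_right lessThan_Suc_atMost)
  also have "\<dots> \<le> real T * (2 * ?\<kappa>)"
    using T \<kappa> sum_length_circuits[OF V] by (intro mult_right_mono) (auto simp: circuit_size_def)
  finally have d: "nrm {..<2 ^ ?N} (\<lambda>k. ?a k - ?b k) \<le> 2 * real T * ?\<kappa>" by simp
  have sub: "?S \<subseteq> {..<2 ^ ?N}" by auto
  have "nrm ?S ?b \<le> nrm ?S ?a + nrm ?S (\<lambda>k. ?b k - ?a k)" by (rule nrm_le_diff)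
  also have "nrm ?S (\<lambda>k. ?b k - ?a k) \<le> nrm {..<2 ^ ?N} (\<lambda>k. ?b k - ?a k)"
    by (rule nrm_subset[OF _ sub]) simp
  finally have ba: "nrm ?S ?b - nrm ?S ?a \<le> 2 * real T * ?\<kappa>"
    using d nrm_commute[of "{..<2 ^ ?N}" ?a ?b] by simp
  have le1: "nrm ?S ?a \<le> 1" "nrm ?S ?b \<le> 1"
    using nrm_subset[OF _ sub, of ?a] nrm_subset[OF _ sub, of ?b] joint_state_norm[OF V P, of ?j] by auto
  have "accept_prob B V P - accept_prob A V P = (nrm ?S ?b - nrm ?S ?a) * (nrm ?S ?b + nrm ?S ?a)"
    unfolding accept_prob_nrm by (simp add: power2_eq_square algebra_simps)
  also have "\<dots> \<le> 2 * real T * ?\<kappa> * (nrm ?S ?b + nrm ?S ?a)"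
    using ba by (intro mult_right_mono) auto
  also have "\<dots> \<le> 2 * real T * ?\<kappa> * 2"
    using le1 \<kappa> by (intro mult_left_mono) auto
  finally show ?thesis by simp
qed

text \<open>For a good \<open>w\<close>, accepting with probability 2/3 under the planted oracle but
  at most 1/3 under \<open>A\<close> leaves a gap that only a large simulated weight on
  \<open>F w\<close> can explain. The weights sum to at most \<open>T\<close>, so at most half of
  \<open>W\<close> can reach the threshold.\<close>

lemma few_good_witnesses:
  assumes V: "valid_verifier V" and S: "valid_simulator V S"
    and W: "finite W" "disjoint_family_on F W"
    and T: "circuit_size V S \<le> T" "0 < T" and \<epsilon>: "0 \<le> \<epsilon>"
    and small: "real T ^ 2 * (18 * real T ^ 3 / real (card W) + 2 * \<epsilon>) < 1 / 144"
    and sound: "\<And>P. valid_prover V P \<Longrightarrow> accept_prob A V P \<le> 1 / 3"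
  shows "2 * card {w \<in> W. \<exists>P. valid_prover V P \<and> accept_prob (A \<union> F w) V P \<ge> 2 / 3 \<and>
      (\<forall>j\<le>2 * rounds V. trace_distance (simulated_view (A \<union> F w) V S j) (view (A \<union> F w) V P j) \<le> \<epsilon>)} \<le> card W"
    (is "2 * card ?G \<le> _")
proof (cases "W = {}")
  case False
  then have W0: "card W > 0" using W by (simp add: card_gt_0_iff)
  \<comment> \<open>Twice the largest possible mean weight, as in Markov's inequality.\<close>
  let ?\<eta>2 = "2 * real T / real (card W)"
  have big: "?\<eta>2 \<le> simulated_weight A V S (F w)" if w: "w \<in> ?G" for w
  proof (rule ccontr)
    assume n: "\<not> ?thesis"
    obtain P where P: "valid_prover V P" "accept_prob (A \<union> F w) V P \<ge> 2 / 3"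
      "\<And>j. j \<le> 2 * rounds V \<Longrightarrow> trace_distance (simulated_view (A \<union> F w) V S j) (view (A \<union> F w) V P j) \<le> \<epsilon>"
      using w by blast
    have \<eta>: "(sqrt ?\<eta>2)\<^sup>2 = ?\<eta>2" "0 \<le> sqrt ?\<eta>2" by auto
    have "accept_prob (A \<union> F w) V P \<le> accept_prob A V P + 4 * real T * sqrt (9 * real T ^ 2 * (sqrt ?\<eta>2)\<^sup>2 + 2 * \<epsilon>)"
      by (rule accept_prob_stable[OF V S P(1) _ P(3) T(1) _ \<eta>(2) \<epsilon>]) (use n in \<open>auto simp: \<eta>(1)\<close>)
    then have "1 / 3 \<le> 4 * real T * sqrt (9 * real T ^ 2 * ?\<eta>2 + 2 * \<epsilon>)"
      using P(2) sound[OF P(1)] unfolding \<eta>(1) by linarith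
    then have "(1 / 3)\<^sup>2 \<le> (4 * real T * sqrt (9 * real T ^ 2 * ?\<eta>2 + 2 * \<epsilon>))\<^sup>2"
      by (intro power_mono) auto
    \<comment> \<open>Origin of the constants in the smallness hypothesis: 18 = 9 * 2 from the
      threshold, and 144 = 9 * 16 from the squared gap 1/9 and the squared factor 4.\<close>
    also have "\<dots> = 16 * (real T ^ 2 * (18 * real T ^ 3 / real (card W) + 2 * \<epsilon>))"
      using \<epsilon> by (simp add: power_mult_distrib power2_eq_square power3_eq_cube)
    finally have "1 / 9 \<le> 16 * (real T ^ 2 * (18 * real T ^ 3 / real (card W) + 2 * \<epsilon>))"
      by (simp add: power_divide)
    then show False using small by linarith
  qed
  have "real (card ?G) * ?\<eta>2 = (\<Sum>w\<in>?G. ?\<eta>2)" by simp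
  also have "\<dots> \<le> (\<Sum>w\<in>?G. simulated_weight A V S (F w))" by (intro sum_mono big)
  also have "\<dots> \<le> (\<Sum>w\<in>W. simulated_weight A V S (F w))"
    using W by (intro sum_mono2) (auto simp: simulated_weight_def intro!: sum_nonneg)
  also have "\<dots> \<le> real (circuit_size V S)" by (rule sum_simulated_weight_le[OF V S W])
  also have "\<dots> \<le> real T" using T by simp
  finally have "real (card ?G) * (2 * real T) \<le> real T * real (card W)"
    using W0 by (simp add: field_simps)
  then have "2 * real (card ?G) \<le> real (card W)" using T(2) by (simp add: mult.assoc mult.left_commute[of _ "real T"])
  then show ?thesis by linarith
qed simp

section \<open>A machine for the witness language\<close>

fun interleave :: "'a list \<Rightarrow> 'a list \<Rightarrow> 'a list" where
  "interleave (a # x) (b # w) = a # b # interleave x w"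
| "interleave _ _ = []"

lemma length_interleave: "length x = length w \<Longrightarrow> length (interleave x w) = 2 * length x"
  by (induction x w rule: list_induct2) auto

lemma interleave_snoc:
  "length x = length w \<Longrightarrow> interleave (x @ [a]) (w @ [b]) = interleave x w @ [a, b]"
  by (induction x w rule: list_induct2) auto

lemma interleave_inject:
  assumes "length x = length w" "length x' = length w'" "length x = length x'"
    and "interleave x w = interleave x' w'"
  shows "x = x' \<and> w = w'"
  using assms
proof (induction x w arbitrary: x' w' rule: list_induct2)
  case Nil
  then show ?case by simp
next
  case (Cons a x b w)
  then show ?case by (cases x'; cases w') auto
qed

definition query_count :: "nat \<Rightarrow> nat \<Rightarrow> nat" where
  "query_count k n = 2 * n + k + 2"

definition block :: "nat \<Rightarrow> bool list \<Rightarrow> bool list \<Rightarrow> bool list set" where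
  "block k x w = (\<lambda>j. interleave x w @ replicate j True) ` {..<query_count k (length x)}"

definition witness :: "nat \<Rightarrow> language \<Rightarrow> bool list \<Rightarrow> bool list \<Rightarrow> bool" where
  "witness k A x w \<longleftrightarrow> length w = length x \<and> block k x w \<subseteq> A"

definition witness_lang :: "nat \<Rightarrow> language \<Rightarrow> language" where
  "witness_lang k A = {x. \<exists>w. witness k A x w}"

text \<open>
  States 0 and 1 write the input interleaved with guessed bits to the query tape. Tape 0 becomes a
  counter: a cell holding \<open>Aux c\<close> stands for \<open>c + 1\<close> queries, each followed by appending a bit to the
  query tape.
\<close>

definition witness_machine :: "nat \<Rightarrow> otm" where
  "witness_machine k = \<lparr>
     work_tapes = 0, start_state = 0, accept_state = 2, query_state = 3,
     yes_state = 4, no_state = 5,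
     transitions =
       [((0, [Bit b, Blank]), (1, [(Bit b, Stay), (Bit b, MoveRight)])). b \<leftarrow> [False, True]] @
       [((1, [Bit b, Blank]), (0, [(Aux 1, MoveRight), (Bit c, MoveRight)])).
          b \<leftarrow> [False, True], c \<leftarrow> [False, True]] @
       [((0, [Blank, Blank]), (3, [(Aux k, Stay), (Blank, Stay)])),
        ((4, [Aux 0, Blank]), (3, [(Aux 0, MoveLeft), (Bit True, MoveRight)])),
        ((4, [Blank, Blank]), (2, [(Blank, Stay), (Blank, Stay)]))] @
       [((4, [Aux (Suc i), Blank]), (3, [(Aux i, Stay), (Bit True, MoveRight)])). i \<leftarrow> [0..<Suc k]]
   \<rparr>"

definition word_tape :: "bool list \<Rightarrow> tape" where
  "word_tape u = (\<lambda>i. if 0 \<le> i \<and> i < int (length u) then Bit (u ! nat i) else Blank, int (length u))"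

lemma read_word_tape: "read_tape (word_tape u) = Blank"
  by (simp add: read_tape_def word_tape_def)

lemma act_word_tape_Bit: "act_tape (Bit b, MoveRight) (word_tape u) = word_tape (u @ [b])"
  by (auto simp: act_tape_def word_tape_def fun_eq_iff nth_append)

lemma act_word_tape_Blank: "act_tape (Blank, Stay) (word_tape u) = word_tape u"
  by (auto simp: act_tape_def word_tape_def fun_eq_iff)

lemma tape_word_word_tape: "tape_word (word_tape u) = u"
proof -
  have "(LEAST i. fst (word_tape u) (int i) \<notin> range Bit) = length u"
  proof (rule Least_equality)
    show "fst (word_tape u) (int (length u)) \<notin> range Bit" by (auto simp: word_tape_def)
    fix i assume "fst (word_tape u) (int i) \<notin> range Bit"
    then show "length u \<le> i" by (auto simp: word_tape_def split: if_splits)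
  qed
  then show ?thesis
    unfolding tape_word_def by (intro nth_equalityI) (simp_all add: word_tape_def)
qed

text \<open>Scanned cells already hold \<open>Aux 1\<close>, good for two queries each, so copying
  sets up a count of 2n without arithmetic.\<close>

definition copy_tape :: "bool list \<Rightarrow> nat \<Rightarrow> tape" where
  "copy_tape x i = (\<lambda>p. if 0 \<le> p \<and> p < int i then Aux 1
     else if 0 \<le> p \<and> p < int (length x) then Bit (x ! nat p) else Blank, int i)"

text \<open>
  Tape 0 while the queries are made, with the head on cell \<open>m - 1\<close>, which holds \<open>Aux c\<close>. The head
  ends up on the blank cell \<open>-1\<close>, where \<open>m = 0\<close>.
\<close>

definition counter_tape :: "nat \<Rightarrow> nat \<times> nat \<Rightarrow> tape" where
  "counter_tape n mc = (\<lambda>p. if 0 \<le> p \<and> p < int (fst mc) - 1 then Aux 1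
     else if 0 \<le> p \<and> p = int (fst mc) - 1 then Aux (snd mc)
     else if int (fst mc) \<le> p \<and> p \<le> int n then Aux 0 else Blank, int (fst mc) - 1)"

text \<open>Query number \<open>j\<close> is made with the head on cell n for k + 1 values of
  \<open>j\<close>, on each of the cells n - 1, ..., 0 for two values, and on the blank cell -1 for
  one: 2n + k + 2 in all. In the final pair \<open>(0, 1)\<close> the second component stands for
  nothing on the tape.\<close>

definition counter_value :: "nat \<Rightarrow> nat \<Rightarrow> nat \<Rightarrow> nat \<times> nat" where
  "counter_value k n j = (if j \<le> k then (Suc n, k - j)
     else (n - (j - Suc k) div 2, 1 - (j - Suc k) mod 2))"

lemma read_copy_tape: "read_tape (copy_tape x i) = (if i < length x then Bit (x ! i) else Blank)"
  by (simp add: read_tape_def copy_tape_def)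

lemma act_copy_tape_Stay: "i < length x \<Longrightarrow> act_tape (Bit (x ! i), Stay) (copy_tape x i) = copy_tape x i"
  by (auto simp: act_tape_def copy_tape_def fun_eq_iff)

lemma act_copy_tape_Right:
  "i < length x \<Longrightarrow> act_tape (Aux 1, MoveRight) (copy_tape x i) = copy_tape x (Suc i)"
  by (auto simp: act_tape_def copy_tape_def fun_eq_iff)

lemma act_copy_tape_end:
  "act_tape (Aux k, Stay) (copy_tape x (length x)) = counter_tape (length x) (counter_value k (length x) 0)"
  by (auto simp: act_tape_def copy_tape_def counter_tape_def counter_value_def fun_eq_iff)

lemma read_counter_tape:
  "read_tape (counter_tape n (m, c)) = (if m = 0 then Blank else Aux c)"
  by (auto simp: read_tape_def counter_tape_def)

lemma act_counter_tape_Suc: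
  "0 < m \<Longrightarrow> act_tape (Aux c, Stay) (counter_tape n (m, Suc c)) = counter_tape n (m, c)"
  by (auto simp: act_tape_def counter_tape_def fun_eq_iff)

lemma act_counter_tape_0:
  "m \<le> n \<Longrightarrow> act_tape (Aux 0, MoveLeft) (counter_tape n (Suc m, 0)) = counter_tape n (m, 1)"
  by (auto simp: act_tape_def counter_tape_def fun_eq_iff)

lemma act_counter_tape_Blank:
  "act_tape (Blank, Stay) (counter_tape n (0, c)) = counter_tape n (0, c)"
  by (auto simp: act_tape_def counter_tape_def fun_eq_iff)

text \<open>The two cases are the two kinds of transition back into the query state: decrement the
  current cell, or leave an exhausted one to the left.\<close>

lemma counter_value_cases:
  assumes "Suc j < query_count k n"
  obtains m c where "counter_value k n j = (Suc m, Suc c)" "c \<le> k" "counter_value k n (Suc j) = (Suc m, c)"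
  | m where "counter_value k n j = (Suc m, 0)" "m \<le> n" "counter_value k n (Suc j) = (m, 1)"
proof (cases "j \<le> k")
  case True
  show ?thesis
  proof (cases "j = k")
    case True
    then show ?thesis by (intro that(2)[of n]) (auto simp: counter_value_def)
  next
    case False
    with \<open>j \<le> k\<close> show ?thesis by (intro that(1)[of n "k - j - 1"]) (auto simp: counter_value_def)
  qed
next
  case False
  define d where "d = j - Suc k"
  have j: "j = Suc k + d" using False by (simp add: d_def)
  have d: "d < 2 * n" using assms j by (simp add: query_count_def)
  show ?thesis
  proof (cases "even d")
    case True
    then obtain e where e: "d = 2 * e" by blast
    with d show ?thesis by (intro that(1)[of "n - e - 1" 0]) (auto simp: counter_value_def j)
  next
    case False
    then obtain e where e: "d = Suc (2 * e)" by (auto elim: oddE)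
    with d show ?thesis by (intro that(2)[of "n - e - 1"]) (auto simp: counter_value_def j)
  qed
qed

lemma counter_value_last: "counter_value k n (2 * n + k + 1) = (0, 1)"
  by (simp add: counter_value_def)

definition copy_config :: "nat \<Rightarrow> bool list \<Rightarrow> bool list \<Rightarrow> nat \<Rightarrow> config" where
  "copy_config s x w i =
     (s, [copy_tape x i,
          word_tape (interleave (take i x) (take i w) @ (if s = 0 then [] else [x ! i]))])"

definition query_config :: "nat \<Rightarrow> nat \<Rightarrow> bool list \<Rightarrow> bool list \<Rightarrow> nat \<Rightarrow> config" where
  "query_config s k x w j =
     (s, [counter_tape (length x) (counter_value k (length x) j),
          word_tape (interleave x w @ replicate j True)])"

text \<open>Two steps per input bit, one step into the first query, and two steps per query.\<close>

definition run_time :: "nat \<Rightarrow> nat \<Rightarrow> nat" where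
  "run_time k n = 2 * n + 1 + 2 * query_count k n"

text \<open>The configuration at time \<open>t\<close> of the path guessing \<open>w\<close>, all queries being answered yes.\<close>

definition config_at :: "nat \<Rightarrow> bool list \<Rightarrow> bool list \<Rightarrow> nat \<Rightarrow> config" where
  "config_at k x w t =
     (let n = length x; s = t - (2 * n + 1) in
      if t \<le> 2 * n then copy_config (t mod 2) x w (t div 2)
      else if t < run_time k n then query_config (if even s then 3 else 4) k x w (s div 2)
      else query_config 2 k x w (2 * n + k + 1))"

lemma time_cases:
  assumes "t \<le> run_time k n"
  obtains (copy0) i where "i < n" "t = 2 * i"
  | (copy1) i where "i < n" "t = Suc (2 * i)"
  | (copied) "t = 2 * n"
  | (query) j where "j < query_count k n" "t = 2 * n + 1 + 2 * j"
  | (answer) j where "j < query_count k n" "t = 2 * n + 2 + 2 * j"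
  | (halt) "t = run_time k n"
proof -
  consider "t < 2 * n" | "t = 2 * n" | "t > 2 * n" "t < run_time k n" | "t = run_time k n"
    using assms by linarith
  then show thesis
  proof cases
    case 1
    then show ?thesis using copy0[of "t div 2"] copy1[of "t div 2"] by (cases "even t") (auto elim!: oddE)
  next
    case 3
    define s where "s = t - (2 * n + 1)"
    have t: "t = 2 * n + 1 + s" using 3 by (simp add: s_def)
    have s: "s < 2 * query_count k n" using 3 t by (simp add: run_time_def)
    show ?thesis using query[of "s div 2"] answer[of "s div 2"] s t by (cases "even s") (auto elim!: oddE)
  qed (use copied halt in auto)
qed

lemma config_at_simps:
  "i \<le> length x \<Longrightarrow> config_at k x w (2 * i) = copy_config 0 x w i"
  "i < length x \<Longrightarrow> config_at k x w (Suc (2 * i)) = copy_config 1 x w i"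
  "j < query_count k (length x) \<Longrightarrow> config_at k x w (2 * length x + 1 + 2 * j) = query_config 3 k x w j"
  "j < query_count k (length x) \<Longrightarrow> config_at k x w (2 * length x + 2 + 2 * j) = query_config 4 k x w j"
  "config_at k x w (run_time k (length x)) = query_config 2 k x w (2 * length x + k + 1)"
  by (auto simp: config_at_def run_time_def Let_def)

lemma initial_config_witness_machine: "initial_config (witness_machine k) x = config_at k x w 0"
  using config_at_simps(1)[of 0 x k w]
  by (simp add: initial_config_def witness_machine_def copy_config_def input_tape_def blank_tape_def
      copy_tape_def word_tape_def fun_eq_iff)

lemma interleave_take_Suc:
  assumes "i < length x" "length w = length x"
  shows "interleave (take (Suc i) x) (take (Suc i) w) = interleave (take i x) (take i w) @ [x ! i, w ! i]"
  using assms interleave_snoc[of "take i x" "take i w"] by (simp add: take_Suc_conv_app_nth)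

lemma stepE_transition:
  assumes "step A M (s, [t, t']) c" "s \<noteq> query_state M"
  obtains q a a' where "((s, [read_tape t, read_tape t']), (q, [a, a'])) \<in> set (transitions M)"
    "c = (q, [act_tape a t, act_tape a' t'])"
proof -
  obtain q acts where *: "((s, [read_tape t, read_tape t']), (q, acts)) \<in> set (transitions M)"
    "length acts = 2" "c = (q, map2 act_tape acts [t, t'])"
    using assms by (auto simp: step_def)
  then obtain a a' where "acts = [a, a']" by (auto simp: length_Suc_conv numeral_2_eq_2)
  with * show thesis by (intro that) auto
qed

lemma witness_machine_simps:
  "start_state (witness_machine k) = 0" "accept_state (witness_machine k) = 2"
  "query_state (witness_machine k) = 3" "yes_state (witness_machine k) = 4"
  "no_state (witness_machine k) = 5" "work_tapes (witness_machine k) = 0"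
  by (simp_all add: witness_machine_def)

lemma transitions_witness_machine:
  "((s, [r, r']), (q, [a, a'])) \<in> set (transitions (witness_machine k)) \<longleftrightarrow> r' = Blank \<and>
     (s = 0 \<and> q = 1 \<and> (\<exists>b. r = Bit b \<and> a = (Bit b, Stay) \<and> a' = (Bit b, MoveRight)) \<or>
      s = 1 \<and> q = 0 \<and> (\<exists>b c. r = Bit b \<and> a = (Aux 1, MoveRight) \<and> a' = (Bit c, MoveRight)) \<or>
      s = 0 \<and> q = 3 \<and> r = Blank \<and> a = (Aux k, Stay) \<and> a' = (Blank, Stay) \<or>
      s = 4 \<and> q = 3 \<and> r = Aux 0 \<and> a = (Aux 0, MoveLeft) \<and> a' = (Bit True, MoveRight) \<or>
      s = 4 \<and> q = 2 \<and> r = Blank \<and> a = (Blank, Stay) \<and> a' = (Blank, Stay) \<or>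
      s = 4 \<and> q = 3 \<and> (\<exists>i\<le>k. r = Aux (Suc i) \<and> a = (Aux i, Stay) \<and> a' = (Bit True, MoveRight)))"
proof (cases r)
  case Blank
  then show ?thesis unfolding witness_machine_def by (simp add: image_iff del: upt_Suc) blast
next
  case (Bit b)
  then show ?thesis unfolding witness_machine_def by (cases b) (simp_all add: image_iff del: upt_Suc, blast+)
next
  case (Aux i)
  have "y \<in> set (map f [0..<Suc k]) \<longleftrightarrow> (\<exists>j\<le>k. y = f j)" for y and f :: "nat \<Rightarrow> 'b"
    by (auto simp: less_Suc_eq_le simp del: upt_Suc)
  note m = this
  show ?thesis unfolding witness_machine_def Aux otm.simps set_append Un_iff m
    by (cases i) (simp_all, blast+)
qed

lemma step_transition:
  assumes "((s, [read_tape t, read_tape t']), (q, [a, a'])) \<in> set (transitions M)"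
    and "s \<noteq> accept_state M" "s \<noteq> query_state M"
  shows "step A M (s, [t, t']) (q, [act_tape a t, act_tape a' t'])"
  unfolding step_def using assms by (auto intro!: exI[of _ q] exI[of _ "[a, a']"])

text \<open>The machine branches only when it writes a guessed bit. The word \<open>w\<close>
  describing a path is thus fixed letter by letter: a step may replace it by a \<open>w'\<close>
  giving the same past. State 5 is the dead end after a negative answer.\<close>

lemma step_config_at:
  assumes w: "length w = length x" "t \<le> run_time k (length x)"
    and step: "step A (witness_machine k) (config_at k x w t) c"
  shows "t < run_time k (length x) \<and>
    (fst c = 5 \<or> (\<exists>w'. length w' = length x \<and> c = config_at k x w' (Suc t) \<and>
                    (\<forall>s\<le>t. config_at k x w' s = config_at k x w s)))"
  using w(2)
proof (cases rule: time_cases)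
  case (copy0 i)
  let ?u = "interleave (take i x) (take i w)"
  have "config_at k x w t = (0, [copy_tape x i, word_tape ?u])"
    using copy0 by (simp add: config_at_simps copy_config_def)
  from step[unfolded this] have "c = copy_config 1 x w i"
    by (rule stepE_transition)
       (use copy0 in \<open>auto simp: witness_machine_simps transitions_witness_machine copy_config_def
          read_copy_tape act_copy_tape_Stay act_word_tape_Bit\<close>)
  then show ?thesis using copy0 w by (auto simp: config_at_simps run_time_def intro!: exI[of _ w])
next
  case (copy1 i)
  let ?u = "interleave (take i x) (take i w) @ [x ! i]"
  have "config_at k x w t = (1, [copy_tape x i, word_tape ?u])"
    using copy1 by (simp add: config_at_simps copy_config_def)
  from step[unfolded this] obtain b where c: "c = (0, [copy_tape x (Suc i), word_tape (?u @ [b])])"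
    by (rule stepE_transition)
       (use copy1 in \<open>auto simp: witness_machine_simps transitions_witness_machine
          read_copy_tape act_copy_tape_Right[simplified] act_word_tape_Bit\<close>)
  \<comment> \<open>Letter \<open>i\<close> has not influenced any configuration up to time
    \<open>t\<close>, so it may be corrected to the bit just guessed.\<close>
  define w' where "w' = w[i := b]"
  have w': "length w' = length x" by (simp add: w'_def w)
  have tk: "take i' w' = take i' w" if "i' \<le> i" for i' using that by (simp add: w'_def)
  have "c = copy_config 0 x w' (Suc i)"
    using copy1 w' w by (simp add: c copy_config_def interleave_take_Suc tk) (simp add: w'_def)
  then have "c = config_at k x w' (Suc t)"
    using copy1 config_at_simps(1)[of "Suc i" x k w'] by simp
  moreover have "config_at k x w' s = config_at k x w s" if "s \<le> t" for s
    using that copy1 tk[of "s div 2"] by (auto simp: config_at_def Let_def copy_config_def)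
  ultimately show ?thesis using copy1 w' by (auto simp: run_time_def)
next
  case copied
  have "config_at k x w t = (0, [copy_tape x (length x), word_tape (interleave x w)])"
    using copied w(1) by (simp add: config_at_simps copy_config_def)
  from step[unfolded this] have "c = query_config 3 k x w 0"
    by (rule stepE_transition)
       (auto simp: witness_machine_simps transitions_witness_machine query_config_def
          read_copy_tape act_copy_tape_end act_word_tape_Blank)
  then show ?thesis using copied w config_at_simps(3)[of 0 k x w]
    by (auto simp: run_time_def query_count_def intro!: exI[of _ w])
next
  case (query j)
  have "config_at k x w t = query_config 3 k x w j" using query config_at_simps(3)[of j k x w] by simp
  from step[unfolded this] have "fst c = 5 \<or> c = query_config 4 k x w j"
    by (auto simp: step_def query_config_def witness_machine_simps)
  then show ?thesis using query w config_at_simps(4)[of j k x w]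
    by (auto simp: run_time_def intro!: exI[of _ w])
next
  case (answer j)
  let ?u = "interleave x w @ replicate j True"
  have e: "config_at k x w t = (4, [counter_tape (length x) (counter_value k (length x) j), word_tape ?u])"
    using answer config_at_simps(4)[of j k x w] by (simp add: query_config_def)
  show ?thesis
  proof (cases "Suc j < query_count k (length x)")
    case True
    have "c = query_config 3 k x w (Suc j)"
      using True
    proof (cases rule: counter_value_cases)
      case (1 m c)
      from step[unfolded e 1] show ?thesis
        by (rule stepE_transition)
           (auto simp: witness_machine_simps transitions_witness_machine query_config_def 1
             read_counter_tape act_counter_tape_Suc act_word_tape_Bit replicate_append_same)
    next
      case (2 m)
      from step[unfolded e 2] show ?thesis
        by (rule stepE_transition)
           (use 2 in \<open>auto simp: witness_machine_simps transitions_witness_machine query_config_def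
             read_counter_tape act_counter_tape_0[simplified] act_word_tape_Bit replicate_append_same\<close>)
    qed
    then show ?thesis using answer w True config_at_simps(3)[of "Suc j" k x w]
      by (auto simp: run_time_def intro!: exI[of _ w])
  next
    case False
    then have j: "j = 2 * length x + k + 1" using answer by (simp add: query_count_def)
    then have v: "counter_value k (length x) j = (0, 1)" using counter_value_last[of k "length x"] by simp
    from step[unfolded e v] have "c = query_config 2 k x w j"
      by (rule stepE_transition)
         (auto simp: witness_machine_simps transitions_witness_machine query_config_def v
           read_counter_tape act_counter_tape_Blank act_word_tape_Blank)
    moreover have "Suc t = run_time k (length x)" using answer j by (simp add: run_time_def query_count_def)
    ultimately show ?thesis using w config_at_simps(5)[of k x w] j by (auto intro!: exI[of _ w])
  qed
next
  case halt
  then show ?thesis using step by (simp add: config_at_simps(5) step_def query_config_def witness_machine_simps)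
qed

lemma config_at_step:
  assumes w: "witness k A x w" "t < run_time k (length x)"
  shows "step A (witness_machine k) (config_at k x w t) (config_at k x w (Suc t))"
  using less_imp_le[OF w(2)]
proof (cases rule: time_cases)
  case (copy0 i)
  let ?u = "interleave (take i x) (take i w)"
  have "step A (witness_machine k) (0, [copy_tape x i, word_tape ?u])
      (1, [act_tape (Bit (x ! i), Stay) (copy_tape x i), act_tape (Bit (x ! i), MoveRight) (word_tape ?u)])"
    using copy0 by (intro step_transition) (auto simp: transitions_witness_machine witness_machine_simps read_copy_tape read_word_tape)
  then show ?thesis using copy0
    by (simp add: config_at_simps copy_config_def act_copy_tape_Stay act_word_tape_Bit)
next
  case (copy1 i)
  let ?u = "interleave (take i x) (take i w) @ [x ! i]"
  have e: "config_at k x w (Suc t) = copy_config 0 x w (Suc i)"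
    using copy1 config_at_simps(1)[of "Suc i" x k w] by simp
  have u: "interleave (take (Suc i) x) (take (Suc i) w) = ?u @ [w ! i]"
    using w copy1 interleave_take_Suc[of i x w] by (auto simp: witness_def)
  have "step A (witness_machine k) (1, [copy_tape x i, word_tape ?u])
      (0, [act_tape (Aux 1, MoveRight) (copy_tape x i), act_tape (Bit (w ! i), MoveRight) (word_tape ?u)])"
    using copy1 by (intro step_transition) (auto simp: transitions_witness_machine witness_machine_simps read_copy_tape read_word_tape)
  then show ?thesis unfolding e using copy1 u
    by (simp only: config_at_simps copy_config_def act_copy_tape_Right act_word_tape_Bit) simp
next
  case copied
  let ?n = "length x"
  have e: "config_at k x w (Suc t) = query_config 3 k x w 0"
    using copied config_at_simps(3)[of 0 k x w] by (simp add: query_count_def)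
  have "step A (witness_machine k) (0, [copy_tape x ?n, word_tape (interleave x w)])
      (3, [act_tape (Aux k, Stay) (copy_tape x ?n), act_tape (Blank, Stay) (word_tape (interleave x w))])"
    by (intro step_transition) (auto simp: transitions_witness_machine witness_machine_simps read_copy_tape read_word_tape)
  then show ?thesis unfolding e using copied w
    by (simp add: config_at_simps copy_config_def query_config_def act_copy_tape_end act_word_tape_Blank witness_def)
next
  case (query j)
  have "interleave x w @ replicate j True \<in> A" using w query by (auto simp: witness_def block_def)
  then show ?thesis using query config_at_simps(3,4)[of j k x w]
    by (simp add: step_def query_config_def witness_machine_simps tape_word_word_tape)
next
  case (answer j)
  show ?thesis
  proof (cases "Suc j < query_count k (length x)")
    case True
    have e: "config_at k x w (Suc t) = query_config 3 k x w (Suc j)"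
      using answer True config_at_simps(3)[of "Suc j" k x w] by simp
    let ?u = "interleave x w @ replicate j True"
    show ?thesis using True
    proof (cases rule: counter_value_cases)
      case (1 m c)
      have "step A (witness_machine k) (4, [counter_tape (length x) (Suc m, Suc c), word_tape ?u])
        (3, [act_tape (Aux c, Stay) (counter_tape (length x) (Suc m, Suc c)),
             act_tape (Bit True, MoveRight) (word_tape ?u)])"
        using 1(2) by (intro step_transition) (auto simp: transitions_witness_machine witness_machine_simps read_counter_tape read_word_tape)
      then show ?thesis unfolding e using answer 1
        by (simp add: config_at_simps(4)[simplified] query_config_def act_counter_tape_Suc act_word_tape_Bit
            replicate_append_same)
    next
      case (2 m)
      have "step A (witness_machine k) (4, [counter_tape (length x) (Suc m, 0), word_tape ?u])
        (3, [act_tape (Aux 0, MoveLeft) (counter_tape (length x) (Suc m, 0)),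
             act_tape (Bit True, MoveRight) (word_tape ?u)])"
        by (intro step_transition) (auto simp: transitions_witness_machine witness_machine_simps read_counter_tape read_word_tape)
      then show ?thesis unfolding e using answer 2
        by (simp add: config_at_simps(4)[simplified] query_config_def act_counter_tape_0 act_word_tape_Bit
            replicate_append_same)
    qed
  next
    case False
    then have j: "j = 2 * length x + k + 1" using answer by (simp add: query_count_def)
    let ?u = "interleave x w @ replicate j True"
    have e: "config_at k x w (Suc t) = query_config 2 k x w j"
      using answer j config_at_simps(5)[of k x w] by (simp add: run_time_def query_count_def)
    have "step A (witness_machine k) (4, [counter_tape (length x) (0, 1), word_tape ?u])
        (2, [act_tape (Blank, Stay) (counter_tape (length x) (0, 1)), act_tape (Blank, Stay) (word_tape ?u)])"
      by (intro step_transition) (auto simp: transitions_witness_machine witness_machine_simps read_counter_tape read_word_tape)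
    moreover have "counter_value k (length x) j = (0, 1)"
      using counter_value_last[of k "length x"] j by simp
    then have "config_at k x w t = (4, [counter_tape (length x) (0, 1), word_tape ?u])"
      using answer config_at_simps(4)[of j k x w] by (simp add: query_config_def)
    ultimately show ?thesis unfolding e using \<open>counter_value k (length x) j = (0, 1)\<close>
      by (simp add: query_config_def act_counter_tape_Blank act_word_tape_Blank)
  qed
qed (use w in simp)

lemma no_step_from_no: "fst c = 5 \<Longrightarrow> \<not> step A (witness_machine k) c c'"
  by (auto simp: step_def witness_machine_def)

text \<open>Covers rejecting paths as well, as the time bound requires; the last configuration is
  singled out because it may be the dead end.\<close>

lemma computation_path_config_at:
  assumes "computation_path A (witness_machine k) x cs"
  shows "\<exists>w. length w = length x \<and> length cs \<le> Suc (run_time k (length x)) \<and>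
           (\<forall>t < length cs - 1. cs ! t = config_at k x w t) \<and>
           (last cs = config_at k x w (length cs - 1) \<or> fst (last cs) = 5)"
  using assms
proof (induction cs rule: rev_induct)
  case Nil
  then show ?case by (simp add: computation_path_def)
next
  case (snoc c cs)
  show ?case
  proof (cases "cs = []")
    case True
    \<comment> \<open>Nothing has been guessed yet; \<open>x\<close> merely serves as some word of
      the right length.\<close>
    then show ?thesis using snoc.prems
      by (auto simp: computation_path_def initial_config_witness_machine[of _ _ x] intro!: exI[of _ x])
  next
    case False
    then have path: "computation_path A (witness_machine k) x cs" and
      st: "step A (witness_machine k) (last cs) c"
      using snoc.prems by (auto simp: computation_path_def successively_append_iff)
    from snoc.IH[OF path] obtain w where w: "length w = length x" "length cs \<le> Suc (run_time k (length x))"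
      "\<And>t. t < length cs - 1 \<Longrightarrow> cs ! t = config_at k x w t"
      and l: "last cs = config_at k x w (length cs - 1)"
      using no_step_from_no[of "last cs"] st by blast
    have all: "cs ! t = config_at k x w t" if "t < length cs" for t
      using w(3) l that False by (cases "t = length cs - 1") (auto simp: last_conv_nth)
    from step_config_at[OF w(1) _ st[unfolded l]] w(2) False
    have lt: "length cs - 1 < run_time k (length x)" and
      *: "fst c = 5 \<or> (\<exists>w'. length w' = length x \<and> c = config_at k x w' (length cs) \<and>
                    (\<forall>s\<le>length cs - 1. config_at k x w' s = config_at k x w s))"
      by auto
    from * show ?thesis
    proof
      assume "fst c = 5"
      then show ?thesis using w(1) all lt by (intro exI[of _ w]) (auto simp: nth_append)
    next
      assume "\<exists>w'. length w' = length x \<and> c = config_at k x w' (length cs) \<and>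
                    (\<forall>s\<le>length cs - 1. config_at k x w' s = config_at k x w s)"
      then obtain w' where "length w' = length x" "c = config_at k x w' (length cs)"
        "\<forall>s\<le>length cs - 1. config_at k x w' s = config_at k x w s" by blast
      then show ?thesis using all lt by (intro exI[of _ w']) (auto simp: nth_append)
    qed
  qed
qed

text \<open>The path is a function of the witness, so unique witnesses give unique accepting
  paths.\<close>

lemma accepting_path_iff:
  "accepting_path A (witness_machine k) x cs \<longleftrightarrow>
     (\<exists>w. witness k A x w \<and> cs = map (config_at k x w) [0..<Suc (run_time k (length x))])"
  (is "?L \<longleftrightarrow> ?R")
proof
  assume ?L
  then have path: "computation_path A (witness_machine k) x cs" and acc: "fst (last cs) = 2"
    by (auto simp: accepting_path_def witness_machine_simps)
  have ne: "cs \<noteq> []" using path by (simp add: computation_path_def)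
  from computation_path_config_at[OF path] acc obtain w where w: "length w = length x"
    "length cs \<le> Suc (run_time k (length x))"
    "\<And>t. t < length cs - 1 \<Longrightarrow> cs ! t = config_at k x w t"
    and l: "last cs = config_at k x w (length cs - 1)"
    by auto
  have all: "cs ! t = config_at k x w t" if "t < length cs" for t
    using w(3) l that ne by (cases "t = length cs - 1") (auto simp: last_conv_nth)
  have "length cs - 1 \<le> run_time k (length x)" using w(2) by simp
  \<comment> \<open>Among the configurations \<open>config_at\<close>, only the one at time
    \<open>run_time\<close> is in the accepting state.\<close>
  then have len: "length cs = Suc (run_time k (length x))"
  proof (cases rule: time_cases)
    case halt
    then show ?thesis using ne by (cases cs) auto
  qed (use acc l in \<open>auto simp: config_at_simps(1,2) config_at_simps(3,4)[simplified] copy_config_def query_config_def\<close>)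
  have "interleave x w @ replicate j True \<in> A" if j: "j < query_count k (length x)" for j
  proof -
    let ?t = "2 * length x + 1 + 2 * j"
    have "Suc ?t < length cs" using j len by (simp add: run_time_def)
    then have "step A (witness_machine k) (cs ! ?t) (cs ! Suc ?t)"
      using path by (auto simp: computation_path_def successively_conv_nth)
    then have "step A (witness_machine k) (config_at k x w ?t) (config_at k x w (Suc ?t))"
      using all[of ?t] all[of "Suc ?t"] \<open>Suc ?t < length cs\<close> by simp
    then show ?thesis
      using config_at_simps(3)[OF j, of w] config_at_simps(4)[OF j, of w]
      by (auto simp: step_def query_config_def witness_machine_simps tape_word_word_tape split: if_splits)
  qed
  then have "witness k A x w" using w(1) by (auto simp: witness_def block_def)
  moreover have "cs = map (config_at k x w) [0..<Suc (run_time k (length x))]"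
    using all len by (intro nth_equalityI) (auto simp del: upt_Suc)
  ultimately show ?R by blast
next
  assume ?R
  then obtain w where w: "witness k A x w" and cs: "cs = map (config_at k x w) [0..<Suc (run_time k (length x))]"
    by blast
  have "hd cs = initial_config (witness_machine k) x"
    using initial_config_witness_machine[of k x w] by (simp add: cs hd_map del: upt_Suc)
  moreover have "successively (step A (witness_machine k)) cs"
    using config_at_step[OF w] by (auto simp: successively_conv_nth cs simp del: upt_Suc)
  moreover have "fst (last cs) = 2" by (simp add: cs config_at_simps(5) query_config_def)
  ultimately show ?L by (auto simp: accepting_path_def computation_path_def cs witness_machine_simps)
qed

lemma polynomial_time_witness_machine: "polynomial_time A (witness_machine k)"
  unfolding polynomial_time_def
proof (intro exI allI impI)
  fix x cs assume "computation_path A (witness_machine k) x cs"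
  from computation_path_config_at[OF this]
  \<comment> \<open>\<open>Suc (run_time k n)\<close> is exactly 6n + 2k + 6.\<close>
  show "length cs \<le> poly [:2 * k + 6, 6:] (length x)"
    by (auto simp: run_time_def query_count_def)
qed

lemma witness_lang_in_UP:
  assumes "\<And>x w w'. witness k A x w \<Longrightarrow> witness k A x w' \<Longrightarrow> w = w'"
  shows "witness_lang k A \<in> UP A"
  unfolding UP_def
proof (intro CollectI exI conjI ballI allI impI)
  show "polynomial_time A (witness_machine k)" by (rule polynomial_time_witness_machine)
  show "\<exists>!cs. accepting_path A (witness_machine k) x cs" if "x \<in> witness_lang k A" for x
    using that assms unfolding accepting_path_iff witness_lang_def by blast
  show "\<nexists>cs. accepting_path A (witness_machine k) x cs" if "x \<notin> witness_lang k A" for x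
    using that unfolding accepting_path_iff witness_lang_def by blast
qed

section \<open>Uniform families\<close>

instance symbol :: countable by countable_datatype
instance move :: countable by countable_datatype

lemma countable_otm: "countable (UNIV :: otm set)"
proof (rule countableI)
  show "inj_on (\<lambda>M :: otm. to_nat (work_tapes M, start_state M, accept_state M, query_state M, yes_state M,
     no_state M, transitions M)) UNIV"
    by (rule inj_onI) (simp add: otm.equality)
qed

lemma step_deterministic:
  assumes "single_valued (set (transitions M))" "step A M c c'" "step A M c c''"
  shows "c' = c''"
  using assms by (auto simp: step_def split: if_splits dest: single_valuedD)

text \<open>Determinism makes the paths agree as long as both last, and neither is a proper prefix
  of the other because the accepting state is halting.\<close>

lemma accepting_path_unique:
  assumes M: "single_valued (set (transitions M))"
    and cs: "accepting_path A M x cs" and cs': "accepting_path A M x cs'"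
  shows "cs = cs'"
proof -
  have eq: "cs ! t = cs' ! t" if "t < length cs" "t < length cs'"
    "accepting_path A M x cs" "accepting_path A M x cs'" for t cs cs'
    using that(1,2)
  proof (induction t)
    case 0
    then show ?case using that(3,4) by (auto simp: accepting_path_def computation_path_def hd_conv_nth)
  next
    case (Suc t)
    then have "cs ! t = cs' ! t" by simp
    moreover have "step A M (cs ! t) (cs ! Suc t)" "step A M (cs' ! t) (cs' ! Suc t)"
      using Suc.prems that(3,4) by (auto simp: accepting_path_def computation_path_def successively_conv_nth)
    ultimately show ?case using step_deterministic[OF M] by simp
  qed
  have le: "length cs' \<le> length cs" if "accepting_path A M x cs" "accepting_path A M x cs'" for cs cs'
  proof (rule ccontr)
    assume n: "\<not> ?thesis"
    let ?t = "length cs - 1"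
    have ne: "cs \<noteq> []" using that by (auto simp: accepting_path_def computation_path_def)
    have "Suc ?t < length cs'" using n ne by (cases cs) auto
    then have "step A M (cs' ! ?t) (cs' ! Suc ?t)"
      using that unfolding accepting_path_def computation_path_def successively_conv_nth by blast
    moreover have "cs' ! ?t = last cs"
      using eq[of ?t cs cs'] n ne that by (simp add: last_conv_nth)
    ultimately show False using that by (simp add: step_def accepting_path_def)
  qed
  show ?thesis using le[OF cs cs'] le[OF cs' cs] eq[OF _ _ cs cs'] by (intro nth_equalityI) auto
qed

text \<open>A deterministic machine has one accepting path per input, so it determines the function
  it computes; and there are countably many machines.\<close>

lemma countable_polytime_computable: "countable {f. polytime_computable f}"
proof -
  define result where "result M x = tape_word (snd (last (THE cs. accepting_path {} M x cs)) ! 1)" for M x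
  have "{f. polytime_computable f} \<subseteq> result ` UNIV"
  proof
    fix f assume "f \<in> {f. polytime_computable f}"
    then obtain M where M: "single_valued (set (transitions M))"
      "\<And>x. \<exists>cs. accepting_path {} M x cs \<and> tape_word (snd (last cs) ! 1) = f x"
      by (auto simp: polytime_computable_def)
    have "f = result M"
    proof
      fix x
      obtain cs where cs: "accepting_path {} M x cs" "tape_word (snd (last cs) ! 1) = f x" using M(2) by blast
      have "(THE cs. accepting_path {} M x cs) = cs"
        using cs(1) accepting_path_unique[OF M(1)] by (intro the_equality) auto
      then show "f x = result M x" using cs by (simp add: result_def)
    qed
    then show "f \<in> result ` UNIV" by blast
  qed
  then show ?thesis by (rule countable_subset) (intro countable_image countable_otm)
qed

section \<open>Output length of polynomial-time machines\<close>

definition used_cells :: "tape \<Rightarrow> int set" where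
  "used_cells t = {i. fst t i \<noteq> Blank}"

lemma used_cells_act_tape: "used_cells (act_tape a t) \<subseteq> insert (snd t) (used_cells t)"
  by (auto simp: used_cells_def act_tape_def)

lemma length_tape_word_le:
  assumes "finite (used_cells t)"
  shows "length (tape_word t) \<le> card (used_cells t)"
proof -
  let ?P = "\<lambda>i. fst t (int i) \<notin> range Bit"
  let ?L = "LEAST i. ?P i"
  have sub: "int ` {..<?L} \<subseteq> used_cells t"
  proof
    fix p assume "p \<in> int ` {..<?L}"
    then obtain i where i: "p = int i" "i < ?L" by blast
    then have "\<not> ?P i" by (intro not_less_Least)
    then show "p \<in> used_cells t" using i by (auto simp: used_cells_def)
  qed
  have "?L = card (int ` {..<?L})" by (simp add: card_image)
  also have "\<dots> \<le> card (used_cells t)" by (rule card_mono[OF assms sub])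
  finally show ?thesis by (simp add: tape_word_def)
qed

text \<open>One step writes one cell of the output tape, which starts blank, so running time bounds
  output length and hence, through the codes, the number of gates.\<close>

lemma path_used_cells:
  assumes "computation_path A M x cs"
  shows "t < length cs \<Longrightarrow> length (snd (cs ! t)) = Suc (Suc (work_tapes M)) \<and>
    finite (used_cells (snd (cs ! t) ! 1)) \<and> card (used_cells (snd (cs ! t) ! 1)) \<le> t"
proof (induction t)
  case 0
  then have "cs ! 0 = initial_config M x" using assms by (auto simp: computation_path_def hd_conv_nth)
  then show ?case by (simp add: initial_config_def used_cells_def blank_tape_def)
next
  case (Suc t)
  let ?c = "cs ! t" and ?c' = "cs ! Suc t"
  have IH: "length (snd ?c) = Suc (Suc (work_tapes M))" "finite (used_cells (snd ?c ! 1))"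
    "card (used_cells (snd ?c ! 1)) \<le> t" using Suc by auto
  have "step A M ?c ?c'"
    using Suc.prems assms by (auto simp: computation_path_def successively_conv_nth)
  then consider "snd ?c' = snd ?c" | acts where "length acts = length (snd ?c)" "snd ?c' = map2 act_tape acts (snd ?c)"
    by (auto simp: step_def split: if_splits)
  then show ?case
  proof cases
    case 1
    then show ?thesis using IH by simp
  next
    case 2
    then have e: "snd ?c' ! 1 = act_tape (acts ! 1) (snd ?c ! 1)" using IH(1) by simp
    have "card (used_cells (snd ?c' ! 1)) \<le> card (insert (snd (snd ?c ! 1)) (used_cells (snd ?c ! 1)))"
      unfolding e using IH(2) by (intro card_mono used_cells_act_tape) auto
    also have "\<dots> \<le> Suc t" using IH(2,3) card_insert_le_m1[of "Suc t"] by (simp add: card_insert_if)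
    finally have "card (used_cells (snd ?c' ! 1)) \<le> Suc t" .
    moreover have "finite (used_cells (snd ?c' ! 1))"
      unfolding e using IH(2) by (intro finite_subset[OF used_cells_act_tape]) auto
    ultimately show ?thesis using 2 IH(1) by simp
  qed
qed

lemma polytime_computable_length:
  assumes "polytime_computable f"
  shows "\<exists>p :: nat poly. \<forall>x. length (f x) \<le> poly p (length x)"
proof -
  obtain M p where p: "\<And>x cs. computation_path {} M x cs \<Longrightarrow> length cs \<le> poly p (length x)"
    and M: "\<And>x. \<exists>cs. accepting_path {} M x cs \<and> tape_word (snd (last cs) ! 1) = f x"
    using assms unfolding polytime_computable_def polynomial_time_def by metis
  have "length (f x) \<le> poly p (length x)" for x
  proof -
    obtain cs where cs: "accepting_path {} M x cs" "tape_word (snd (last cs) ! 1) = f x" using M by blast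
    then have path: "computation_path {} M x cs" and ne: "cs \<noteq> []"
      by (auto simp: accepting_path_def computation_path_def)
    have "length (f x) \<le> card (used_cells (snd (last cs) ! 1))"
      unfolding cs(2)[symmetric] using path_used_cells[OF path, of "length cs - 1"] ne
      by (intro length_tape_word_le) (simp add: last_conv_nth)
    also have "\<dots> \<le> length cs - 1"
      using path_used_cells[OF path, of "length cs - 1"] ne by (simp add: last_conv_nth)
    finally show ?thesis using p[OF path] by linarith
  qed
  then show ?thesis by blast
qed

section \<open>Injectivity of the codes and circuit sizes\<close>

lemma encode_inject: "encode ns = encode ms \<Longrightarrow> ns = ms"
proof (induction ns arbitrary: ms)
  case Nil
  then show ?case by (cases ms) (auto simp: encode_def)
next
  case (Cons n ns)
  then obtain m ms' where ms: "ms = m # ms'" by (cases ms) (auto simp: encode_def)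
  have cons: "encode (a # as) = replicate a True @ False # encode as" for a as by (simp add: encode_def)
  have tw: "length (takeWhile id (encode (a # as))) = a" for a as unfolding cons by (induction a) auto
  have "n = m" using tw[of n ns] tw[of m ms'] Cons.prems ms by simp
  then show ?case using Cons ms by (simp add: cons)
qed

text \<open>Tags and length fields make the codes self-delimiting; the remainders \<open>r\<close>,
  \<open>r'\<close> carry this through concatenations.\<close>

lemma gate_code_append_inject:
  "gate_code g @ r = gate_code g' @ r' \<Longrightarrow> g = g' \<and> r = r'"
  by (cases g; cases g') auto

lemma gates_code_append_inject:
  assumes "length C = length C'" "concat (map gate_code C) @ r = concat (map gate_code C') @ r'"
  shows "C = C' \<and> r = r'"
  using assms
proof (induction C C' rule: list_induct2)
  case (Cons g C g' C')
  then show ?case using gate_code_append_inject[of g _ g'] by force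
qed simp

lemma circuit_code_append_inject:
  "circuit_code C @ r = circuit_code C' @ r' \<Longrightarrow> C = C' \<and> r = r'"
  using gates_code_append_inject[of C C' r r'] by (simp add: circuit_code_def)

lemma circuits_code_inject:
  assumes "length Cs = length Cs'" "concat (map circuit_code Cs) = concat (map circuit_code Cs')"
  shows "Cs = Cs'"
  using assms
proof (induction Cs Cs' rule: list_induct2)
  case (Cons C Cs C' Cs')
  then show ?case using circuit_code_append_inject[of C _ C'] by force
qed simp

lemma verifier_code_inject: "verifier_code V = verifier_code V' \<Longrightarrow> V = V'"
  using circuits_code_inject[of "circuits V" "circuits V'"]
  by (intro verifier.equality) (auto simp: verifier_code_def)

lemma simulator_code_inject: "simulator_code S = simulator_code S' \<Longrightarrow> S = S'"
proof -
  have "S = S'" if "length S = length S'"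
    "concat (map (\<lambda>(n, C). n # circuit_code C) S) = concat (map (\<lambda>(n, C). n # circuit_code C) S')" for S S'
    using that
  proof (induction S S' rule: list_induct2)
    case (Cons s S s' S')
    then show ?case using circuit_code_append_inject[of "snd s" _ "snd s'"] by (force simp: split_beta prod_eq_iff)
  qed simp
  then show "simulator_code S = simulator_code S' \<Longrightarrow> S = S'" by (simp add: simulator_code_def)
qed

lemma countable_polytime_uniform:
  assumes "\<And>a b. code a = code b \<Longrightarrow> a = b"
  shows "countable {F. polytime_uniform code F}"
proof (rule countable_image_inj_on)
  show "countable ((\<lambda>F x. encode (code (F x))) ` {F. polytime_uniform code F})"
    by (rule countable_subset[OF _ countable_polytime_computable]) (auto simp: polytime_uniform_def)
  show "inj_on (\<lambda>F x. encode (code (F x))) {F. polytime_uniform code F}"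
    by (rule inj_onI) (metis assms encode_inject ext)
qed

lemma length_le_encode: "length ns \<le> length (encode ns)"
  by (induction ns) (auto simp: encode_def)

lemma length_circuit_code: "length C \<le> length (circuit_code C)"
proof -
  have "length C \<le> length (concat (map gate_code C))"
  proof (induction C)
    case (Cons g C)
    then show ?case by (cases g) auto
  qed simp
  then show ?thesis by (simp add: circuit_code_def)
qed

lemma length_verifier_code: "sum_list (map length (circuits V)) \<le> length (encode (verifier_code V))"
proof -
  have "sum_list (map length Cs) \<le> length (concat (map circuit_code Cs))" for Cs
    using length_circuit_code by (induction Cs) (auto intro: add_mono)
  then have "sum_list (map length (circuits V)) \<le> length (verifier_code V)"
    by (simp add: verifier_code_def le_Suc_eq)
  then show ?thesis using length_le_encode order_trans by blast
qed

lemma length_simulator_code: "sum_list (map (length \<circ> snd) S) \<le> length (encode (simulator_code S))"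
proof -
  have "sum_list (map (length \<circ> snd) S) \<le> length (concat (map (\<lambda>(n, C). n # circuit_code C) S))"
  proof (induction S)
    case (Cons s S)
    then show ?case using length_circuit_code[of "snd s"] by (auto simp: split_beta)
  qed simp
  then have "sum_list (map (length \<circ> snd) S) \<le> length (simulator_code S)"
    by (simp add: simulator_code_def)
  then show ?thesis using length_le_encode order_trans by blast
qed

lemma poly_nat_bound:
  fixes p :: "nat poly"
  shows "\<exists>C d. \<forall>n\<ge>1. poly p n \<le> C * n ^ d"
proof (induction p)
  case 0
  then show ?case by (intro exI[of _ 0]) auto
next
  case (pCons a p)
  then obtain C d where Cd: "\<And>n. n \<ge> 1 \<Longrightarrow> poly p n \<le> C * n ^ d" by auto
  have "poly (pCons a p) n \<le> (a + C) * n ^ Suc d" if "n \<ge> 1" for n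
  proof -
    have "a * 1 \<le> a * n ^ Suc d" using that by (intro mult_le_mono) auto
    moreover have "n * poly p n \<le> n * (C * n ^ d)" using Cd[OF that] by (rule mult_le_mono2)
    moreover have "(a + C) * n ^ Suc d = a * n ^ Suc d + n * (C * n ^ d)" by (simp add: algebra_simps)
    moreover have "poly (pCons a p) n = a + n * poly p n" by simp
    ultimately show ?thesis by linarith
  qed
  then show ?case by blast
qed

lemma poly_power_over_exp: "(\<lambda>n. real n ^ d / 2 ^ n) \<longlonglongrightarrow> 0"
proof -
  have "(\<lambda>n. real n powr real d / 2 powr real n) \<longlonglongrightarrow> 0"
    by real_asymp
  moreover have "\<forall>\<^sub>F n in sequentially. real n powr real d / 2 powr real n = real n ^ d / 2 ^ n"
    using eventually_gt_at_top[of 0] by eventually_elim (simp add: powr_realpow)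
  ultimately show ?thesis by (simp add: filterlim_cong)
qed

text \<open>For T = O(n^d) the first term is O(n^(5d) / 2^n), and K = 2d + 1 makes the second
  O(1/n). The exponent depends on the size polynomial alone, so one \<open>K\<close> serves all
  negligible errors.\<close>

lemma eventually_parameters_small:
  fixes p :: "nat poly"
  shows "\<exists>K. \<forall>\<^sub>F n in sequentially. \<forall>T. T \<le> poly p n \<longrightarrow>
    real T ^ 2 * (18 * real T ^ 3 / 2 ^ n + 2 * (1 / real n ^ K)) < 1 / 144"
proof -
  obtain C d where Cd: "\<And>n. n \<ge> 1 \<Longrightarrow> poly p n \<le> C * n ^ d" using poly_nat_bound[of p] by blast
  let ?u = "\<lambda>n. 18 * real C ^ 5 * (real n ^ (5 * d) / 2 ^ n) + 2 * real C ^ 2 * (1 / real n)"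
  have "?u \<longlonglongrightarrow> 18 * real C ^ 5 * 0 + 2 * real C ^ 2 * 0"
    by (intro tendsto_add tendsto_mult_left poly_power_over_exp lim_1_over_n)
  then have "\<forall>\<^sub>F n in sequentially. ?u n < 1 / 144" by (intro order_tendstoD(2)) auto
  then have "\<forall>\<^sub>F n in sequentially. \<forall>T. T \<le> poly p n \<longrightarrow>
    real T ^ 2 * (18 * real T ^ 3 / 2 ^ n + 2 * (1 / real n ^ (2 * d + 1))) < 1 / 144"
    using eventually_ge_at_top[of 1]
  proof eventually_elim
    case (elim n)
    show ?case
    proof (intro allI impI)
      fix T assume "T \<le> poly p n"
      then have "T \<le> C * n ^ d" using Cd[of n] elim by linarith
      then have T: "real T \<le> real C * real n ^ d" by (metis of_nat_le_iff of_nat_mult of_nat_power)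
      have "real T ^ 2 * (18 * real T ^ 3 / 2 ^ n + 2 * (1 / real n ^ (2 * d + 1))) \<le>
        (real C * real n ^ d) ^ 2 * (18 * (real C * real n ^ d) ^ 3 / 2 ^ n + 2 * (1 / real n ^ (2 * d + 1)))"
        using T by (intro mult_mono add_mono divide_right_mono power_mono mult_left_mono) auto
      also have "\<dots> = ?u n"
        using elim by (simp add: field_simps power_mult_distrib power_add power_mult power2_eq_square power3_eq_cube numeral_eq_Suc)
      finally show "real T ^ 2 * (18 * real T ^ 3 / 2 ^ n + 2 * (1 / real n ^ (2 * d + 1))) < 1 / 144"
        using elim by linarith
    qed
  qed
  then show ?thesis by blast
qed

section \<open>Random oracles\<close>

lemma prob_space_random_oracle: "prob_space random_oracle"
  unfolding random_oracle_def by (intro prob_space_PiM) (rule prob_space_measure_pmf)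

interpretation ro: prob_space random_oracle
  by (rule prob_space_random_oracle)

lemma space_random_oracle [simp]: "space random_oracle = UNIV"
  by (simp add: random_oracle_def space_PiM)

lemma oracle_coordinate_sets: "{\<omega>. \<omega> u} \<in> sets random_oracle"
proof -
  have "(\<lambda>\<omega>. \<omega> u) \<in> measurable random_oracle (measure_pmf (bernoulli_pmf (1 / 2)))"
    unfolding random_oracle_def by (intro measurable_component_singleton) simp
  from measurable_sets[OF this, of "{True}"] show ?thesis by (simp add: vimage_def)
qed

lemma oracle_update_measurable: "(\<lambda>\<omega>. (fun_upd \<omega> u True)) \<in> measurable random_oracle random_oracle"
  unfolding random_oracle_def by (rule measurable_fun_upd[where J = UNIV]) auto

lemma oracle_update_sets:
  "X \<in> sets random_oracle \<Longrightarrow> {\<omega>. (fun_upd \<omega> u True) \<in> X} \<in> sets random_oracle"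
  using measurable_sets[OF oracle_update_measurable, of X u] by (simp add: vimage_def)

text \<open>Overwriting coordinate \<open>u\<close> by an independent fair bit preserves the product
  measure; the event then asks this bit to be \<open>True\<close> and the overwritten oracle to lie
  in \<open>X\<close>.\<close>

lemma prob_force_one:
  assumes X: "X \<in> sets random_oracle"
  shows "ro.prob ({\<omega>. \<omega> u} \<inter> X) = ro.prob {\<omega>. (fun_upd \<omega> u True) \<in> X} / 2"
proof -
  let ?B = "measure_pmf (bernoulli_pmf (1 / 2))"
  let ?Y = "{\<omega>. \<omega> u} \<inter> X"
  have Y: "?Y \<in> sets random_oracle" using X oracle_coordinate_sets by auto
  have eq: "distr (?B \<Otimes>\<^sub>M random_oracle) random_oracle (\<lambda>(b, \<omega>). fun_upd \<omega> u b) = random_oracle"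
    using distr_pair_PiM_eq_PiM[of UNIV "\<lambda>_. ?B" u, OF prob_space_measure_pmf prob_space_measure_pmf]
    by (simp add: random_oracle_def)
  have m: "(\<lambda>(b, \<omega>). fun_upd \<omega> u b) \<in> measurable (?B \<Otimes>\<^sub>M random_oracle) random_oracle"
  proof -
    have "(\<lambda>p. fun_upd (snd p) u (fst p)) \<in> measurable (?B \<Otimes>\<^sub>M random_oracle) random_oracle"
      unfolding random_oracle_def
      by (rule measurable_fun_upd[where J = UNIV]) auto
    then show ?thesis by (simp add: case_prod_beta')
  qed
  have "emeasure random_oracle ?Y = emeasure (distr (?B \<Otimes>\<^sub>M random_oracle) random_oracle (\<lambda>(b, \<omega>). fun_upd \<omega> u b)) ?Y"
    by (simp add: eq)
  also have "\<dots> = emeasure (?B \<Otimes>\<^sub>M random_oracle) ((\<lambda>(b, \<omega>). fun_upd \<omega> u b) -` ?Y \<inter> space (?B \<Otimes>\<^sub>M random_oracle))"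
    by (rule emeasure_distr[OF m Y])
  also have "(\<lambda>(b, \<omega>). fun_upd \<omega> u b) -` ?Y \<inter> space (?B \<Otimes>\<^sub>M random_oracle) = {True} \<times> {\<omega>. (fun_upd \<omega> u True) \<in> X}"
    by (auto simp: space_pair_measure)
  also have "emeasure (?B \<Otimes>\<^sub>M random_oracle) \<dots> = emeasure ?B {True} * emeasure random_oracle {\<omega>. (fun_upd \<omega> u True) \<in> X}"
    by (rule ro.emeasure_pair_measure_Times) (auto intro: oracle_update_sets[OF X])
  also have "emeasure ?B {True} = ennreal (1 / 2)" by (simp add: emeasure_pmf_single)
  finally have "ennreal (ro.prob ?Y) = ennreal (1 / 2 * ro.prob {\<omega>. (fun_upd \<omega> u True) \<in> X})"
    by (simp only: ro.emeasure_eq_measure ennreal_mult''[symmetric] measure_nonneg)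
  then show ?thesis by simp
qed

lemma oracle_all_sets: "finite F \<Longrightarrow> {\<omega>. \<forall>u\<in>F. \<omega> u} \<in> sets random_oracle"
proof (induction F rule: finite_induct)
  case (insert u F)
  have "{\<omega>. \<forall>v\<in>insert u F. \<omega> v} = {\<omega>. \<omega> u} \<inter> {\<omega>. \<forall>v\<in>F. \<omega> v}" by auto
  then show ?case using insert.IH oracle_coordinate_sets by auto
qed (use sets.top[of random_oracle] in simp)

lemma oracle_force_sets:
  assumes "finite F" "X \<in> sets random_oracle"
  shows "{\<omega>. (\<lambda>u. u \<in> F \<or> \<omega> u) \<in> X} \<in> sets random_oracle"
  using assms
proof (induction F arbitrary: X rule: finite_induct)
  case (insert u F)
  have "{\<omega>. (\<lambda>v. v \<in> insert u F \<or> \<omega> v) \<in> X} = {\<omega>. (\<lambda>v. v \<in> F \<or> \<omega> v) \<in> {\<omega>. (fun_upd \<omega> u True) \<in> X}}"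
    by (intro Collect_cong) (simp, intro arg_cong[where f = "\<lambda>h. h \<in> X"], auto)
  then show ?case using insert.IH[OF oracle_update_sets[OF insert.prems]] by (simp only:)
qed simp

text \<open>Conditioned on containing \<open>F\<close>, the oracle is distributed like a random
  oracle with \<open>F\<close> planted. This is what turns errors under planted oracles into errors
  under the random oracle.\<close>

lemma prob_force:
  assumes "finite F" "X \<in> sets random_oracle"
  shows "ro.prob ({\<omega>. \<forall>u\<in>F. \<omega> u} \<inter> X) =
    (1 / 2) ^ card F * ro.prob {\<omega>. (\<lambda>u. u \<in> F \<or> \<omega> u) \<in> X}"
  using assms
proof (induction F arbitrary: X rule: finite_induct)
  case (insert u F)
  let ?X = "{\<omega>. \<forall>v\<in>F. \<omega> v} \<inter> X"
  have X: "?X \<in> sets random_oracle" using oracle_all_sets[OF insert.hyps(1)] insert.prems by auto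
  have "ro.prob ({\<omega>. \<forall>v\<in>insert u F. \<omega> v} \<inter> X) = ro.prob ({\<omega>. \<omega> u} \<inter> ?X)"
    by (rule arg_cong[where f = ro.prob]) auto
  also have "\<dots> = ro.prob {\<omega>. (fun_upd \<omega> u True) \<in> ?X} / 2" by (rule prob_force_one[OF X])
  also have "{\<omega>. (fun_upd \<omega> u True) \<in> ?X} = {\<omega>. \<forall>v\<in>F. \<omega> v} \<inter> {\<omega>. (fun_upd \<omega> u True) \<in> X}"
    using insert.hyps(2) by auto
  also have "ro.prob \<dots> = (1 / 2) ^ card F * ro.prob {\<omega>. (\<lambda>v. v \<in> F \<or> \<omega> v) \<in> {\<omega>. (fun_upd \<omega> u True) \<in> X}}"
    by (rule insert.IH[OF oracle_update_sets[OF insert.prems]])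
  also have "{\<omega>. (\<lambda>v. v \<in> F \<or> \<omega> v) \<in> {\<omega>. (fun_upd \<omega> u True) \<in> X}} = {\<omega>. (\<lambda>v. v \<in> insert u F \<or> \<omega> v) \<in> X}"
    by (intro Collect_cong) (simp, intro arg_cong[where f = "\<lambda>h. h \<in> X"], auto)
  finally show ?case using insert.hyps by simp
next
  case empty
  have "{\<omega>. \<forall>u\<in>{}. \<omega> u} \<inter> X = X" by auto
  then show ?case by simp
qed

lemma prob_all:
  assumes "finite F"
  shows "ro.prob {\<omega>. \<forall>u\<in>F. \<omega> u} = (1 / 2) ^ card F"
  using prob_force[OF assms, of UNIV] sets.top[of random_oracle] ro.prob_space by simp

text \<open>Stands in for the sigma-algebra generated by the coordinates in \<open>E\<close>. It is
  checked pointwise, even for events that quantify over all provers, and for finite \<open>E\<close>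
  it yields measurability.\<close>

definition depends_on :: "bool list set \<Rightarrow> (bool list \<Rightarrow> bool) set \<Rightarrow> bool" where
  "depends_on E X \<longleftrightarrow> (\<forall>\<omega> \<omega>'. (\<forall>u\<in>E. \<omega> u = \<omega>' u) \<longrightarrow> (\<omega> \<in> X \<longleftrightarrow> \<omega>' \<in> X))"

lemma depends_onD:
  "depends_on E X \<Longrightarrow> (\<And>u. u \<in> E \<Longrightarrow> \<omega> u = \<omega>' u) \<Longrightarrow> \<omega> \<in> X \<Longrightarrow> \<omega>' \<in> X"
  unfolding depends_on_def by metis

lemma depends_on_mono: "depends_on E X \<Longrightarrow> E \<subseteq> E' \<Longrightarrow> depends_on E' X"
  unfolding depends_on_def by blast

lemma depends_on_Int: "depends_on E X \<Longrightarrow> depends_on E Y \<Longrightarrow> depends_on E (X \<inter> Y)"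
  unfolding depends_on_def by blast

text \<open>A finite union of cylinders, one for each possible intersection \<open>G\<close> of the
  oracle with \<open>E\<close>.\<close>

lemma depends_on_sets:
  assumes E: "finite E" and X: "depends_on E X"
  shows "X \<in> sets random_oracle"
proof -
  let ?C = "\<lambda>G. {\<omega>. \<forall>u\<in>G. \<omega> u} - (\<Union>u\<in>E - G. {\<omega>. \<omega> u})"
  have "X = (\<Union>G\<in>{G \<in> Pow E. (\<lambda>u. u \<in> G) \<in> X}. ?C G)"
  proof (intro equalityI subsetI)
    fix \<omega> assume \<omega>: "\<omega> \<in> X"
    let ?G = "{u \<in> E. \<omega> u}"
    have "(\<lambda>u. u \<in> ?G) \<in> X" by (rule depends_onD[OF X _ \<omega>]) simp
    moreover have "\<omega> \<in> ?C ?G" by auto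
    ultimately show "\<omega> \<in> (\<Union>G\<in>{G \<in> Pow E. (\<lambda>u. u \<in> G) \<in> X}. ?C G)" by (intro UN_I[of ?G]) auto
  next
    fix \<omega> assume "\<omega> \<in> (\<Union>G\<in>{G \<in> Pow E. (\<lambda>u. u \<in> G) \<in> X}. ?C G)"
    then obtain G where G: "G \<subseteq> E" "(\<lambda>u. u \<in> G) \<in> X" "\<omega> \<in> ?C G" by blast
    show "\<omega> \<in> X" by (rule depends_onD[OF X _ G(2)]) (use G in auto)
  qed
  moreover have "?C G \<in> sets random_oracle" if "G \<subseteq> E" for G
    using that E oracle_all_sets[OF finite_subset[OF that E]] oracle_coordinate_sets
    by (intro sets.Diff sets.finite_UN) auto
  then have "(\<Union>G\<in>{G \<in> Pow E. (\<lambda>u. u \<in> G) \<in> X}. ?C G) \<in> sets random_oracle"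
    using E by (intro sets.finite_UN) auto
  ultimately show ?thesis by simp
qed

definition words :: "nat \<Rightarrow> bool list set" where
  "words n = {x. length x = n}"

lemma finite_words [simp]: "finite (words n)" and card_words: "card (words n) = 2 ^ n"
  using finite_lists_length_eq[of "UNIV :: bool set" n] card_lists_length_eq[of "UNIV :: bool set" n]
  by (simp_all add: words_def)

lemma finite_short_words [simp]: "finite {u :: bool list. length u < N}"
proof -
  have "{u :: bool list. length u < N} = (\<Union>n<N. words n)" by (auto simp: words_def)
  then show ?thesis by simp
qed

lemma finite_block [simp]: "finite (block k x w)"
  by (simp add: block_def)

lemma card_block: "card (block k x w) = query_count k (length x)"
  unfolding block_def by (subst card_image) (auto intro!: inj_onI dest: arg_cong[where f = length])

lemma block_length:
  assumes "length x = n" "length w = n" "u \<in> block k x w"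
  shows "2 * n \<le> length u" "length u < 2 * n + query_count k n"
  using assms by (auto simp: block_def length_interleave)

text \<open>Both prefixes have length 2n, so a common string would force equal prefixes, which
  determine the pair.\<close>

lemma block_disjoint:
  assumes "length x = n" "length w = n" "length x' = n" "length w' = n" "(x, w) \<noteq> (x', w')"
  shows "block k x w \<inter> block k x' w' = {}"
proof (rule ccontr)
  assume "block k x w \<inter> block k x' w' \<noteq> {}"
  then obtain j j' where e: "interleave x w @ replicate j True = interleave x' w' @ replicate j' True"
    by (auto simp: block_def)
  have "length (interleave x w) = length (interleave x' w')" using assms by (simp add: length_interleave)
  with e have "interleave x w = interleave x' w'" by simp
  with interleave_inject[of x w x' w'] assms show False by auto
qed

section \<open>Almost sure uniqueness of witnesses\<close>

definition ambiguous :: "nat \<Rightarrow> nat \<Rightarrow> (bool list \<Rightarrow> bool) set" where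
  "ambiguous k n = (\<Union>(x, w, w')\<in>{(x, w, w'). length x = n \<and> length w = n \<and> length w' = n \<and> w \<noteq> w'}.
     {\<omega>. \<forall>u\<in>block k x w \<union> block k x w'. \<omega> u})"

lemma prob_ambiguous:
  "ambiguous k n \<in> sets random_oracle" "ro.prob (ambiguous k n) \<le> (1 / 4) ^ k * (1 / 2) ^ n"
proof -
  let ?D = "{(x :: bool list, w :: bool list, w' :: bool list). length x = n \<and> length w = n \<and> length w' = n \<and> w \<noteq> w'}"
  let ?E = "\<lambda>(x, w, w'). {\<omega>. \<forall>u\<in>block k x w \<union> block k x w'. \<omega> u}"
  have sub: "?D \<subseteq> words n \<times> words n \<times> words n" by (auto simp: words_def)
  have fin: "finite ?D" by (rule finite_subset[OF sub]) simp
  have sets: "?E d \<in> sets random_oracle" for d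
    by (cases d) (simp only: prod.case, intro oracle_all_sets, simp)
  show "ambiguous k n \<in> sets random_oracle"
    unfolding ambiguous_def using fin sets by (intro sets.finite_UN) auto
  have one: "ro.prob (?E d) = (1 / 2) ^ (2 * query_count k n)" if "d \<in> ?D" for d
  proof -
    obtain x w w' where d: "d = (x, w, w')" "length x = n" "length w = n" "length w' = n" "w \<noteq> w'"
      using \<open>d \<in> ?D\<close> by auto
    have "card (block k x w \<union> block k x w') = 2 * query_count k n"
      using d block_disjoint[of x n w x w' k] by (subst card_Un_disjoint) (auto simp: card_block)
    then show ?thesis unfolding d(1) prod.case by (subst prob_all) auto
  qed
  have "ro.prob (ambiguous k n) \<le> (\<Sum>d\<in>?D. ro.prob (?E d))"
    unfolding ambiguous_def using fin sets by (intro ro.finite_measure_subadditive_finite) auto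
  also have "\<dots> = real (card ?D) * (1 / 2) ^ (2 * query_count k n)"
    using one by simp
  also have "card ?D \<le> card (words n \<times> words n \<times> words n)" using sub by (intro card_mono) auto
  also have "card (words n \<times> words n \<times> words n) = 2 ^ n * (2 ^ n * 2 ^ n)"
    by (simp add: card_cartesian_product card_words)
  finally have "ro.prob (ambiguous k n) \<le> real (2 ^ n * (2 ^ n * 2 ^ n)) * (1 / 2) ^ (2 * query_count k n)"
    by (simp add: mult_right_mono)
  \<comment> \<open>2^(3n) triples against 2^(-4n - 2k - 4).\<close>
  also have "\<dots> = (1 / 4) ^ k * (1 / 2) ^ n * (1 / 16)"
    by (simp add: query_count_def power_add power_mult_distrib power_mult power_divide)
       (simp add: field_simps flip: power_mult_distrib power_mult power_add)
  also have "\<dots> \<le> (1 / 4) ^ k * (1 / 2) ^ n" by simp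
  finally show "ro.prob (ambiguous k n) \<le> (1 / 4) ^ k * (1 / 2) ^ n" .
qed

text \<open>Parameter \<open>k\<close> fails with probability at most 2 / 4^k, so all
  \<open>k\<close> fail together with probability 0. The good \<open>k\<close> varies with the
  oracle.\<close>

lemma AE_unambiguous:
  "AE \<omega> in random_oracle. \<exists>k. witness_lang k {u. \<omega> u} \<in> UP {u. \<omega> u}"
proof -
  let ?N = "\<Inter>k. \<Union>n. ambiguous k n"
  have Us: "(\<Union>n. ambiguous k n) \<in> sets random_oracle" for k using prob_ambiguous(1) by auto
  have Ns: "?N \<in> sets random_oracle" using Us by auto
  have le: "ro.prob (\<Union>n. ambiguous k n) \<le> 2 * (1 / 4) ^ k" for k
  proof -
    have geo: "summable (\<lambda>n. (1 / 4) ^ k * (1 / 2 :: real) ^ n)" by (intro summable_mult summable_geometric) simp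
    have sm: "summable (\<lambda>n. ro.prob (ambiguous k n))"
      using prob_ambiguous(2) by (intro summable_comparison_test'[OF geo]) auto
    have "ro.prob (\<Union>n. ambiguous k n) \<le> (\<Sum>n. ro.prob (ambiguous k n))"
      using prob_ambiguous(1) sm by (intro ro.finite_measure_subadditive_countably) auto
    also have "\<dots> \<le> (\<Sum>n. (1 / 4) ^ k * (1 / 2) ^ n)"
      using prob_ambiguous(2) by (intro suminf_le sm geo)
    also have "\<dots> = 2 * (1 / 4) ^ k" by (subst suminf_mult) (auto simp: suminf_geometric summable_geometric)
    finally show ?thesis .
  qed
  have bound: "ro.prob ?N \<le> 2 * (1 / 4) ^ k" for k
    using le[of k] ro.finite_measure_mono[of ?N "\<Union>n. ambiguous k n"] Us by fastforce
  have "(\<lambda>k. 2 * (1 / 4 :: real) ^ k) \<longlonglongrightarrow> 2 * 0"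
    by (intro tendsto_mult_left LIMSEQ_realpow_zero) auto
  then have "ro.prob ?N \<le> 2 * 0" by (rule LIMSEQ_le_const) (use bound in blast)
  then have null: "?N \<in> null_sets random_oracle"
    using Ns by (intro null_setsI) (simp_all add: ro.emeasure_eq_measure measure_le_0_iff)
  have "witness_lang k {u. \<omega> u} \<in> UP {u. \<omega> u}" if "\<omega> \<notin> (\<Union>n. ambiguous k n)" for k \<omega>
  proof (rule witness_lang_in_UP, rule ccontr)
    fix x w w' assume "witness k {u. \<omega> u} x w" "witness k {u. \<omega> u} x w'" "w \<noteq> w'"
    then have "\<omega> \<in> ambiguous k (length x)"
      unfolding ambiguous_def by (intro UN_I[of "(x, w, w')"]) (auto simp: witness_def)
    then show False using that by blast
  qed
  then show ?thesis by (intro AE_I'[OF null]) blast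
qed

section \<open>Errors of a fixed proof system\<close>

lemma gate_mat_cong:
  assumes "\<And>u. length u < N \<Longrightarrow> u \<in> A \<longleftrightarrow> u \<in> B" "length (gate_qubits g) < N"
  shows "gate_mat A n g = gate_mat B n g"
proof (cases g)
  case (Query qs t)
  have "map (bit c) qs \<in> A \<longleftrightarrow> map (bit c) qs \<in> B" for c :: nat
    using assms by (simp add: Query)
  then show ?thesis by (simp add: gate_mat_def Query)
qed (simp_all add: gate_mat_def)

lemma circuit_mat_cong:
  assumes "\<And>u. length u < N \<Longrightarrow> u \<in> A \<longleftrightarrow> u \<in> B" "\<forall>g\<in>set C. length (gate_qubits g) < N"
  shows "circuit_mat A n C = circuit_mat B n C"
proof -
  have "gate_mat A n g = gate_mat B n g" if "g \<in> set C" for g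
    by (rule gate_mat_cong[where N = N]) (use assms that in auto)
  then show ?thesis unfolding circuit_mat_def by (intro List.fold_cong refl) simp
qed

text \<open>\<open>gate_qubits\<close> includes the target, so its length exceeds that of any string
  the gate queries.\<close>

definition queries_below :: "nat \<Rightarrow> verifier \<Rightarrow> simulator \<Rightarrow> bool" where
  "queries_below N V S \<longleftrightarrow>
     (\<forall>C\<in>set (circuits V) \<union> snd ` set S. \<forall>g\<in>set C. length (gate_qubits g) < N)"

lemma queries_below_exists: "\<exists>N. queries_below N V S"
proof -
  let ?G = "\<Union>C\<in>set (circuits V) \<union> snd ` set S. set C"
  have "finite ((\<lambda>g. length (gate_qubits g)) ` ?G)" by auto
  then obtain N where "\<forall>m\<in>(\<lambda>g. length (gate_qubits g)) ` ?G. m < N"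
    using finite_nat_set_iff_bounded by blast
  then show ?thesis unfolding queries_below_def by blast
qed

lemma queries_below_mono: "queries_below N V S \<Longrightarrow> N \<le> N' \<Longrightarrow> queries_below N' V S"
  unfolding queries_below_def by (meson order_less_le_trans)

definition sound_at :: "language \<Rightarrow> verifier \<Rightarrow> bool" where
  "sound_at A V \<longleftrightarrow> (\<forall>P. valid_prover V P \<longrightarrow> accept_prob A V P \<le> 1 / 3)"

text \<open>Completeness is included: one and the same prover must convince the verifier and have
  views close to the simulated ones.\<close>

definition zk_at :: "language \<Rightarrow> verifier \<Rightarrow> simulator \<Rightarrow> real \<Rightarrow> bool" where
  "zk_at A V S \<epsilon> \<longleftrightarrow> (\<exists>P. valid_prover V P \<and> accept_prob A V P \<ge> 2 / 3 \<and>
     (\<forall>j\<le>2 * rounds V. trace_distance (simulated_view A V S j) (view A V P j) \<le> \<epsilon>))"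

text \<open>Validity of a prover does not mention the oracle, so both sides quantify over the same
  provers, and the finitely many gates query only strings shorter than \<open>N\<close>.\<close>

lemma proof_system_cong:
  assumes AB: "\<And>u. length u < N \<Longrightarrow> u \<in> A \<longleftrightarrow> u \<in> B" and N: "queries_below N V S"
    and V: "valid_verifier V" and S: "valid_simulator V S"
  shows "sound_at A V \<longleftrightarrow> sound_at B V" "zk_at A V S \<epsilon> \<longleftrightarrow> zk_at B V S \<epsilon>"
proof -
  have len: "length (circuits V) = Suc (rounds V)"
    using V by (cases "circuits V") (auto simp: valid_verifier_def rounds_def)
  have C: "circuit_mat A n (circuits V ! i) = circuit_mat B n (circuits V ! i)" if "i \<le> rounds V" for n i
    using N len that by (intro circuit_mat_cong[OF AB]) (auto simp: queries_below_def)
  have J: "j \<le> 2 * rounds V + 1 \<Longrightarrow> joint_state A V P j = joint_state B V P j" for P j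
    by (induction j) (auto simp: C)
  have acc: "accept_prob A V P = accept_prob B V P" for P
    unfolding accept_prob_def by (simp only: J order_refl)
  have view: "j \<le> 2 * rounds V \<Longrightarrow> view A V P j = view B V P j" for P j
    unfolding view_def by (simp add: J)
  have sim: "simulated_view A V S j = simulated_view B V S j" if "j \<le> 2 * rounds V" for j
  proof -
    have "S ! j \<in> set S" using S that by (intro nth_mem) (simp add: valid_simulator_def)
    then have "circuit_mat A n (snd (S ! j)) = circuit_mat B n (snd (S ! j))" for n
      using N by (intro circuit_mat_cong[OF AB]) (auto simp: queries_below_def)
    then show ?thesis by (simp add: simulated_view_def split_beta)
  qed
  show "sound_at A V \<longleftrightarrow> sound_at B V" by (simp add: sound_at_def acc)
  show "zk_at A V S \<epsilon> \<longleftrightarrow> zk_at B V S \<epsilon>" by (simp add: zk_at_def acc view sim cong: conj_cong)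
qed

text \<open>The demands of \<open>QSZK\<close> at a single length, with a number in place of the
  negligible function, so that the event is determined by finitely many strings.\<close>

definition correct_at ::
  "nat \<Rightarrow> (bool list \<Rightarrow> verifier) \<Rightarrow> (bool list \<Rightarrow> simulator) \<Rightarrow> real \<Rightarrow> nat \<Rightarrow> (bool list \<Rightarrow> bool) set" where
  "correct_at k V S \<epsilon> n = {\<omega>. \<forall>x\<in>words n.
     (if x \<in> witness_lang k {u. \<omega> u} then zk_at {u. \<omega> u} (V x) (S x) \<epsilon> else sound_at {u. \<omega> u} (V x))}"

lemma correct_at_depends_on:
  assumes valid: "\<And>x. valid_verifier (V x)" "\<And>x. valid_simulator (V x) (S x)"
  shows "\<exists>N. depends_on {u. length u < N} (correct_at k V S \<epsilon> n)"
proof -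
  have "\<forall>x. \<exists>N. queries_below N (V x) (S x)" using queries_below_exists by blast
  then obtain f where f: "\<And>x. queries_below (f x) (V x) (S x)" by metis
  define N where "N = Max (insert (2 * n + query_count k n) (f ` words n))"
  have N: "2 * n + query_count k n \<le> N" "\<And>x. x \<in> words n \<Longrightarrow> queries_below N (V x) (S x)"
    using queries_below_mono[OF f] by (auto simp: N_def)
  have "\<omega> \<in> correct_at k V S \<epsilon> n \<longleftrightarrow> \<omega>' \<in> correct_at k V S \<epsilon> n"
    if agree: "\<forall>u\<in>{u. length u < N}. \<omega> u = \<omega>' u" for \<omega> \<omega>'
  proof -
    have AB: "\<And>u. length u < N \<Longrightarrow> u \<in> {u. \<omega> u} \<longleftrightarrow> u \<in> {u. \<omega>' u}" using agree by auto
    have "witness k {u. \<omega> u} x w \<longleftrightarrow> witness k {u. \<omega>' u} x w" if x: "x \<in> words n" for x w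
    proof (cases "length w = n")
      case True
      have "\<omega> u = \<omega>' u" if "u \<in> block k x w" for u
        using block_length(2)[of x n w u k] that x True N(1) agree by (auto simp: words_def)
      then show ?thesis by (auto simp: witness_def)
    qed (use x in \<open>simp add: witness_def words_def\<close>)
    then have "x \<in> witness_lang k {u. \<omega> u} \<longleftrightarrow> x \<in> witness_lang k {u. \<omega>' u}" if "x \<in> words n" for x
      using that unfolding witness_lang_def mem_Collect_eq by blast
    moreover have "sound_at {u. \<omega> u} (V x) \<longleftrightarrow> sound_at {u. \<omega>' u} (V x)"
      "zk_at {u. \<omega> u} (V x) (S x) \<epsilon> \<longleftrightarrow> zk_at {u. \<omega>' u} (V x) (S x) \<epsilon>" if "x \<in> words n" for x
      using proof_system_cong[OF AB N(2)[OF that] valid] by auto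
    ultimately show ?thesis by (simp add: correct_at_def)
  qed
  then show ?thesis unfolding depends_on_def by blast
qed

text \<open>Planting \<open>w\<close> puts \<open>x\<close> into the language, so correctness would
  demand \<open>zk_at\<close> under the planted oracle; \<open>few_good_witnesses\<close> grants
  this to at most half of the \<open>w\<close>.\<close>

lemma many_incorrect_witnesses:
  assumes valid: "\<And>x. valid_verifier (V x)" "\<And>x. valid_simulator (V x) (S x)"
    and T: "\<And>x. x \<in> words n \<Longrightarrow> circuit_size (V x) (S x) \<le> T x" "\<And>x. 0 < T x"
    and \<epsilon>: "0 \<le> \<epsilon>"
    and small: "\<And>x. x \<in> words n \<Longrightarrow> real (T x) ^ 2 * (18 * real (T x) ^ 3 / 2 ^ n + 2 * \<epsilon>) < 1 / 144"
    and x: "x \<in> words n" and \<omega>: "\<omega> \<in> correct_at k V S \<epsilon> n" "x \<notin> witness_lang k {u. \<omega> u}"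
  shows "2 ^ n \<le> 2 * card {w \<in> words n. (\<lambda>u. u \<in> block k x w \<or> \<omega> u) \<notin> correct_at k V S \<epsilon> n}"
    (is "_ \<le> 2 * card ?B")
proof -
  let ?A = "{u. \<omega> u}"
  let ?G = "{w \<in> words n. zk_at (?A \<union> block k x w) (V x) (S x) \<epsilon>}"
  have sound: "\<And>P. valid_prover (V x) P \<Longrightarrow> accept_prob ?A (V x) P \<le> 1 / 3"
    using \<omega> x by (auto simp: correct_at_def sound_at_def)
  have disj: "disjoint_family_on (block k x) (words n)"
    using block_disjoint[of x n _ x _ k] x by (auto simp: disjoint_family_on_def words_def)
  have "2 * card ?G \<le> card (words n)"
    unfolding zk_at_def
    by (rule few_good_witnesses[OF valid finite_words disj T(1)[OF x] T(2) \<epsilon> _ sound])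
       (use small[OF x] in \<open>simp_all add: card_words\<close>)
  moreover have "words n - ?G \<subseteq> ?B"
  proof
    fix w assume w: "w \<in> words n - ?G"
    have e: "{u. u \<in> block k x w \<or> \<omega> u} = ?A \<union> block k x w" by auto
    have "x \<in> witness_lang k (?A \<union> block k x w)"
      using w x by (auto simp: witness_lang_def witness_def words_def)
    then show "w \<in> ?B" using w x by (auto simp: correct_at_def e)
  qed
  then have "card (words n - ?G) \<le> card ?B" by (intro card_mono) auto
  moreover have "card (words n - ?G) = card (words n) - card ?G" by (intro card_Diff_subset) auto
  moreover have "card ?G \<le> card (words n)" by (intro card_mono) auto
  ultimately show ?thesis by (simp add: card_words)
qed

text \<open>\<open>D\<close> is the history up to length 2n. At least 3/4 of it has no witness at
  length n. From each correct oracle there, half of the 2^(2n) plantings produce an error, and each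
  planting carries the factor 2^-q = 2^-(2n+k+2): errors have at least 2^-(k+3) times the mass of
  these oracles.\<close>

lemma prob_correct_decay:
  assumes valid: "\<And>x. valid_verifier (V x)" "\<And>x. valid_simulator (V x) (S x)"
    and T: "\<And>x. x \<in> words n \<Longrightarrow> circuit_size (V x) (S x) \<le> T x" "\<And>x. 0 < T x"
    and \<epsilon>: "0 \<le> \<epsilon>"
    and small: "\<And>x. x \<in> words n \<Longrightarrow> real (T x) ^ 2 * (18 * real (T x) ^ 3 / 2 ^ n + 2 * \<epsilon>) < 1 / 144"
    and D: "depends_on {u. length u < 2 * n} D"
  shows "ro.prob (D \<inter> correct_at k V S \<epsilon> n) \<le> (1 - (1 / 2) ^ (k + 5)) * ro.prob D"
proof -
  let ?C = "correct_at k V S \<epsilon> n" and ?q = "query_count k n"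
  let ?XW = "words n \<times> words n"
  let ?b = "\<lambda>p. block k (fst p) (snd p)"
  let ?U = "\<lambda>p. {\<omega>. \<forall>u\<in>?b p. \<omega> u}"
  let ?\<phi> = "\<lambda>p \<omega> u. u \<in> ?b p \<or> \<omega> u"
  let ?Z = "UNIV - (\<Union>p\<in>?XW. ?U p)"
  have D_sets: "D \<in> sets random_oracle" using depends_on_sets[OF _ D] by simp
  have C_sets: "?C \<in> sets random_oracle"
    using correct_at_depends_on[of V S, OF valid] depends_on_sets[OF finite_short_words] by blast
  have U_sets: "?U p \<in> sets random_oracle" for p by (intro oracle_all_sets) simp
  have fin: "finite ?XW" by simp
  have Z_sets: "?Z \<in> sets random_oracle"
    using sets.compl_sets[OF sets.finite_UN[OF fin U_sets]] by simp
  have card_b: "card (?b p) = ?q" if "p \<in> ?XW" for p using that by (auto simp: card_block words_def)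
  have cardXW: "card ?XW = 2 ^ n * 2 ^ n" by (simp add: card_cartesian_product card_words)
  have "(1 / 2 :: real) ^ (2 * n) = 1 / (2 ^ n * 2 ^ n)"
    by (simp add: power_mult power_divide power2_eq_square flip: power_mult_distrib)
  then have pow: "(1 / 2 :: real) ^ ?q = (1 / 2) ^ (k + 2) / (2 ^ n * 2 ^ n)"
    by (simp add: query_count_def power_add)
  \<comment> \<open>Planted strings have length at least 2n, so the history is unaffected.\<close>
  have \<phi>D: "?\<phi> p \<omega> \<in> D \<longleftrightarrow> \<omega> \<in> D" if "p \<in> ?XW" for p \<omega>
  proof -
    have "?\<phi> p \<omega> u = \<omega> u" if "length u < 2 * n" for u
      using block_length(1)[of "fst p" n "snd p" u k] that \<open>p \<in> ?XW\<close> by (auto simp: words_def)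
    then show ?thesis using D unfolding depends_on_def by (metis (mono_tags, lifting) mem_Collect_eq)
  qed
  \<comment> \<open>Errors in which no pair other than \<open>p\<close> is a witness. Together with
    \<open>?U p\<close> these events are disjoint for different \<open>p\<close>, so no error is
    counted twice.\<close>
  let ?Y = "\<lambda>p. (D - ?C) - (\<Union>p'\<in>?XW - {p}. ?U p')"
  have Y_sets: "?Y p \<in> sets random_oracle" for p
    using D_sets C_sets U_sets fin by (intro sets.Diff sets.finite_UN) auto
  have force: "ro.prob (?U p \<inter> X) = (1 / 2) ^ ?q * ro.prob {\<omega>. ?\<phi> p \<omega> \<in> X}"
    if "p \<in> ?XW" "X \<in> sets random_oracle" for p X
    using prob_force[OF _ that(2), of "?b p"] card_b[OF that(1)] by simp

  have "(\<Sum>p\<in>?XW. ro.prob (?U p \<inter> ?Y p)) = ro.prob (\<Union>p\<in>?XW. ?U p \<inter> ?Y p)"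
  proof (rule ro.finite_measure_finite_Union[symmetric])
    show "disjoint_family_on (\<lambda>p. ?U p \<inter> ?Y p) ?XW" by (auto simp: disjoint_family_on_def)
  qed (use U_sets Y_sets fin in auto)
  also have "\<dots> \<le> ro.prob (D - ?C)"
    using D_sets C_sets by (intro ro.finite_measure_mono) auto
  finally have err: "(\<Sum>p\<in>?XW. ro.prob (?U p \<inter> ?Y p)) \<le> ro.prob (D - ?C)" .

  let ?G = "D \<inter> ?Z \<inter> ?C"
  have G_sets: "?G \<in> sets random_oracle" using D_sets Z_sets C_sets by auto
  let ?H = "\<lambda>p. ?G \<inter> {\<omega>. ?\<phi> p \<omega> \<notin> ?C}"
  have H_sets: "?H p \<in> sets random_oracle" for p
  proof -
    have "{\<omega>. ?\<phi> p \<omega> \<in> ?C} \<in> sets random_oracle" by (intro oracle_force_sets C_sets) simp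
    from sets.Diff[OF G_sets this] show ?thesis by (rule back_subst[of "\<lambda>X. X \<in> sets random_oracle"]) auto
  qed
  \<comment> \<open>An oracle in \<open>?H p\<close> has no witness at length \<open>n\<close>;
    since blocks are disjoint, planting \<open>p\<close> creates no witness besides
    \<open>p\<close>.\<close>
  have single: "(1 / 2) ^ ?q * ro.prob (?H p) \<le> ro.prob (?U p \<inter> ?Y p)" if p: "p \<in> ?XW" for p
  proof -
    have "?H p \<subseteq> {\<omega>. ?\<phi> p \<omega> \<in> ?Y p}"
    proof
      fix \<omega> assume \<omega>: "\<omega> \<in> ?H p"
      have "?\<phi> p \<omega> \<notin> ?U p'" if p': "p' \<in> ?XW - {p}" for p'
      proof -
        have "\<omega> \<notin> ?U p'" using \<omega> p' by blast
        then obtain u where u: "u \<in> ?b p'" "\<not> \<omega> u" by blast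
        moreover have "?b p \<inter> ?b p' = {}"
          using p p' by (intro block_disjoint[of _ n]) (auto simp: words_def)
        ultimately show ?thesis by blast
      qed
      then show "\<omega> \<in> {\<omega>. ?\<phi> p \<omega> \<in> ?Y p}" using \<omega> \<phi>D[OF p, of \<omega>] by simp
    qed
    then have "ro.prob (?H p) \<le> ro.prob {\<omega>. ?\<phi> p \<omega> \<in> ?Y p}"
      by (intro ro.finite_measure_mono oracle_force_sets Y_sets finite_block)
    then show ?thesis unfolding force[OF p Y_sets] by (intro mult_left_mono) auto
  qed
  \<comment> \<open>Pointwise count of harmful plantings: at least half of the \<open>w\<close> for
    every \<open>x\<close>. Taking expectations turns it into the bound \<open>sumH\<close> on
    probabilities.\<close>
  have count: "2 ^ n * 2 ^ n / 2 * indicator ?G \<omega> \<le> (\<Sum>p\<in>?XW. indicator (?H p) \<omega> :: real)" for \<omega>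
  proof (cases "\<omega> \<in> ?G")
    case True
    have "2 ^ n * 2 ^ n / 2 = (\<Sum>x\<in>words n. 2 ^ n / 2 :: real)" by (simp add: card_words)
    also have "\<dots> \<le> (\<Sum>x\<in>words n. \<Sum>w\<in>words n. indicator (?H (x, w)) \<omega>)"
    proof (rule sum_mono)
      fix x assume x: "x \<in> words n"
      have "x \<notin> witness_lang k {u. \<omega> u}"
      proof
        assume "x \<in> witness_lang k {u. \<omega> u}"
        then obtain w where "w \<in> words n" "\<omega> \<in> ?U (x, w)"
          using x by (auto simp: witness_lang_def witness_def words_def)
        then show False using True x by blast
      qed
      then have "2 ^ n \<le> 2 * card {w \<in> words n. (\<lambda>u. u \<in> block k x w \<or> \<omega> u) \<notin> ?C}"
        using many_incorrect_witnesses[of V S n T \<epsilon> x \<omega> k, OF valid T \<epsilon> small x] True by auto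
      then have "real (2 ^ n) \<le> real (2 * card {w \<in> words n. (\<lambda>u. u \<in> block k x w \<or> \<omega> u) \<notin> ?C})"
        by (simp only: of_nat_le_iff)
      then have "2 ^ n / 2 \<le> real (card {w \<in> words n. (\<lambda>u. u \<in> block k x w \<or> \<omega> u) \<notin> ?C})"
        by simp
      also have "\<dots> = (\<Sum>w\<in>words n. indicator (?H (x, w)) \<omega>)"
        using True by (simp add: indicator_def sum.If_cases Int_def)
      finally show "2 ^ n / 2 \<le> (\<Sum>w\<in>words n. indicator (?H (x, w)) \<omega> :: real)" .
    qed
    also have "\<dots> = (\<Sum>p\<in>?XW. indicator (?H p) \<omega>)" by (simp add: sum.cartesian_product split_beta)
    finally show ?thesis using True by simp
  qed (simp add: sum_nonneg)
  have "2 ^ n * 2 ^ n / 2 * ro.prob ?G = ro.expectation (\<lambda>\<omega>. 2 ^ n * 2 ^ n / 2 * indicator ?G \<omega>)"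
    using G_sets by simp
  also have "\<dots> \<le> ro.expectation (\<lambda>\<omega>. \<Sum>p\<in>?XW. indicator (?H p) \<omega>)"
    using G_sets H_sets count by (intro integral_mono) (auto intro!: integrable_real_indicator simp: less_top[symmetric])
  also have "\<dots> = (\<Sum>p\<in>?XW. ro.prob (?H p))"
    using H_sets by (subst Bochner_Integration.integral_sum) (auto intro!: integrable_real_indicator simp: less_top[symmetric])
  finally have sumH: "2 ^ n * 2 ^ n / 2 * ro.prob ?G \<le> (\<Sum>p\<in>?XW. ro.prob (?H p))" .
  have "(1 / 2) ^ (k + 3) * ro.prob ?G = (1 / 2) ^ ?q * (2 ^ n * 2 ^ n / 2 * ro.prob ?G)"
    unfolding pow by (simp add: power_add power3_eq_cube)
  also have "\<dots> \<le> (1 / 2) ^ ?q * (\<Sum>p\<in>?XW. ro.prob (?H p))" using sumH by (intro mult_left_mono) auto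
  also have "\<dots> \<le> (\<Sum>p\<in>?XW. ro.prob (?U p \<inter> ?Y p))"
    unfolding sum_distrib_left by (intro sum_mono single)
  finally have e1: "(1 / 2) ^ (k + 3) * ro.prob ?G \<le> ro.prob (D - ?C)" using err by linarith

  \<comment> \<open>Union bound over the 2^(2n) pairs; each witness event is independent of the
    history by \<open>force\<close> and \<open>\<phi>D\<close>.\<close>
  have "ro.prob (D \<inter> (\<Union>p\<in>?XW. ?U p)) = ro.prob (\<Union>p\<in>?XW. ?U p \<inter> D)"
    by (rule arg_cong[where f = ro.prob]) auto
  also have "\<dots> \<le> (\<Sum>p\<in>?XW. ro.prob (?U p \<inter> D))"
    using U_sets D_sets by (intro ro.finite_measure_subadditive_finite fin) auto
  also have "\<dots> = (\<Sum>p\<in>?XW. (1 / 2) ^ ?q * ro.prob D)"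
    by (intro sum.cong refl) (simp add: force[OF _ D_sets] \<phi>D)
  also have "\<dots> = (1 / 2) ^ (k + 2) * ro.prob D" unfolding sum_constant cardXW pow by simp
  also have "\<dots> \<le> 1 / 4 * ro.prob D"
    using power_decreasing[of 2 "k + 2" "1 / 2 :: real"] by (intro mult_right_mono) (auto simp: power2_eq_square)
  finally have hit: "ro.prob (D \<inter> (\<Union>p\<in>?XW. ?U p)) \<le> 1 / 4 * ro.prob D" .
  have hit_sets: "D \<inter> (\<Union>p\<in>?XW. ?U p) \<in> sets random_oracle"
    using D_sets sets.finite_UN[OF fin U_sets] by (rule sets.Int)
  have DC_sets: "D - ?C \<in> sets random_oracle" using D_sets C_sets by (rule sets.Diff)
  have "D \<subseteq> (D \<inter> (\<Union>p\<in>?XW. ?U p)) \<union> ((D - ?C) \<union> ?G)" by auto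
  then have "ro.prob D \<le> ro.prob ((D \<inter> (\<Union>p\<in>?XW. ?U p)) \<union> ((D - ?C) \<union> ?G))"
    by (intro ro.finite_measure_mono sets.Un hit_sets DC_sets G_sets)
  also have "\<dots> \<le> ro.prob (D \<inter> (\<Union>p\<in>?XW. ?U p)) + ro.prob ((D - ?C) \<union> ?G)"
    by (intro measure_Un_le sets.Un hit_sets DC_sets G_sets)
  also have "ro.prob ((D - ?C) \<union> ?G) \<le> ro.prob (D - ?C) + ro.prob ?G"
    by (intro measure_Un_le DC_sets G_sets)
  finally have e2: "3 / 4 * ro.prob D \<le> ro.prob (D - ?C) + ro.prob ?G" using hit by linarith
  have dc: "ro.prob (D - ?C) = ro.prob D - ro.prob (D \<inter> ?C)"
    using D_sets C_sets by (rule ro.finite_measure_Diff')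
  \<comment> \<open>By \<open>e1\<close>, \<open>a\<close> times the mass of \<open>?G\<close> is at
    most the error mass; as a \<le> 1, \<open>e2\<close> gives an error mass of at least 3/8
    \<open>a\<close> times that of \<open>D\<close>. Lowering 3/8 to 1/4 makes it the power with
    exponent k + 5.\<close>
  define a where "a = (1 / 2 :: real) ^ (k + 3)"
  have a: "0 < a" "a \<le> 1" by (auto simp: a_def power_le_one)
  have "a * (3 / 4 * ro.prob D) \<le> a * (ro.prob (D - ?C) + ro.prob ?G)"
    using e2 a by (intro mult_left_mono) auto
  also have "\<dots> \<le> 2 * ro.prob (D - ?C)"
    using e1 a mult_right_mono[of a 1 "ro.prob (D - ?C)"] by (simp add: a_def[symmetric] distrib_left)
  finally have "a * (3 / 8 * ro.prob D) \<le> ro.prob (D - ?C)" by simp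
  moreover have "(1 / 2) ^ (k + 5) * ro.prob D = a * (1 / 4 * ro.prob D)"
    by (simp add: a_def power_add power_divide)
  moreover have "a * (1 / 4 * ro.prob D) \<le> a * (3 / 8 * ro.prob D)"
    using a by (intro mult_left_mono) auto
  ultimately have "(1 / 2) ^ (k + 5) * ro.prob D \<le> ro.prob (D - ?C)" by linarith
  then show ?thesis unfolding left_diff_distrib using dc by linarith
qed

text \<open>Lengths are chosen one after the other, each so large that all earlier events depend
  only on strings shorter than twice the new length; each choice multiplies the probability by
  \<open>?c\<close> < 1. The event is enclosed in a null set.\<close>

lemma correct_infinitely_null:
  assumes valid: "\<And>x. valid_verifier (V x)" "\<And>x. valid_simulator (V x) (S x)"
    and T: "\<And>x. circuit_size (V x) (S x) \<le> T x" "\<And>x. 0 < T x" and \<epsilon>: "\<And>n. 0 \<le> \<epsilon> n"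
    and small: "\<forall>\<^sub>F n in sequentially. \<forall>x\<in>words n.
      real (T x) ^ 2 * (18 * real (T x) ^ 3 / 2 ^ n + 2 * \<epsilon> n) < 1 / 144"
  shows "AE \<omega> in random_oracle. \<not> (\<forall>n\<ge>n0. \<omega> \<in> correct_at k V S (\<epsilon> n) n)"
proof -
  obtain n1 where n1: "\<And>n x. n \<ge> n1 \<Longrightarrow> x \<in> words n \<Longrightarrow>
      real (T x) ^ 2 * (18 * real (T x) ^ 3 / 2 ^ n + 2 * \<epsilon> n) < 1 / 144"
    using small by (auto simp: eventually_sequentially)
  let ?c = "1 - (1 / 2 :: real) ^ (k + 5)"
  let ?Q = "{\<omega>. \<forall>n\<ge>n0. \<omega> \<in> correct_at k V S (\<epsilon> n) n}"
  have c: "0 \<le> ?c" "?c < 1" by (auto simp: power_le_one)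
  have ex: "\<exists>N D. depends_on {u. length u < N} D \<and> ?Q \<subseteq> D \<and> ro.prob D \<le> ?c ^ m" for m
  proof (induction m)
    case 0
    have "depends_on {u. length u < 0} UNIV" by (simp add: depends_on_def)
    then show ?case by (intro exI[of _ 0] exI[of _ UNIV]) auto
  next
    case (Suc m)
    then obtain N D where D: "depends_on {u. length u < N} D" "?Q \<subseteq> D" "ro.prob D \<le> ?c ^ m" by blast
    \<comment> \<open>Past \<open>n0\<close> the event \<open>?Q\<close> demands correctness, past
      \<open>n1\<close> the parameters are small, and past \<open>N\<close> the history
      \<open>D\<close> is decided below length 2n.\<close>
    define n where "n = Max {n0, n1, N}"
    have n: "n0 \<le> n" "n1 \<le> n" "N \<le> n" by (auto simp: n_def)
    obtain N' where N': "depends_on {u. length u < N'} (correct_at k V S (\<epsilon> n) n)"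
      using correct_at_depends_on[of V S, OF valid] by blast
    let ?D = "D \<inter> correct_at k V S (\<epsilon> n) n"
    have "depends_on {u. length u < max N N'} ?D"
      by (intro depends_on_Int depends_on_mono[OF D(1)] depends_on_mono[OF N']) auto
    moreover have "?Q \<subseteq> ?D" using D(2) n(1) by auto
    moreover have "ro.prob ?D \<le> ?c * ro.prob D"
      using n n1 by (intro prob_correct_decay[where T = T] valid T \<epsilon> depends_on_mono[OF D(1)]) auto
    then have "ro.prob ?D \<le> ?c ^ Suc m"
      using mult_left_mono[OF D(3) c(1)] by simp
    ultimately show ?case by blast
  qed
  have "\<forall>m. \<exists>D. D \<in> sets random_oracle \<and> ?Q \<subseteq> D \<and> ro.prob D \<le> ?c ^ m"
  proof
    fix m
    from ex[of m] obtain N D where "depends_on {u. length u < N} D" "?Q \<subseteq> D" "ro.prob D \<le> ?c ^ m"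
      by (elim exE conjE)
    then show "\<exists>D. D \<in> sets random_oracle \<and> ?Q \<subseteq> D \<and> ro.prob D \<le> ?c ^ m"
      by (intro exI[of _ D] conjI depends_on_sets[OF finite_short_words])
  qed
  from choice[OF this] obtain D where Ds: "\<And>m. D m \<in> sets random_oracle" and
    D: "\<And>m. ?Q \<subseteq> D m" "\<And>m. ro.prob (D m) \<le> ?c ^ m" by blast
  let ?I = "\<Inter>m. D m"
  have Is: "?I \<in> sets random_oracle" using Ds by auto
  have bound: "ro.prob ?I \<le> ?c ^ m" for m
  proof -
    have "ro.prob ?I \<le> ro.prob (D m)" using Ds by (intro ro.finite_measure_mono) auto
    then show ?thesis using D(2)[of m] by linarith
  qed
  have "(\<lambda>m. ?c ^ m) \<longlonglongrightarrow> 0" using c by (intro LIMSEQ_realpow_zero)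
  then have "ro.prob ?I \<le> 0" by (rule LIMSEQ_le_const) (use bound in blast)
  then have "?I \<in> null_sets random_oracle"
    using Is by (intro null_setsI) (simp_all add: ro.emeasure_eq_measure measure_le_0_iff)
  then show ?thesis using D(1) by (intro AE_I') auto
qed

text \<open>A countable union of null events, over uniform families and thresholds
  \<open>n0\<close>: the exponent \<open>K\<close> is a function of the family, and
  \<open>n0\<close> absorbs the choice of the negligible function.\<close>

lemma witness_lang_not_in_QSZK:
  "AE \<omega> in random_oracle. witness_lang k {u. \<omega> u} \<notin> QSZK {u. \<omega> u}"
proof -
  let ?VS = "{V. polytime_uniform verifier_code V} \<times> {S. polytime_uniform simulator_code S}"
  define bad where "bad p K n0 \<omega> \<longleftrightarrow> (\<forall>n\<ge>n0. \<omega> \<in> correct_at k (fst p) (snd p) (1 / real n ^ K) n)"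
    for p :: "(bool list \<Rightarrow> verifier) \<times> (bool list \<Rightarrow> simulator)" and K n0 :: nat and \<omega>
  define ok where "ok p \<longleftrightarrow> (\<forall>x. valid_verifier (fst p x) \<and> valid_simulator (fst p x) (snd p x))"
    for p :: "(bool list \<Rightarrow> verifier) \<times> (bool list \<Rightarrow> simulator)"
  have cnt: "countable ?VS"
    by (intro countable_SIGMA countable_polytime_uniform verifier_code_inject simulator_code_inject)
  have "\<exists>K. \<forall>n0. AE \<omega> in random_oracle. \<not> bad p K n0 \<omega>" if p: "p \<in> ?VS" "ok p" for p
  proof -
    obtain V S where VS: "p = (V, S)" by fastforce
    have pt: "polytime_computable (\<lambda>x. encode (verifier_code (V x)))"
      "polytime_computable (\<lambda>x. encode (simulator_code (S x)))"
      using p by (auto simp: VS polytime_uniform_def)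
    obtain pv ps :: "nat poly" where len: "\<And>x. length (encode (verifier_code (V x))) \<le> poly pv (length x)"
      "\<And>x. length (encode (simulator_code (S x))) \<le> poly ps (length x)"
      using polytime_computable_length[OF pt(1)] polytime_computable_length[OF pt(2)] by blast
    \<comment> \<open>The summand 1 keeps the size bound positive.\<close>
    define p' where "p' = pv + ps + 1"
    let ?T = "\<lambda>x. poly p' (length x)"
    obtain K where K: "\<forall>\<^sub>F n in sequentially. \<forall>T. T \<le> poly p' n \<longrightarrow>
        real T ^ 2 * (18 * real T ^ 3 / 2 ^ n + 2 * (1 / real n ^ K)) < 1 / 144"
      using eventually_parameters_small by blast
    have size: "circuit_size (V x) (S x) \<le> ?T x" for x
      using len[of x] length_verifier_code[of "V x"] length_simulator_code[of "S x"]
      by (simp add: circuit_size_def p'_def)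
    have "AE \<omega> in random_oracle. \<not> (\<forall>n\<ge>n0. \<omega> \<in> correct_at k V S (1 / real n ^ K) n)" for n0
    proof (rule correct_infinitely_null[where T = ?T])
      show "\<forall>\<^sub>F n in sequentially. \<forall>x\<in>words n.
        real (?T x) ^ 2 * (18 * real (?T x) ^ 3 / 2 ^ n + 2 * (1 / real n ^ K)) < 1 / 144"
        using K by eventually_elim (simp add: words_def)
    qed (use p size in \<open>auto simp: ok_def VS p'_def\<close>)
    then show ?thesis by (auto simp: bad_def VS)
  qed
  then obtain K where K: "\<And>p n0. p \<in> ?VS \<Longrightarrow> ok p \<Longrightarrow> AE \<omega> in random_oracle. \<not> bad p (K p) n0 \<omega>"
    by metis
  have "AE \<omega> in random_oracle. \<forall>p\<in>?VS. ok p \<longrightarrow> (\<forall>n0. \<not> bad p (K p) n0 \<omega>)"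
    unfolding AE_ball_countable[OF cnt] by (auto simp: AE_all_countable K)
  then show ?thesis
  proof eventually_elim
    case (elim \<omega>)
    let ?A = "{u. \<omega> u}" and ?L = "witness_lang k {u. \<omega> u}"
    show ?case
    proof
      assume "?L \<in> QSZK ?A"
      then obtain V S \<delta> where *: "\<And>x. valid_verifier (V x) \<and> valid_simulator (V x) (S x)"
        "polytime_uniform verifier_code V" "polytime_uniform simulator_code S" and \<delta>: "negligible \<delta>"
        and zk: "\<And>x. x \<in> ?L \<Longrightarrow> \<exists>P. valid_prover (V x) P \<and> accept_prob ?A (V x) P \<ge> 2 / 3 \<and>
          (\<forall>j \<le> 2 * rounds (V x).
           trace_distance (simulated_view ?A (V x) (S x) j) (view ?A (V x) P j) \<le> \<delta> (length x))"
        and snd: "\<And>x P. x \<notin> ?L \<Longrightarrow> valid_prover (V x) P \<Longrightarrow> accept_prob ?A (V x) P \<le> 1 / 3"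
        unfolding QSZK_def by blast
      let ?p = "(V, S)"
      obtain n0 where n0: "\<And>n. n \<ge> n0 \<Longrightarrow> \<bar>\<delta> n\<bar> < 1 / real n ^ K ?p"
        using \<delta> unfolding negligible_def eventually_sequentially by blast
      have "bad ?p (K ?p) n0 \<omega>"
        unfolding bad_def
      proof (intro allI impI)
        fix n assume "n0 \<le> n"
        then have le: "\<delta> n \<le> 1 / real n ^ K ?p" using n0[of n] by linarith
        have "zk_at ?A (V x) (S x) (1 / real n ^ K ?p)" if "x \<in> words n" "x \<in> ?L" for x
          using zk[OF that(2)] that(1) le unfolding zk_at_def words_def by (blast intro: order_trans)
        moreover have "sound_at ?A (V x)" if "x \<notin> ?L" for x using snd that by (simp add: sound_at_def)
        ultimately show "\<omega> \<in> correct_at k (fst ?p) (snd ?p) (1 / real n ^ K ?p) n"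
          by (simp add: correct_at_def)
      qed
      moreover have "?p \<in> ?VS" "ok ?p" using * by (auto simp: ok_def)
      ultimately show False using elim by blast
    qed
  qed
qed

theorem theorem5:
  shows "AE \<omega> in random_oracle. \<not> UP {w. \<omega> w} \<subseteq> QSZK {w. \<omega> w}"
proof -
  \<comment> \<open>All \<open>k\<close> are excluded simultaneously because the \<open>k\<close>
    supplied by \<open>AE_unambiguous\<close> depends on the oracle.\<close>
  have "AE \<omega> in random_oracle. \<forall>k. witness_lang k {u. \<omega> u} \<notin> QSZK {u. \<omega> u}"
    unfolding AE_all_countable using witness_lang_not_in_QSZK by blast
  with AE_unambiguous show ?thesis
    by eventually_elim blast
qed

end
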